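(* Let $V$ be a simple Euclidean Jordan algebra of rank $r>1$ with off-diagonal Peirce dimension $d$, and assume $r>2$ or $d>1$. For every $m\in\mathbb N$ the space $\mathcal H^m(\mathbb S)^{K^L_{c_1}}$ of $K^L_{c_1}$-invariant harmonics of degree $m$ is one-dimensional and spanned by the function $\varphi_m\in\mathcal H^m(\mathbb S)$ given by $$\varphi_m(x)={}_2F_1\big(-m,\,m+r\lambda-1;\,\lambda;\,(x|c_1)\big),\qquad x\in\mathbb S,$$ where $\lambda=\frac d2$.
   Context: $V$ has unit $\mathbf e$, trace form $(x|y)=\operatorname{tr}(xy)$, $|x|=(x|x)^{1/2}$, multiplication operators $L(x)$, $P(x,y)=L(x)L(y)+L(y)L(x)-L(xy)$. $L=\operatorname{Str}(V)_0$ is the identity component of the structure group, $K^L=\{g\in L:g\mathbf e=\mathbf e\}$, $c_1$ a primitive idempotent, $K^L_{c_1}$ the stabilizer of $c_1$ in $K^L$, $\Xi=L\cdot c_1$, $\mathbb S=\{x\in\Xi:|x|=1\}=K^L\cdot c_1$. The Bessel operator $\mathcal Bf=\sum_{\alpha,\beta}\frac{\partial^2f}{\partial x_\alpha\partial x_\beta}P(e_\alpha,e_\beta)x+\lambda\sum_\alpha\frac{\partial f}{\partial x_\alpha}e_\alpha$ (orthonormal basis $(e_\alpha)$ of $V$) is tangential to $\Xi$, $\mathcal B_{\mathbf e}=(\mathbf e|\mathcal B)$. $\mathcal P^m(\Xi)$ = restrictions to $\Xi$ of complex-valued homogeneous polynomials of degree $m$ on $V$; $\mathcal H^m(\Xi)=\{p\in\mathcal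 P^m(\Xi):\mathcal B_{\mathbf e}p=0\}$; $\mathcal H^m(\mathbb S)=\{p|_{\mathbb S}:p\in\mathcal H^m(\Xi)\}$, on which $K^L$ acts by $(k\cdot p)(x)=p(k^{-1}x)$. ${}_2F_1(a,b;c;z)=\sum_k\frac{(a)_k(b)_k}{k!(c)_k}z^k$ (a polynomial here). *)

theory Defs
  imports "HOL-Analysis.Analysis" "HOL-Library.Function_Algebras"
begin

section \<open>Simple Euclidean Jordan algebras\<close>

text \<open>
  A Euclidean Jordan algebra is a finite-dimensional real unital Jordan algebra together with an
  inner product for which all multiplication operators are symmetric; here this is the inner
  product of the type. It is not assumed to be the trace form, which is defined below
  and is the form used in everything that follows.
\<close>

locale euclidean_jordan_algebra =
  fixes jp :: "'a::euclidean_space \<Rightarrow> 'a \<Rightarrow> 'a" (infixl \<open>\<diamondop>\<close> 70)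
    and e :: 'a
  assumes bilinear_jp: "bilinear (\<diamondop>)"
    and commute: "x \<diamondop> y = y \<diamondop> x"
    and jordan: "x \<diamondop> ((x \<diamondop> x) \<diamondop> y) = (x \<diamondop> x) \<diamondop> (x \<diamondop> y)"
    and unit: "e \<diamondop> x = x"
    and inner_assoc: "(x \<diamondop> y) \<bullet> z = y \<bullet> (x \<diamondop> z)"

locale simple_euclidean_jordan_algebra = euclidean_jordan_algebra +
  assumes simple: "\<lbrakk>subspace I; \<And>x y. y \<in> I \<Longrightarrow> x \<diamondop> y \<in> I\<rbrakk> \<Longrightarrow> I = {0} \<or> I = UNIV"

context
  fixes jp :: "'a::euclidean_space \<Rightarrow> 'a \<Rightarrow> 'a" (infixl \<open>\<diamondop>\<close> 70)
    and e :: 'a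
begin

subsection \<open>Rank, trace, Peirce dimension\<close>

definition jpow :: "'a \<Rightarrow> nat \<Rightarrow> 'a" where
  "jpow x k = (((\<diamondop>) x) ^^ k) e"

text \<open>The degree of the minimal polynomial of an element.\<close>

definition jdegree :: "'a \<Rightarrow> nat" where
  "jdegree x = (LEAST k. jpow x k \<in> span (jpow x ` {..<k}))"

definition jrank :: nat where
  "jrank = Max (range jdegree)"

definition regular :: "'a \<Rightarrow> bool" where
  "regular x \<longleftrightarrow> jdegree x = jrank"

text \<open>
  The minimal polynomial of a regular element \<open>x\<close> is
  \<open>T^r - a\<^sub>1(x) T^(r-1) + a\<^sub>2(x) T^(r-2) - \<dots>\<close>, where \<open>a\<^sub>j\<close> is a homogeneous polynomial of degree
  \<open>j\<close> on the whole algebra; the trace is the linear form \<open>a\<^sub>1\<close>. It is determined by its values on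
  regular elements because these are dense.
\<close>

definition jtrace :: "'a \<Rightarrow> real" where
  "jtrace = (THE t. linear t \<and>
     (\<forall>x. regular x \<longrightarrow>
        jpow x jrank - t x *\<^sub>R jpow x (jrank - 1) \<in> span (jpow x ` {..<jrank - 1})))"

definition tform :: "'a \<Rightarrow> 'a \<Rightarrow> real" where
  "tform x y = jtrace (x \<diamondop> y)"

definition tnorm :: "'a \<Rightarrow> real" where
  "tnorm x = sqrt (tform x x)"

definition trace_orthonormal_basis :: "'a set \<Rightarrow> bool" where
  "trace_orthonormal_basis E \<longleftrightarrow>
     span E = UNIV \<and> (\<forall>a\<in>E. \<forall>b\<in>E. tform a b = (if a = b then 1 else 0))"

definition primitive_idempotent :: "'a \<Rightarrow> bool" where
  "primitive_idempotent c \<longleftrightarrow> c \<noteq> 0 \<and> c \<diamondop> c = c \<and>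
     (\<forall>a b. a \<diamondop> a = a \<and> b \<diamondop> b = b \<and> a + b = c \<longrightarrow> a = 0 \<or> b = 0)"

definition jordan_frame :: "'a set \<Rightarrow> bool" where
  "jordan_frame C \<longleftrightarrow> finite C \<and> (\<forall>c\<in>C. primitive_idempotent c) \<and>
     (\<forall>a\<in>C. \<forall>b\<in>C. a \<noteq> b \<longrightarrow> a \<diamondop> b = 0) \<and> (\<Sum>c\<in>C. c) = e"

definition offdiag_peirce_space :: "'a \<Rightarrow> 'a \<Rightarrow> 'a set" where
  "offdiag_peirce_space a b = {x. a \<diamondop> x = (1/2) *\<^sub>R x \<and> b \<diamondop> x = (1/2) *\<^sub>R x}"

text \<open>
  In a simple algebra of rank at least two all off-diagonal Peirce spaces, for all Jordan frames,
  have the same positive dimension.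
\<close>

definition offdiag_peirce_dim :: nat where
  "offdiag_peirce_dim = (THE d. \<forall>C. jordan_frame C \<longrightarrow>
     (\<forall>a\<in>C. \<forall>b\<in>C. a \<noteq> b \<longrightarrow> dim (offdiag_peirce_space a b) = d))"

subsection \<open>The structure group and the orbit of a primitive idempotent\<close>

definition P2 :: "'a \<Rightarrow> 'a \<Rightarrow> 'a \<Rightarrow> 'a" where
  "P2 x y z = x \<diamondop> (y \<diamondop> z) + y \<diamondop> (x \<diamondop> z) - (x \<diamondop> y) \<diamondop> z"

text \<open>\<open>P(g x) = g P(x) g\<^sup>*\<close>, where \<open>P(x) = P(x,x)\<close> and \<open>h = g\<^sup>*\<close> is the adjoint of \<open>g\<close> for the
  trace form.\<close>

definition structure_group :: "('a \<Rightarrow>\<^sub>L 'a) set" where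
  "structure_group = {g. bij (blinfun_apply g) \<and>
     (\<exists>h :: 'a \<Rightarrow>\<^sub>L 'a.
        (\<forall>x y. tform (blinfun_apply g x) y = tform x (blinfun_apply h y)) \<and>
        (\<forall>x. P2 (blinfun_apply g x) (blinfun_apply g x) =
           blinfun_apply g \<circ> P2 x x \<circ> blinfun_apply h))}"

definition str_group0 :: "('a \<Rightarrow>\<^sub>L 'a) set" where
  "str_group0 = connected_component_set structure_group id_blinfun"

definition KL :: "('a \<Rightarrow>\<^sub>L 'a) set" where
  "KL = {g \<in> str_group0. blinfun_apply g e = e}"

definition KL_stab :: "'a \<Rightarrow> ('a \<Rightarrow>\<^sub>L 'a) set" where
  "KL_stab c = {g \<in> KL. blinfun_apply g c = c}"

definition Xi :: "'a \<Rightarrow> 'a set" where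
  "Xi c = (\<lambda>g. blinfun_apply g c) ` str_group0"

definition SS :: "'a \<Rightarrow> 'a set" where
  "SS c = {x \<in> Xi c. tnorm x = 1}"

subsection \<open>The Bessel operator\<close>

definition partial :: "'a \<Rightarrow> ('a \<Rightarrow> real) \<Rightarrow> 'a \<Rightarrow> real" where
  "partial v f x = frechet_derivative f (at x) v"

definition bessel :: "'a set \<Rightarrow> real \<Rightarrow> ('a \<Rightarrow> real) \<Rightarrow> 'a \<Rightarrow> 'a" where
  "bessel E lam f x =
     (\<Sum>a\<in>E. \<Sum>b\<in>E. partial a (partial b f) x *\<^sub>R P2 a b x) +
     lam *\<^sub>R (\<Sum>a\<in>E. partial a f x *\<^sub>R a)"

text \<open>The component \<open>(e|\<B>)\<close>, extended complex-linearly to complex-valued functions.\<close>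

definition bessel_e :: "'a set \<Rightarrow> real \<Rightarrow> ('a \<Rightarrow> complex) \<Rightarrow> 'a \<Rightarrow> complex" where
  "bessel_e E lam f x =
     Complex (tform e (bessel E lam (\<lambda>y. Re (f y)) x)) (tform e (bessel E lam (\<lambda>y. Im (f y)) x))"

end

section \<open>Harmonics\<close>

text \<open>Functions on a subset \<open>A\<close> are represented by functions on the whole type that vanish
  off \<open>A\<close>.\<close>

definition restr :: "'a set \<Rightarrow> ('a \<Rightarrow> complex) \<Rightarrow> 'a \<Rightarrow> complex" where
  "restr A f = (\<lambda>x. if x \<in> A then f x else 0)"

definition homogeneous_poly :: "nat \<Rightarrow> ('a::euclidean_space \<Rightarrow> complex) set" where
  "homogeneous_poly m =
     {q. polynomial_function q \<and> (\<forall>t x. q (t *\<^sub>R x) = of_real t ^ m * q x)}"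

context
  fixes jp :: "'a::euclidean_space \<Rightarrow> 'a \<Rightarrow> 'a" (infixl \<open>\<diamondop>\<close> 70)
    and e :: 'a
begin

definition polys_Xi :: "'a \<Rightarrow> nat \<Rightarrow> ('a \<Rightarrow> complex) set" where
  "polys_Xi c m = restr (Xi (\<diamondop>) e c) ` homogeneous_poly m"

text \<open>
  The operator \<open>(e|\<B>)\<close> acts on a function on \<open>\<Xi>\<close> through a polynomial extension. The operator is
  tangential to \<open>\<Xi>\<close> (for \<open>lam\<close> half the Peirce dimension), so the choice of the extension
  is immaterial.
\<close>

definition harmonics_Xi :: "'a set \<Rightarrow> real \<Rightarrow> 'a \<Rightarrow> nat \<Rightarrow> ('a \<Rightarrow> complex) set" where
  "harmonics_Xi E lam c m =
     {p \<in> polys_Xi c m. \<exists>q \<in> homogeneous_poly m. p = restr (Xi (\<diamondop>) e c) q \<and>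
        (\<forall>x \<in> Xi (\<diamondop>) e c. bessel_e (\<diamondop>) e E lam q x = 0)}"

definition harmonics_SS :: "'a set \<Rightarrow> real \<Rightarrow> 'a \<Rightarrow> nat \<Rightarrow> ('a \<Rightarrow> complex) set" where
  "harmonics_SS E lam c m = restr (SS (\<diamondop>) e c) ` harmonics_Xi E lam c m"

definition invariant_harmonics_SS :: "'a set \<Rightarrow> real \<Rightarrow> 'a \<Rightarrow> nat \<Rightarrow> ('a \<Rightarrow> complex) set" where
  "invariant_harmonics_SS E lam c m =
     {p \<in> harmonics_SS E lam c m.
        \<forall>k \<in> KL_stab (\<diamondop>) e c. (\<lambda>x. p (inv (blinfun_apply k) x)) = p}"

end

definition hyp2F1 :: "real \<Rightarrow> real \<Rightarrow> real \<Rightarrow> real \<Rightarrow> real" where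
  "hyp2F1 a b c z =
     (\<Sum>k. pochhammer a k * pochhammer b k / (fact k * pochhammer c k) * z ^ k)"

definition cscale :: "complex \<Rightarrow> ('a \<Rightarrow> complex) \<Rightarrow> 'a \<Rightarrow> complex" where
  "cscale z f = (\<lambda>x. z * f x)"

lemma vector_space_cscale: "vector_space cscale"
  by unfold_locales (auto simp: cscale_def fun_eq_iff algebra_simps)

end

theory Submission
  imports Defs "HOL-Computational_Algebra.Polynomial"
begin

text \<open>
  The orbit of a primitive idempotent consists of the positive multiples of all primitive
  idempotents, and the group elements needed are products of two Peirce reflections
  \<open>1 - 8 L(p) + 8 L(p)\<^sup>2\<close>, moved to the identity along an arc of primitive idempotents; neither the
  exponential map nor the fundamental formula enters. The stabilizer of \<open>c\<close> is transitive on the pairs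
  \<open>(j, z)\<close> with \<open>j\<close> primitive and orthogonal to \<open>c\<close> and \<open>z\<close> in their common off-diagonal Peirce space,
  \<open>z\<^sup>2 = c + j\<close>. Every point of the orbit is a positive multiple of some \<open>a\<^sup>2 c + b\<^sup>2 j + a b z\<close>, so the
  restriction of an invariant polynomial to the orbit is a polynomial in \<open>a\<close> and \<open>b\<close> that does not depend on
  \<open>(j, z)\<close> and is even in \<open>b\<close>, that is, a polynomial in \<open>\<xi> = (x|c)\<close> and \<open>\<tau> = (x|e)\<close>. On these
  \<open>(e|\<B>)\<close> acts by
  \<open>\<xi>\<^sup>k \<tau>\<^sup>l \<mapsto> k (k - 1 + \<lambda>) \<xi>\<^sup>k\<^sup>-\<^sup>1 \<tau>\<^sup>l + l (l - 1 + 2 k + r \<lambda>) \<xi>\<^sup>k \<tau>\<^sup>l\<^sup>-\<^sup>1\<close>,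
  which turns harmonicity into the hypergeometric recursion.
\<close>

text \<open>Two features of the definitions shape the proof. First, the group is an identity
  component. A single reflection need not be connected to the identity, but a product of two becomes
  the identity when the two idempotents coincide, so a path of primitive idempotents is all that is
  needed. Second, harmonicity is tested on some polynomial extension, while an invariant polynomial
  agrees with a polynomial in \<xi> and \<tau> only on the orbit. Hence tangentiality has to be
  proved before the recursion can be read off. This is where \<lambda> = d/2 comes from: at a
  multiple of p, each of the d basis vectors of an off-diagonal space of p and j contributes -1/2
  times the derivative along j, and these terms cancel \<lambda> times the derivative along e. The
  inner product of the type is not assumed to be the trace form, but simplicity gives all primitive
  idempotents the same norm, which makes it a multiple of the trace form; most computations
  therefore use it directly.\<close>

lemma vector_inner_eqI: "(\<And>w. x \<bullet> w = y \<bullet> w) \<Longrightarrow> x = (y::'a::euclidean_space)"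
  by (metis vector_eq_rdot)

section \<open>Linearizations of the Jordan identity\<close>

context euclidean_jordan_algebra
begin

sublocale jp: bounded_bilinear "(\<diamondop>)"
  using bilinear_jp by (simp add: bilinear_conv_bounded_bilinear)

lemmas jp_simps = jp.add_left jp.add_right jp.diff_left jp.diff_right jp.scaleR_left
  jp.scaleR_right jp.minus_left jp.minus_right jp.zero_left jp.zero_right

declare jp.zero_left [simp] jp.zero_right [simp]

lemma unit_right: "x \<diamondop> e = x"
  using commute unit by metis

lemma inner_self_adjoint: "(x \<diamondop> y) \<bullet> z = (x \<diamondop> z) \<bullet> y"
  using inner_assoc[of x y z] inner_commute by metis

lemma jordan_polar2:
  "z \<diamondop> ((x \<diamondop> x) \<diamondop> y) + 2 *\<^sub>R (x \<diamondop> ((x \<diamondop> z) \<diamondop> y)) =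
   2 *\<^sub>R ((x \<diamondop> z) \<diamondop> (x \<diamondop> y)) + (x \<diamondop> x) \<diamondop> (z \<diamondop> y)"
proof (rule vector_inner_eqI)
  fix w
  \<comment> \<open>The identity at x + z minus the one at x - z keeps the terms odd in z, and 3
    removes the cubic one. Pairing with \<open>w\<close> turns a vector identity into linear
    arithmetic over the reals, a device used throughout.\<close>
  have 1: "((x + z) \<diamondop> (((x + z) \<diamondop> (x + z)) \<diamondop> y)) \<bullet> w = (((x + z) \<diamondop> (x + z)) \<diamondop> ((x + z) \<diamondop> y)) \<bullet> w"
    and 2: "((x - z) \<diamondop> (((x - z) \<diamondop> (x - z)) \<diamondop> y)) \<bullet> w = (((x - z) \<diamondop> (x - z)) \<diamondop> ((x - z) \<diamondop> y)) \<bullet> w"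
    and 3: "(z \<diamondop> ((z \<diamondop> z) \<diamondop> y)) \<bullet> w = ((z \<diamondop> z) \<diamondop> (z \<diamondop> y)) \<bullet> w"
    by (simp_all only: jordan)
  show "(z \<diamondop> ((x \<diamondop> x) \<diamondop> y) + 2 *\<^sub>R (x \<diamondop> ((x \<diamondop> z) \<diamondop> y))) \<bullet> w =
   (2 *\<^sub>R ((x \<diamondop> z) \<diamondop> (x \<diamondop> y)) + (x \<diamondop> x) \<diamondop> (z \<diamondop> y)) \<bullet> w"
    using 1 2 3 by (simp add: jp_simps inner_simps commute[of z x])
qed

lemma jordan_polar3:
  "z \<diamondop> ((x \<diamondop> w) \<diamondop> y) + x \<diamondop> ((w \<diamondop> z) \<diamondop> y) + w \<diamondop> ((x \<diamondop> z) \<diamondop> y) =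
   (x \<diamondop> z) \<diamondop> (w \<diamondop> y) + (w \<diamondop> z) \<diamondop> (x \<diamondop> y) + (x \<diamondop> w) \<diamondop> (z \<diamondop> y)"
proof (rule vector_inner_eqI)
  fix v
  have "(z \<diamondop> (((x + w) \<diamondop> (x + w)) \<diamondop> y) + 2 *\<^sub>R ((x + w) \<diamondop> (((x + w) \<diamondop> z) \<diamondop> y))) \<bullet> v =
   (2 *\<^sub>R (((x + w) \<diamondop> z) \<diamondop> ((x + w) \<diamondop> y)) + ((x + w) \<diamondop> (x + w)) \<diamondop> (z \<diamondop> y)) \<bullet> v"
    and "(z \<diamondop> ((x \<diamondop> x) \<diamondop> y) + 2 *\<^sub>R (x \<diamondop> ((x \<diamondop> z) \<diamondop> y))) \<bullet> v =
   (2 *\<^sub>R ((x \<diamondop> z) \<diamondop> (x \<diamondop> y)) + (x \<diamondop> x) \<diamondop> (z \<diamondop> y)) \<bullet> v"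
    and "(z \<diamondop> ((w \<diamondop> w) \<diamondop> y) + 2 *\<^sub>R (w \<diamondop> ((w \<diamondop> z) \<diamondop> y))) \<bullet> v =
   (2 *\<^sub>R ((w \<diamondop> z) \<diamondop> (w \<diamondop> y)) + (w \<diamondop> w) \<diamondop> (z \<diamondop> y)) \<bullet> v"
    by (simp_all only: jordan_polar2)
  then show "(z \<diamondop> ((x \<diamondop> w) \<diamondop> y) + x \<diamondop> ((w \<diamondop> z) \<diamondop> y) + w \<diamondop> ((x \<diamondop> z) \<diamondop> y)) \<bullet> v =
   ((x \<diamondop> z) \<diamondop> (w \<diamondop> y) + (w \<diamondop> z) \<diamondop> (x \<diamondop> y) + (x \<diamondop> w) \<diamondop> (z \<diamondop> y)) \<bullet> v"
    by (simp add: jp_simps inner_simps commute[of w x])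
qed

text \<open>The fully polarized identity with y and w exchanged, read as an operator identity:
  multiplication by a triple product is expressed through multiplications by its factors and their
  pairwise products. For powers of one element it is the recursion behind
  \<open>pw_commute\<close>.\<close>

lemma mult_triple:
  "((x \<diamondop> z) \<diamondop> w) \<diamondop> y = (x \<diamondop> z) \<diamondop> (w \<diamondop> y) + (w \<diamondop> z) \<diamondop> (x \<diamondop> y) + (x \<diamondop> w) \<diamondop> (z \<diamondop> y)
     - z \<diamondop> (w \<diamondop> (x \<diamondop> y)) - x \<diamondop> (w \<diamondop> (z \<diamondop> y))"
proof -
  have "z \<diamondop> ((x \<diamondop> y) \<diamondop> w) + x \<diamondop> ((y \<diamondop> z) \<diamondop> w) + y \<diamondop> ((x \<diamondop> z) \<diamondop> w) =
   (x \<diamondop> z) \<diamondop> (w \<diamondop> y) + (w \<diamondop> z) \<diamondop> (x \<diamondop> y) + (x \<diamondop> w) \<diamondop> (z \<diamondop> y)"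
  proof -
    have "w \<diamondop> z = z \<diamondop> w" "y \<diamondop> w = w \<diamondop> y" "y \<diamondop> z = z \<diamondop> y" "(x \<diamondop> w) \<diamondop> (z \<diamondop> y) = (z \<diamondop> y) \<diamondop> (x \<diamondop> w)"
      "(x \<diamondop> y) \<diamondop> (z \<diamondop> w) = (z \<diamondop> w) \<diamondop> (x \<diamondop> y)"
      by (simp_all only: commute)
    then show ?thesis using jordan_polar3[of z x y w] by simp
  qed
  moreover have "y \<diamondop> ((x \<diamondop> z) \<diamondop> w) = ((x \<diamondop> z) \<diamondop> w) \<diamondop> y" "(x \<diamondop> y) \<diamondop> w = w \<diamondop> (x \<diamondop> y)" "(y \<diamondop> z) \<diamondop> w = w \<diamondop> (z \<diamondop> y)"
    by (simp_all add: commute)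
  ultimately show ?thesis by (simp add: algebra_simps)
qed

subsection \<open>Peirce decomposition\<close>

definition peirce :: "'a \<Rightarrow> real \<Rightarrow> 'a set" where
  "peirce c s = {x. c \<diamondop> x = s *\<^sub>R x}"

lemma mem_peirce: "x \<in> peirce c s \<longleftrightarrow> c \<diamondop> x = s *\<^sub>R x"
  by (simp add: peirce_def)

lemma subspace_peirce: "subspace (peirce c s)"
  by (auto simp: subspace_def peirce_def jp_simps scaleR_add_right)

lemma peirce_orthogonal: "x \<in> peirce c s \<Longrightarrow> y \<in> peirce c t \<Longrightarrow> s \<noteq> t \<Longrightarrow> x \<bullet> y = 0"
  using inner_self_adjoint[of c x y] by (auto simp: mem_peirce inner_commute)

text \<open>The polynomial in L(c) with value 1 at the eigenvalues 0 and 1 and value -1 at 1/2. For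
  an idempotent c it is the quadratic representation at e - 2c.\<close>

definition reflect :: "'a \<Rightarrow> 'a \<Rightarrow> 'a" where
  "reflect c x = x - 8 *\<^sub>R (c \<diamondop> x) + 8 *\<^sub>R (c \<diamondop> (c \<diamondop> x))"

lemma bounded_linear_reflect: "bounded_linear (reflect c)"
  unfolding reflect_def
  by (intro bounded_linear_add bounded_linear_sub bounded_linear_ident
      bounded_linear_const_scaleR bounded_linear_compose[OF jp.bounded_linear_right]
      jp.bounded_linear_right)

lemmas reflect_simps = linear_add[OF bounded_linear.linear[OF bounded_linear_reflect]]
  linear_diff[OF bounded_linear.linear[OF bounded_linear_reflect]]
  linear_scale[OF bounded_linear.linear[OF bounded_linear_reflect]]
  linear_neg[OF bounded_linear.linear[OF bounded_linear_reflect]]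

lemma reflect_half: "x \<in> peirce c (1/2) \<Longrightarrow> reflect c x = - x"
  by (rule vector_inner_eqI) (simp add: mem_peirce reflect_def jp_simps inner_simps)

lemma reflect_fix: "c \<diamondop> (c \<diamondop> x) = c \<diamondop> x \<Longrightarrow> reflect c x = x"
  by (simp add: reflect_def)

lemma reflect_self_adjoint: "reflect c x \<bullet> y = x \<bullet> reflect c y"
proof -
  have "(c \<diamondop> x) \<bullet> y = x \<bullet> (c \<diamondop> y)" for x y by (rule inner_assoc)
  then show ?thesis
    by (simp add: reflect_def inner_simps)
qed

end

locale jordan_idempotent = euclidean_jordan_algebra +
  fixes c :: 'a
  assumes idem: "c \<diamondop> c = c"
begin

text \<open>The polarized identity at c, c shows that t (2t - 1) (t - 1) annihilates L(c), so only
  the eigenvalues 0, 1/2 and 1 occur.\<close>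

lemma L_cubic: "2 *\<^sub>R (c \<diamondop> (c \<diamondop> (c \<diamondop> x))) = 3 *\<^sub>R (c \<diamondop> (c \<diamondop> x)) - c \<diamondop> x"
proof (rule vector_inner_eqI)
  fix w
  have "x \<diamondop> c = c \<diamondop> x" "(c \<diamondop> x) \<diamondop> c = c \<diamondop> (c \<diamondop> x)"
    by (simp_all only: commute)
  then show "(2 *\<^sub>R (c \<diamondop> (c \<diamondop> (c \<diamondop> x)))) \<bullet> w = (3 *\<^sub>R (c \<diamondop> (c \<diamondop> x)) - c \<diamondop> x) \<bullet> w"
    using arg_cong[OF jordan_polar2[of x c c], of "\<lambda>v. v \<bullet> w"]
    by (simp add: idem inner_simps)
qed

text \<open>These three are the Lagrange interpolation polynomials for the nodes 1, 1/2 and 0,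
  evaluated at L(c).\<close>

definition "proj1 x = 2 *\<^sub>R (c \<diamondop> (c \<diamondop> x)) - c \<diamondop> x"
definition "projh x = 4 *\<^sub>R (c \<diamondop> x) - 4 *\<^sub>R (c \<diamondop> (c \<diamondop> x))"
definition "proj0 x = x - 3 *\<^sub>R (c \<diamondop> x) + 2 *\<^sub>R (c \<diamondop> (c \<diamondop> x))"

lemma proj_sum: "x = proj1 x + projh x + proj0 x"
  unfolding proj1_def projh_def proj0_def
  by (rule vector_inner_eqI) (simp add: inner_simps)

lemma proj1: "proj1 x \<in> peirce c 1"
  and projh: "projh x \<in> peirce c (1/2)"
  and proj0: "proj0 x \<in> peirce c 0"
proof -
  have c3: "c \<diamondop> (c \<diamondop> (c \<diamondop> x)) = (3/2) *\<^sub>R (c \<diamondop> (c \<diamondop> x)) - (1/2) *\<^sub>R (c \<diamondop> x)"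
    using arg_cong[OF L_cubic, of "\<lambda>v. (1/2) *\<^sub>R v" x] by (simp add: scaleR_diff_right)
  show "proj1 x \<in> peirce c 1"
    unfolding proj1_def mem_peirce by (rule vector_inner_eqI) (simp add: jp_simps c3 inner_simps)
  show "projh x \<in> peirce c (1/2)"
    unfolding projh_def mem_peirce by (rule vector_inner_eqI) (simp add: jp_simps c3 inner_simps)
  show "proj0 x \<in> peirce c 0"
    unfolding proj0_def mem_peirce by (rule vector_inner_eqI) (simp add: jp_simps c3 inner_simps)
qed

lemma peirce_decomp:
  obtains x1 xh x0 where "x = x1 + xh + x0" "x1 \<in> peirce c 1" "xh \<in> peirce c (1/2)" "x0 \<in> peirce c 0"
  using proj_sum proj1 projh proj0 by blast

text \<open>The polarized identity yields the claim multiplied by 2s - 1, which is why s = 1/2 is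
  excluded.\<close>

lemma peirce_mult_aux:
  assumes "z \<in> peirce c s" "s \<noteq> 1/2" "y \<in> peirce c t"
  shows "z \<diamondop> y \<in> peirce c t"
proof -
  have "(2 * s - 1) *\<^sub>R (c \<diamondop> (z \<diamondop> y)) = (2 * s - 1) *\<^sub>R (t *\<^sub>R (z \<diamondop> y))"
  proof (rule vector_inner_eqI)
    fix w
    show "((2 * s - 1) *\<^sub>R (c \<diamondop> (z \<diamondop> y))) \<bullet> w = ((2 * s - 1) *\<^sub>R t *\<^sub>R (z \<diamondop> y)) \<bullet> w"
      using arg_cong[OF jordan_polar2[of z c y], of "\<lambda>v. v \<bullet> w"] assms
      by (simp add: mem_peirce idem jp_simps inner_simps algebra_simps)
  qed
  moreover have "2 * s - 1 \<noteq> 0" using assms(2) by simp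
  ultimately show ?thesis unfolding mem_peirce by (metis scaleR_left_imp_eq)
qed

lemma peirce_1_mult: "z \<in> peirce c 1 \<Longrightarrow> y \<in> peirce c t \<Longrightarrow> z \<diamondop> y \<in> peirce c t"
  and peirce_0_mult: "z \<in> peirce c 0 \<Longrightarrow> y \<in> peirce c t \<Longrightarrow> z \<diamondop> y \<in> peirce c t"
  using peirce_mult_aux by force+

lemma peirce_1_0_mult:
  assumes "z \<in> peirce c 1" "y \<in> peirce c 0" shows "z \<diamondop> y = 0"
proof -
  have "z \<diamondop> y \<in> peirce c 0" "y \<diamondop> z \<in> peirce c 1"
    using peirce_1_mult peirce_0_mult assms by blast+
  then show ?thesis
    using commute[of y z] by (simp add: mem_peirce)
qed

lemma peirce_0_1_mult: "z \<in> peirce c 0 \<Longrightarrow> y \<in> peirce c 1 \<Longrightarrow> z \<diamondop> y = 0"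
  using peirce_1_0_mult commute by metis

text \<open>L(c)^2 = L(c) singles out the sum of the eigenspaces for 1 and 0; this is the hypothesis
  that \<open>reflect_fix\<close> takes.\<close>

lemma peirce_half_mult:
  assumes "z \<in> peirce c (1/2)" "y \<in> peirce c (1/2)"
  shows "c \<diamondop> (c \<diamondop> (z \<diamondop> y)) = c \<diamondop> (z \<diamondop> y)"
proof (rule vector_inner_eqI)
  fix w
  have e: "c \<diamondop> z = (1/2) *\<^sub>R z" "z \<diamondop> c = (1/2) *\<^sub>R z" "c \<diamondop> y = (1/2) *\<^sub>R y" "y \<diamondop> c = (1/2) *\<^sub>R y"
    using assms by (simp_all add: mem_peirce commute)
  have "y \<diamondop> z = z \<diamondop> y" "(z \<diamondop> y) \<diamondop> c = c \<diamondop> (z \<diamondop> y)"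
    by (simp_all only: commute)
  then show "(c \<diamondop> (c \<diamondop> (z \<diamondop> y))) \<bullet> w = (c \<diamondop> (z \<diamondop> y)) \<bullet> w"
    using arg_cong[OF jordan_polar3[of z c y c], of "\<lambda>v. v \<bullet> w"]
    by (simp add: e idem jp_simps inner_simps)
qed

text \<open>Up to a factor 2, \<open>peirce c 0\<close> acts on \<open>peirce c (1/2)\<close> by a
  representation of Jordan algebras. So an idempotent acts there with eigenvalues 0 and 1/2 only,
  and the elements acting as 0 are closed under multiplication.\<close>

lemma peirce_half_rep:
  assumes "x \<in> peirce c 0" "y \<in> peirce c 0" "u \<in> peirce c (1/2)"
  shows "(x \<diamondop> y) \<diamondop> u = x \<diamondop> (y \<diamondop> u) + y \<diamondop> (x \<diamondop> u)"
proof (rule vector_inner_eqI)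
  fix w
  have "c \<diamondop> (y \<diamondop> u) = (1/2) *\<^sub>R (y \<diamondop> u)" "c \<diamondop> (x \<diamondop> u) = (1/2) *\<^sub>R (x \<diamondop> u)"
    "c \<diamondop> (x \<diamondop> y) = 0"
    using peirce_0_mult[of y u "1/2"] peirce_0_mult[of x u "1/2"] peirce_0_mult[of x y 0] assms
    by (simp_all add: mem_peirce)
  then have "(y \<diamondop> u) \<diamondop> c = (1/2) *\<^sub>R (y \<diamondop> u)" "(x \<diamondop> u) \<diamondop> c = (1/2) *\<^sub>R (x \<diamondop> u)"
    "(x \<diamondop> y) \<diamondop> c = 0" "x \<diamondop> c = 0" "y \<diamondop> c = 0" "u \<diamondop> c = (1/2) *\<^sub>R u"
    using assms by (simp_all add: mem_peirce commute)
  moreover have "u \<diamondop> x = x \<diamondop> u" "u \<diamondop> y = y \<diamondop> u" "y \<diamondop> x = x \<diamondop> y" "u \<diamondop> (x \<diamondop> y) = (x \<diamondop> y) \<diamondop> u"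
    by (simp_all only: commute)
  ultimately show "((x \<diamondop> y) \<diamondop> u) \<bullet> w = (x \<diamondop> (y \<diamondop> u) + y \<diamondop> (x \<diamondop> u)) \<bullet> w"
    using arg_cong[OF jordan_polar3[of x y u c], of "\<lambda>v. v \<bullet> w"]
    by (simp add: jp_simps inner_simps)
qed

text \<open>The Peirce rules make the algebra graded modulo 2, with even part the eigenspaces for 1
  and 0 and odd part that for 1/2; \<open>reflect c\<close> is the sign of this grading.\<close>

lemma reflect_mult: "reflect c (x \<diamondop> y) = reflect c x \<diamondop> reflect c y"
proof -
  obtain x1 xh x0 where x: "x = x1 + xh + x0" "x1 \<in> peirce c 1" "xh \<in> peirce c (1/2)" "x0 \<in> peirce c 0"
    by (rule peirce_decomp)
  obtain y1 yh y0 where y: "y = y1 + yh + y0" "y1 \<in> peirce c 1" "yh \<in> peirce c (1/2)" "y0 \<in> peirce c 0"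
    by (rule peirce_decomp)
  have fix1: "reflect c v = v" if "v \<in> peirce c 1" for v
    using that by (intro reflect_fix) (simp add: mem_peirce)
  have fix0: "reflect c v = v" if "v \<in> peirce c 0" for v
    using that by (intro reflect_fix) (simp add: mem_peirce)
  have z: "x1 \<diamondop> y0 = 0" "x0 \<diamondop> y1 = 0"
    using peirce_1_0_mult peirce_0_1_mult x y by auto
  have h: "reflect c (xh \<diamondop> yh) = xh \<diamondop> yh"
    using x y by (intro reflect_fix peirce_half_mult)
  have d: "reflect c (x1 \<diamondop> y1) = x1 \<diamondop> y1" "reflect c (x0 \<diamondop> y0) = x0 \<diamondop> y0"
    using fix1[OF peirce_1_mult] fix0[OF peirce_0_mult] x y by blast+
  have o: "reflect c (x1 \<diamondop> yh) = - (x1 \<diamondop> yh)" "reflect c (x0 \<diamondop> yh) = - (x0 \<diamondop> yh)"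
    "reflect c (xh \<diamondop> y1) = - (xh \<diamondop> y1)" "reflect c (xh \<diamondop> y0) = - (xh \<diamondop> y0)"
    using reflect_half[OF peirce_1_mult[of x1 yh]] reflect_half[OF peirce_0_mult[of x0 yh]]
      reflect_half[OF peirce_1_mult[of y1 xh]] reflect_half[OF peirce_0_mult[of y0 xh]] x y
    by (simp_all add: commute[of xh])
  have "reflect c x = x1 - xh + x0" "reflect c y = y1 - yh + y0"
    using x y by (simp_all add: reflect_simps fix1 fix0 reflect_half)
  then show ?thesis
    by (simp add: x(1) y(1) jp_simps reflect_simps h d o z)
qed

lemma reflect_reflect: "reflect c (reflect c x) = x"
proof -
  obtain x1 xh x0 where x: "x = x1 + xh + x0" "x1 \<in> peirce c 1" "xh \<in> peirce c (1/2)" "x0 \<in> peirce c 0"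
    by (rule peirce_decomp)
  have "reflect c x1 = x1" "reflect c x0 = x0"
    using x by (auto intro!: reflect_fix simp: mem_peirce)
  then show ?thesis
    using x by (simp add: reflect_simps reflect_half)
qed

text \<open>L(c) is positive semidefinite, its eigenvalues being 0, 1/2 and 1, so its quadratic form
  vanishes only on its kernel.\<close>

lemma L_nonneg_zero:
  assumes "(c \<diamondop> x) \<bullet> x = 0"
  shows "c \<diamondop> x = 0"
proof -
  obtain x1 xh x0 where x: "x = x1 + xh + x0" "x1 \<in> peirce c 1" "xh \<in> peirce c (1/2)" "x0 \<in> peirce c 0"
    by (rule peirce_decomp)
  have o: "x1 \<bullet> xh = 0" "x1 \<bullet> x0 = 0" "xh \<bullet> x0 = 0"
    using x peirce_orthogonal by force+
  have cx: "c \<diamondop> x = x1 + (1/2) *\<^sub>R xh"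
    using x by (simp add: jp_simps mem_peirce)
  have "x1 \<bullet> x1 + (1/2) * (xh \<bullet> xh) = 0"
    using assms o unfolding cx by (simp add: x(1) inner_simps inner_commute)
  then have "x1 \<bullet> x1 = 0" "xh \<bullet> xh = 0"
    using inner_ge_zero[of x1] inner_ge_zero[of xh] by linarith+
  then show ?thesis by (simp add: cx)
qed

end

context euclidean_jordan_algebra
begin

lemma jordan_idempotentI: "c \<diamondop> c = c \<Longrightarrow> jordan_idempotent (\<diamondop>) e c"
  by unfold_locales

lemma orthogonal_idempotents:
  assumes "c \<diamondop> c = c" "d \<diamondop> d = d" "c \<bullet> d = 0"
  shows "c \<diamondop> d = 0"
proof -
  interpret jordan_idempotent "(\<diamondop>)" e c by (rule jordan_idempotentI[OF assms(1)])
  have "(c \<diamondop> d) \<bullet> d = 0"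
    by (metis assms(2,3) commute inner_assoc inner_commute)
  then show ?thesis by (rule L_nonneg_zero)
qed

end

text \<open>A maximizer of the Rayleigh quotient on the unit sphere of W is an eigenvector. Only an
  invariant subspace is asked for, since the lemma is applied to the span of the powers of one
  element.\<close>

lemma self_adjoint_eigenvector:
  fixes f :: "'a::euclidean_space \<Rightarrow> 'a"
  assumes f: "linear f" and W: "subspace W" "W \<noteq> {0}" and inv: "\<And>x. x \<in> W \<Longrightarrow> f x \<in> W"
    and sym: "\<And>x y. x \<in> W \<Longrightarrow> y \<in> W \<Longrightarrow> f x \<bullet> y = x \<bullet> f y"
  obtains v \<mu> where "v \<in> W" "v \<noteq> 0" "f v = \<mu> *\<^sub>R v"
proof -
  obtain w0 where w0: "w0 \<in> W" "w0 \<noteq> 0"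
    using W subspace_0 by blast
  have "compact (W \<inter> sphere 0 1)"
    by (metis W(1) closed_subspace compact_Int_closed compact_sphere inf_commute)
  moreover have "W \<inter> sphere 0 1 \<noteq> {}"
  proof -
    have "(1 / norm w0) *\<^sub>R w0 \<in> W \<inter> sphere 0 1"
      using w0 W(1) subspace_scale by auto
    then show ?thesis by blast
  qed
  moreover have "continuous_on (W \<inter> sphere 0 1) (\<lambda>v. f v \<bullet> v)"
    using f by (intro continuous_intros linear_continuous_on) (simp add: linear_conv_bounded_linear)
  ultimately obtain v where v: "v \<in> W" "norm v = 1"
    and vmax: "\<And>w. w \<in> W \<Longrightarrow> norm w = 1 \<Longrightarrow> f w \<bullet> w \<le> f v \<bullet> v"
    using continuous_attains_sup[of "W \<inter> sphere 0 1" "\<lambda>v. f v \<bullet> v"] by force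
  define \<mu> where "\<mu> = f v \<bullet> v"
  have bound: "f w \<bullet> w \<le> \<mu> * (w \<bullet> w)" if "w \<in> W" for w
  proof (cases "w = 0")
    case False
    let ?w = "(1 / norm w) *\<^sub>R w"
    have "f ?w \<bullet> ?w \<le> \<mu>"
      unfolding \<mu>_def using that False W(1) subspace_scale by (intro vmax) auto
    then have "f w \<bullet> w / (norm w)\<^sup>2 \<le> \<mu>"
      by (simp add: linear_scale[OF f] power2_eq_square)
    then show ?thesis
      using False by (simp add: divide_le_eq power2_norm_eq_inner)
  qed (simp add: linear_0[OF f])
  have zero: "\<mu> * (v \<bullet> w) - f v \<bullet> w = 0" if w: "w \<in> W" for w
  proof -
    define a where "a = \<mu> * (v \<bullet> w) - f v \<bullet> w"
    define K where "K = \<mu> * (w \<bullet> w) - f w \<bullet> w"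
    have K: "K \<ge> 0" using bound[OF w] by (simp add: K_def)
    have vv: "v \<bullet> v = 1" using v by (simp add: norm_eq_1)
    \<comment> \<open>The gap in \<open>bound\<close> along v + t w is a quadratic in t that is
      nonnegative and vanishes at t = 0, so its linear coefficient must vanish.\<close>
    have "0 \<le> 2 * t * a + t\<^sup>2 * K" for t
    proof -
      have "v + t *\<^sub>R w \<in> W" using v w W(1) by (simp add: subspace_add subspace_scale)
      note bound[OF this]
      moreover have "f w \<bullet> v = f v \<bullet> w" using sym v w by (metis inner_commute)
      ultimately show ?thesis
        by (simp add: linear_add[OF f] linear_scale[OF f] inner_simps a_def K_def \<mu>_def vv
            power2_eq_square algebra_simps inner_commute)
    qed
    note nonneg = this
    \<comment> \<open>At t = -b the quadratic is -b^2 (K + 2); the summand 1 keeps the denominator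
      positive when K = 0.\<close>
    define b where "b = a / (K + 1)"
    have a: "a = b * (K + 1)" using K by (simp add: b_def)
    have "0 \<le> - (b\<^sup>2 * (K + 2))"
      using nonneg[of "- b"] by (simp add: a power2_eq_square algebra_simps)
    then have "b\<^sup>2 \<le> 0" using K by (simp add: mult_le_0_iff)
    then show ?thesis using a by (simp add: a_def)
  qed
  have "f v - \<mu> *\<^sub>R v \<in> W"
    using v W(1) inv by (simp add: subspace_diff subspace_scale)
  from zero[OF this] have "(f v - \<mu> *\<^sub>R v) \<bullet> (f v - \<mu> *\<^sub>R v) = 0"
    by (simp add: inner_simps inner_commute algebra_simps)
  then have "f v = \<mu> *\<^sub>R v" by simp
  then show ?thesis using that[of v \<mu>] v by force
qed

section \<open>Power associativity and the spectral theorem\<close>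

context euclidean_jordan_algebra
begin

abbreviation pw :: "'a \<Rightarrow> nat \<Rightarrow> 'a" where "pw \<equiv> jpow (\<diamondop>) e"

lemma pw_0 [simp]: "pw x 0 = e" and pw_Suc: "pw x (Suc k) = x \<diamondop> pw x k"
  by (simp_all add: jpow_def)

text \<open>By \<open>mult_triple\<close>, multiplication by the power k + 2 is a polynomial in
  multiplications by x, its square and the powers k and k + 1, all of which commute with L(x) by
  induction and the Jordan identity.\<close>

lemma pw_commute: "x \<diamondop> (pw x k \<diamondop> y) = pw x k \<diamondop> (x \<diamondop> y)"
proof (induction k arbitrary: y rule: induct_nat_012)
  case 0 then show ?case by (simp add: unit)
next
  case 1 then show ?case by (simp add: pw_Suc unit_right)
next
  case (ge2 k)
  have L: "pw x (Suc (Suc k)) \<diamondop> y = 2 *\<^sub>R (pw x (Suc k) \<diamondop> (x \<diamondop> y)) + (x \<diamondop> x) \<diamondop> (pw x k \<diamondop> y)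
      - pw x k \<diamondop> (x \<diamondop> (x \<diamondop> y)) - x \<diamondop> (x \<diamondop> (pw x k \<diamondop> y))" for y
    using mult_triple[of x "pw x k" x y] by (simp add: pw_Suc commute[of x "x \<diamondop> pw x k"] scaleR_2)
  show ?case
    unfolding L by (simp add: jp_simps ge2 jordan)
qed

lemma pw_add: "pw x i \<diamondop> pw x j = pw x (i + j)"
proof (induction j)
  case 0 then show ?case by (simp add: unit_right)
next
  case (Suc j)
  then show ?case by (simp add: pw_Suc pw_commute[symmetric])
qed

text \<open>The eigenspaces of \<open>x\<close> in the associative algebra generated by \<open>x\<close> and \<open>c\<close> are ideals on which
  this algebra acts by scalars; so an eigenvector is a multiple of an idempotent.\<close>

lemma eigen_idempotent:
  assumes c: "c \<diamondop> c = c" "c \<noteq> 0" and x: "c \<diamondop> x = x"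
  obtains p \<mu> where "p \<noteq> 0" "p \<diamondop> p = p" "c \<diamondop> p = p" "x \<diamondop> p = \<mu> *\<^sub>R p"
proof -
  interpret jordan_idempotent "(\<diamondop>)" e c by (rule jordan_idempotentI[OF c(1)])
  \<comment> \<open>The powers of x inside \<open>peirce c 1\<close>, where c is the unit and so
    replaces e as the zeroth power.\<close>
  define w where "w k = (if k = 0 then c else pw x k)" for k
  have cp: "c \<diamondop> pw x (Suc k) = pw x (Suc k)" for k
  proof (induction k)
    case 0 then show ?case by (simp add: pw_Suc unit_right x)
  next
    case (Suc k)
    then have "x \<diamondop> pw x (Suc k) \<in> peirce c 1"
      using x by (intro peirce_1_mult) (simp_all add: mem_peirce)
    then show ?case by (simp add: mem_peirce pw_Suc)
  qed
  have w_add: "w i \<diamondop> w j = w (i + j)" for i j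
  proof (cases i)
    case 0
    then show ?thesis using cp[of "j - 1"] c(1) by (cases j) (auto simp: w_def)
  next
    case (Suc i')
    then show ?thesis
      using cp[of i'] commute[of "pw x i" c] by (cases j) (auto simp: w_def pw_add)
  qed
  have xw: "x \<diamondop> w j = w (Suc j)" for j
    using x commute[of x c] by (auto simp: w_def pw_Suc unit_right)
  let ?W = "span (range w)"
  have lin: "linear ((\<diamondop>) y)" for y
    using jp.bounded_linear_right bounded_linear.linear by blast
  have inv: "x \<diamondop> v \<in> ?W" if "v \<in> ?W" for v
    using that
  proof (induction rule: span_induct)
    case base
    then show ?case by (auto simp: subspace_def jp_simps span_add span_scale span_zero)
  next
    case (step v) then show ?case using xw by (auto intro: span_base)
  qed
  have "c \<in> ?W" using span_base[of "w 0"] by (auto simp: w_def)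
  then have "?W \<noteq> {0}" using c by auto
  moreover have "(x \<diamondop> v) \<bullet> u = v \<bullet> (x \<diamondop> u)" for v u by (rule inner_assoc)
  ultimately obtain v \<mu> where v: "v \<in> ?W" "v \<noteq> 0" "x \<diamondop> v = \<mu> *\<^sub>R v"
    using self_adjoint_eigenvector[OF lin subspace_span, of "range w" x] inv by metis
  have wv: "c \<diamondop> v = v \<and> w (Suc k) \<diamondop> v = x \<diamondop> (w k \<diamondop> v)" for k
    using v(1)
  proof (induction rule: span_induct)
    case base
    then show ?case by (auto simp: subspace_def jp_simps)
  next
    case (step v)
    then obtain j where "v = w j" by auto
    moreover have "c = w 0" by (simp add: w_def)
    ultimately show ?case by (simp add: w_add xw)
  qed
  have wk: "w k \<diamondop> v = (\<mu> ^ k) *\<^sub>R v" for k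
    by (induction k) (use wv in \<open>auto simp: w_def jp_simps v(3)\<close>)
  have "\<exists>\<kappa>. u \<diamondop> v = \<kappa> *\<^sub>R v" if "u \<in> ?W" for u
    using that
  proof (induction rule: span_induct)
    case base
    show ?case
      unfolding subspace_def
    proof (intro conjI ballI allI)
      show "0 \<in> {u. \<exists>\<kappa>. u \<diamondop> v = \<kappa> *\<^sub>R v}" by (auto intro: exI[of _ 0])
      show "x + y \<in> {u. \<exists>\<kappa>. u \<diamondop> v = \<kappa> *\<^sub>R v}"
        if "x \<in> {u. \<exists>\<kappa>. u \<diamondop> v = \<kappa> *\<^sub>R v}" "y \<in> {u. \<exists>\<kappa>. u \<diamondop> v = \<kappa> *\<^sub>R v}" for x y
        using that by (auto simp: jp_simps scaleR_add_left[symmetric])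
      show "a *\<^sub>R x \<in> {u. \<exists>\<kappa>. u \<diamondop> v = \<kappa> *\<^sub>R v}" if "x \<in> {u. \<exists>\<kappa>. u \<diamondop> v = \<kappa> *\<^sub>R v}" for a x
        using that by (auto simp: jp_simps)
    qed
  next
    case (step u) then show ?case using wk by auto
  qed
  then obtain \<kappa> where \<kappa>: "v \<diamondop> v = \<kappa> *\<^sub>R v" using v(1) by blast
  \<comment> \<open>A square that vanished would make v orthogonal to itself; so \<kappa> can be
    divided out.\<close>
  have "(v \<diamondop> v) \<bullet> c = v \<bullet> v"
    using wv inner_assoc[of v v c] commute[of v c] by simp
  then have k0: "\<kappa> \<noteq> 0" using \<kappa> v(2) by auto
  show ?thesis
  proof (rule that[of "(1/\<kappa>) *\<^sub>R v" \<mu>])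
    show "(1/\<kappa>) *\<^sub>R v \<noteq> 0" using k0 v(2) by simp
    show "(1/\<kappa>) *\<^sub>R v \<diamondop> (1/\<kappa>) *\<^sub>R v = (1/\<kappa>) *\<^sub>R v"
      using k0 by (simp add: jp_simps \<kappa>)
    show "c \<diamondop> (1/\<kappa>) *\<^sub>R v = (1/\<kappa>) *\<^sub>R v" using wv by (simp add: jp_simps)
    show "x \<diamondop> (1/\<kappa>) *\<^sub>R v = \<mu> *\<^sub>R (1/\<kappa>) *\<^sub>R v" by (simp add: jp_simps v(3))
  qed
qed

abbreviation prim :: "'a \<Rightarrow> bool" where "prim \<equiv> primitive_idempotent (\<diamondop>)"

lemma prim_idem: "prim c \<Longrightarrow> c \<diamondop> c = c" and prim_nz: "prim c \<Longrightarrow> c \<noteq> 0"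
  by (simp_all add: primitive_idempotent_def)

lemma complement_idem:
  assumes "c \<diamondop> c = c" "p \<diamondop> p = p" "c \<diamondop> p = p"
  shows "(c - p) \<diamondop> (c - p) = c - p" "(c - p) \<diamondop> p = 0" "p \<diamondop> (c - p) = 0"
  using assms commute[of p c] by (simp_all add: jp_simps)

text \<open>An idempotent under c on which x acts by a scalar must be c itself, by primitivity; then
  x = x c is that scalar times c.\<close>

lemma prim_peirce_1:
  assumes c: "prim c" and x: "c \<diamondop> x = x"
  obtains \<mu> where "x = \<mu> *\<^sub>R c"
proof -
  obtain p \<mu> where p: "p \<noteq> 0" "p \<diamondop> p = p" "c \<diamondop> p = p" "x \<diamondop> p = \<mu> *\<^sub>R p"
    using eigen_idempotent[OF prim_idem prim_nz x] c by blast
  have "p = 0 \<or> c - p = 0"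
    using c complement_idem[OF prim_idem[OF c] p(2,3)] p(2)
    unfolding primitive_idempotent_def by (metis add.commute diff_add_cancel)
  then have "p = c" using p by simp
  then show ?thesis using that p(4) x commute by metis
qed

lemma sub_idempotent:
  assumes "a \<diamondop> a = a" "b \<diamondop> b = b" "a \<diamondop> b = 0" "b \<diamondop> y = y"
  shows "a \<diamondop> y = 0" "(a + b) \<diamondop> y = y"
proof -
  interpret jordan_idempotent "(\<diamondop>)" e b by (rule jordan_idempotentI[OF assms(2)])
  show "a \<diamondop> y = 0"
    using assms commute[of a b] by (intro peirce_0_1_mult) (simp_all add: mem_peirce)
  then show "(a + b) \<diamondop> y = y" using assms by (simp add: jp_simps)
qed

lemma sub_idempotents_orthogonal:
  assumes "a \<diamondop> a = a" "b \<diamondop> b = b" "a \<diamondop> b = 0" "a \<diamondop> x = x" "b \<diamondop> y = y"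
  shows "x \<diamondop> y = 0"
proof -
  interpret jordan_idempotent "(\<diamondop>)" e a by (rule jordan_idempotentI[OF assms(1)])
  show ?thesis
    using sub_idempotent(1)[OF assms(1,2,3,5)] assms by (intro peirce_1_0_mult) (simp_all add: mem_peirce)
qed

definition orth_prims :: "'a set \<Rightarrow> bool" where
  "orth_prims C \<longleftrightarrow> finite C \<and> (\<forall>p\<in>C. prim p) \<and> (\<forall>p\<in>C. \<forall>q\<in>C. p \<noteq> q \<longrightarrow> p \<diamondop> q = 0)"

text \<open>The spectral theorem in the subalgebra \<open>peirce c 1\<close> with unit c. Working
  under an idempotent lets the induction pass to the two parts of a splitting of c, whose Peirce
  spaces have smaller dimension.\<close>

lemma spectral_in_idempotent:
  assumes "c \<diamondop> c = c" "c \<noteq> 0" "c \<diamondop> x = x"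
  shows "\<exists>C l. orth_prims C \<and> \<Sum>C = c \<and> (\<forall>p\<in>C. c \<diamondop> p = p) \<and> x = (\<Sum>p\<in>C. l p *\<^sub>R p)"
  using assms
proof (induction "dim (peirce c 1)" arbitrary: c x rule: less_induct)
  case less
  show ?case
  proof (cases "prim c \<and> (\<exists>\<mu>. x = \<mu> *\<^sub>R c)")
    case True
    then obtain \<mu> where "x = \<mu> *\<^sub>R c" by blast
    then show ?thesis using True less.prems
      by (intro exI[of _ "{c}"] exI[of _ "\<lambda>_. \<mu>"]) (auto simp: orth_prims_def)
  next
    case F: False
    \<comment> \<open>An eigenvector idempotent p different from c splits c and x together. If p =
      c, then x is a multiple of c, so c is not primitive and any splitting of c splits x.\<close>
    have "\<exists>a b xa xb. a \<noteq> 0 \<and> b \<noteq> 0 \<and> a \<diamondop> a = a \<and> b \<diamondop> b = b \<and> a + b = c \<and> x = xa + xb \<and> a \<diamondop> xa = xa \<and> b \<diamondop> xb = xb"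
    proof -
      obtain p \<mu> where p: "p \<noteq> 0" "p \<diamondop> p = p" "c \<diamondop> p = p" "x \<diamondop> p = \<mu> *\<^sub>R p"
        using eigen_idempotent[OF less.prems] by blast
      show ?thesis
      proof (cases "p = c")
        case False
        have "(c - p) \<diamondop> (x - \<mu> *\<^sub>R p) = x - \<mu> *\<^sub>R p"
          using p less.prems commute[of p x] by (simp add: jp_simps)
        then show ?thesis
          using False p less.prems complement_idem[of c p]
          by (intro exI[of _ p] exI[of _ "c - p"] exI[of _ "\<mu> *\<^sub>R p"] exI[of _ "x - \<mu> *\<^sub>R p"])
             (simp add: jp_simps)
      next
        case True
        then have x: "x = \<mu> *\<^sub>R c" using p(4) less.prems(3) commute by metis
        then have "\<not> prim c" using F by blast
        then obtain a b where "a \<noteq> 0" "b \<noteq> 0" "a \<diamondop> a = a" "b \<diamondop> b = b" "a + b = c"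
          using less.prems unfolding primitive_idempotent_def by blast
        then show ?thesis
          by (intro exI[of _ a] exI[of _ b] exI[of _ "\<mu> *\<^sub>R a"] exI[of _ "\<mu> *\<^sub>R b"])
             (auto simp: jp_simps x scaleR_add_right[symmetric])
      qed
    qed
    then obtain a b xa xb where ab: "a \<noteq> 0" "b \<noteq> 0" "a \<diamondop> a = a" "b \<diamondop> b = b" "a + b = c"
      and x: "x = xa + xb" "a \<diamondop> xa = xa" "b \<diamondop> xb = xb" by blast
    have "2 *\<^sub>R (a \<diamondop> b) = 0"
      using less.prems(1) ab commute[of b a] unfolding ab(5)[symmetric] by (simp add: jp_simps scaleR_2)
    then have ab0: "a \<diamondop> b = 0" "b \<diamondop> a = 0" using commute[of b a] by auto
    have sub: "dim (peirce a' 1) < dim (peirce c 1)"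
      if "a' \<diamondop> a' = a'" "b' \<diamondop> b' = b'" "a' \<diamondop> b' = 0" "b' \<diamondop> a' = 0" "b' \<noteq> 0" "a' + b' = c" for a' b'
    proof (rule dim_psubset)
      have "b' \<in> peirce c 1" "b' \<notin> peirce a' 1"
        using that by (auto simp: mem_peirce that(6)[symmetric] jp_simps)
      moreover have "peirce a' 1 \<subseteq> peirce c 1"
        using sub_idempotent(2)[of b' a'] that add.commute[of a' b'] by (auto simp: mem_peirce)
      ultimately show "span (peirce a' 1) \<subset> span (peirce c 1)"
        using span_eq_iff[of "peirce a' 1"] span_eq_iff[of "peirce c 1"] subspace_peirce by blast
    qed
    obtain A \<alpha> where A: "orth_prims A" "\<Sum>A = a" "\<forall>p\<in>A. a \<diamondop> p = p" "xa = (\<Sum>p\<in>A. \<alpha> p *\<^sub>R p)"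
      using less.hyps[of a xa] sub[of a b] ab ab0 x by blast
    obtain B \<beta> where B: "orth_prims B" "\<Sum>B = b" "\<forall>p\<in>B. b \<diamondop> p = p" "xb = (\<Sum>p\<in>B. \<beta> p *\<^sub>R p)"
      using less.hyps[of b xb] sub[of b a] ab ab0 x add.commute[of a b] by metis
    have fin: "finite A" "finite B" using A B by (auto simp: orth_prims_def)
    have orth: "p \<diamondop> q = 0" if "p \<in> A" "q \<in> B" for p q
      using sub_idempotents_orthogonal[OF ab(3,4) ab0(1)] A B that by blast
    have disj: "A \<inter> B = {}"
      using orth A(1) unfolding orth_prims_def primitive_idempotent_def by fastforce
    have "orth_prims (A \<union> B)"
      using A(1) B(1) orth commute unfolding orth_prims_def by (metis Un_iff finite_Un)
    moreover have "\<Sum>(A \<union> B) = c" using disj fin A B ab by (simp add: sum.union_disjoint)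
    moreover have "c \<diamondop> p = p" if "p \<in> A \<union> B" for p
      using that sub_idempotent(2)[OF ab(3,4) ab0(1)] sub_idempotent(2)[OF ab(4,3) ab0(2)] A(3) B(3) ab(5)
        add.commute[of a b] by (metis Un_iff)
    moreover have "x = (\<Sum>p\<in>A \<union> B. (if p \<in> A then \<alpha> p else \<beta> p) *\<^sub>R p)"
    proof -
      have "(\<Sum>p\<in>B. (if p \<in> A then \<alpha> p else \<beta> p) *\<^sub>R p) = (\<Sum>p\<in>B. \<beta> p *\<^sub>R p)"
        using disj by (intro sum.cong) auto
      then show ?thesis using disj fin A B x by (simp add: sum.union_disjoint)
    qed
    ultimately show ?thesis
      by (intro exI[of _ "A \<union> B"] exI[of _ "\<lambda>p. if p \<in> A then \<alpha> p else \<beta> p"]) blast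
  qed
qed

text \<open>The component \<open>proj1 d\<close> lies on the line through c because c is primitive;
  pairing with c gives its coefficient.\<close>

lemma prim_mult_left:
  assumes "prim c"
  shows "c \<diamondop> (c \<diamondop> d) = (1/2) *\<^sub>R ((c \<bullet> d / (c \<bullet> c)) *\<^sub>R c + c \<diamondop> d)"
proof -
  interpret jordan_idempotent "(\<diamondop>)" e c by (rule jordan_idempotentI[OF prim_idem[OF assms]])
  obtain \<mu> where \<mu>: "2 *\<^sub>R (c \<diamondop> (c \<diamondop> d)) - c \<diamondop> d = \<mu> *\<^sub>R c"
    using prim_peirce_1[OF assms, of "proj1 d"] proj1[of d] by (auto simp: proj1_def mem_peirce)
  have "(c \<diamondop> d) \<bullet> c = c \<bullet> d" "(c \<diamondop> (c \<diamondop> d)) \<bullet> c = c \<bullet> d"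
    by (simp_all add: inner_assoc idem) (simp_all add: inner_commute)
  then have "c \<bullet> d = \<mu> * (c \<bullet> c)"
    using arg_cong[OF \<mu>, of "\<lambda>v. v \<bullet> c"] by (simp add: inner_simps)
  then have "c \<bullet> d / (c \<bullet> c) = \<mu>" using prim_nz[OF assms] by simp
  moreover have "c \<diamondop> (c \<diamondop> d) = (1/2) *\<^sub>R (\<mu> *\<^sub>R c + c \<diamondop> d)"
    unfolding \<mu>[symmetric] by (rule vector_inner_eqI) (simp add: inner_simps)
  ultimately show ?thesis by simp
qed

lemma prim_pair_square_aux:
  assumes "prim c" "prim d"
  defines "\<alpha> \<equiv> c \<bullet> d / (c \<bullet> c)" and "\<beta> \<equiv> c \<bullet> d / (d \<bullet> d)"
  shows "2 *\<^sub>R ((c \<diamondop> d) \<diamondop> (c \<diamondop> d)) = \<beta> *\<^sub>R (c \<diamondop> d) + (1/2) *\<^sub>R (\<alpha> *\<^sub>R c + \<beta> *\<^sub>R d)"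
proof (rule vector_inner_eqI)
  fix w
  have g: "c \<diamondop> (c \<diamondop> d) = (1/2) *\<^sub>R (\<alpha> *\<^sub>R c + c \<diamondop> d)" "d \<diamondop> (c \<diamondop> d) = (1/2) *\<^sub>R (\<beta> *\<^sub>R d + c \<diamondop> d)"
    using prim_mult_left[OF assms(1), of d] prim_mult_left[OF assms(2), of c]
    by (simp_all add: \<alpha>_def \<beta>_def commute[of d c] inner_commute[of d c])
  have "(c \<diamondop> d) \<diamondop> d = d \<diamondop> (c \<diamondop> d)" by (rule commute)
  then show "(2 *\<^sub>R ((c \<diamondop> d) \<diamondop> (c \<diamondop> d))) \<bullet> w = (\<beta> *\<^sub>R (c \<diamondop> d) + (1/2) *\<^sub>R (\<alpha> *\<^sub>R c + \<beta> *\<^sub>R d)) \<bullet> w"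
    using arg_cong[OF jordan_polar2[of d c d], of "\<lambda>v. v \<bullet> w"] prim_idem[OF assms(1)] prim_idem[OF assms(2)]
    by (simp add: g jp_simps inner_simps algebra_simps)
qed

text \<open>The formula for the square of \<open>c \<diamondop> d\<close> is symmetric in c and d
  except for the coefficient of \<open>c \<diamondop> d\<close>. Comparing it with its exchanged
  form forces the two norms to agree.\<close>

lemma prim_norm_eq:
  assumes "prim c" "prim d" "c \<bullet> d \<noteq> 0"
  shows "c \<bullet> c = d \<bullet> d"
proof -
  define a where "a = c \<bullet> d / (c \<bullet> c)"
  define b where "b = c \<bullet> d / (d \<bullet> d)"
  have "a *\<^sub>R (c \<diamondop> d) = b *\<^sub>R (c \<diamondop> d)"
  proof (rule vector_inner_eqI)
    fix w
    have "2 *\<^sub>R ((c \<diamondop> d) \<diamondop> (c \<diamondop> d)) = b *\<^sub>R (c \<diamondop> d) + (1/2) *\<^sub>R (a *\<^sub>R c + b *\<^sub>R d)"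
      "2 *\<^sub>R ((c \<diamondop> d) \<diamondop> (c \<diamondop> d)) = a *\<^sub>R (c \<diamondop> d) + (1/2) *\<^sub>R (b *\<^sub>R d + a *\<^sub>R c)"
      using prim_pair_square_aux[OF assms(1,2)] prim_pair_square_aux[OF assms(2,1)]
      by (simp_all only: a_def b_def commute[of d c] inner_commute[of d c])
    then show "(a *\<^sub>R (c \<diamondop> d)) \<bullet> w = (b *\<^sub>R (c \<diamondop> d)) \<bullet> w"
      by (metis add.commute add_right_imp_eq)
  qed
  moreover have "(c \<diamondop> d) \<bullet> c = c \<bullet> d"
    using inner_assoc[of c d c] prim_idem[OF assms(1)] by (simp add: inner_commute)
  then have "c \<diamondop> d \<noteq> 0" using assms(3) by auto
  ultimately have "c \<bullet> d / (c \<bullet> c) = c \<bullet> d / (d \<bullet> d)" by (simp add: a_def b_def)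
  then show ?thesis using assms(3) by (metis divide_cancel_left)
qed

end

text \<open>The coefficients are indexed by A rather than by its image, since the powers of an
  element may repeat.\<close>

lemma span_image_finite:
  assumes "v \<in> span (f ` A)" "finite A"
  obtains u where "v = (\<Sum>a\<in>A. u a *\<^sub>R (f a :: 'a::real_vector))"
proof -
  have "\<exists>u. v = (\<Sum>a\<in>A. u a *\<^sub>R f a)"
    using assms(1)
  proof (induction rule: span_induct_alt)
    case base
    show ?case by (intro exI[of _ "\<lambda>_. 0"]) simp
  next
    case (step c x y)
    then obtain a u where a: "a \<in> A" "x = f a" and u: "y = (\<Sum>a\<in>A. u a *\<^sub>R f a)" by auto
    have "(\<Sum>b\<in>A. (if b = a then c + u b else u b) *\<^sub>R f b) =
        (\<Sum>b\<in>A. (if b = a then c *\<^sub>R f b else 0) + u b *\<^sub>R f b)"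
      by (intro sum.cong) (auto simp: scaleR_add_left)
    also have "\<dots> = c *\<^sub>R x + y"
      using a assms(2) by (simp add: sum.distrib u sum.delta')
    finally show ?case by (intro exI[of _ "\<lambda>b. if b = a then c + u b else u b"]) simp
  qed
  then show ?thesis using that by blast
qed

lemma poly_eq_sum:
  fixes f :: "real poly"
  assumes "degree f \<le> n"
  shows "poly f x = (\<Sum>i\<le>n. coeff f i * x ^ i)"
  unfolding poly_altdef using assms
  by (intro sum.mono_neutral_left) (auto simp: coeff_eq_0)

text \<open>The next-to-leading coefficient is recorded because it produces the trace; for empty C
  the truncated index \<open>card C - 1\<close> would hit the leading one.\<close>

lemma monic_roots_poly:
  fixes l :: "'b \<Rightarrow> real"
  assumes "finite C"
  defines "f \<equiv> (\<Prod>p\<in>C. [:- l p, 1:])"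
  shows "degree f = card C" "coeff f (card C) = 1" "C \<noteq> {} \<Longrightarrow> coeff f (card C - 1) = - (\<Sum>p\<in>C. l p)"
    "p \<in> C \<Longrightarrow> poly f (l p) = 0"
proof -
  have "degree (\<Prod>p\<in>C. [:- l p, 1:]) = card C \<and> coeff (\<Prod>p\<in>C. [:- l p, 1:]) (card C) = 1 \<and>
      (C \<noteq> {} \<longrightarrow> coeff (\<Prod>p\<in>C. [:- l p, 1:]) (card C - 1) = - (\<Sum>p\<in>C. l p))"
    using assms(1)
  proof (induction rule: finite_induct)
    case empty then show ?case by simp
  next
    case (insert q D)
    define g where "g = (\<Prod>p\<in>D. [:- l p, 1:])"
    have IH: "degree g = card D" "coeff g (card D) = 1" "D \<noteq> {} \<Longrightarrow> coeff g (card D - 1) = - (\<Sum>p\<in>D. l p)"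
      using insert.IH by (simp_all add: g_def)
    have g0: "g \<noteq> 0" using IH(2) by auto
    have eq: "(\<Prod>p\<in>insert q D. [:- l p, 1:]) = smult (- l q) g + pCons 0 g"
      using insert.hyps by (simp add: g_def)
    have deg: "degree (smult (- l q) g + pCons 0 g) = Suc (card D)"
      using g0 IH(1) by (metis degree_add_eq_right degree_pCons_eq degree_smult_le le_imp_less_Suc)
    have c1: "coeff g (Suc (card D)) = 0" using IH(1) by (simp add: coeff_eq_0)
    show ?case
      unfolding eq deg using insert.hyps IH c1
      by (cases "D = {}"; cases "card D") auto
  qed
  then show "degree f = card C" "coeff f (card C) = 1" "C \<noteq> {} \<Longrightarrow> coeff f (card C - 1) = - (\<Sum>p\<in>C. l p)"
    by (simp_all add: f_def)
  show "p \<in> C \<Longrightarrow> poly f (l p) = 0"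
    using assms(1) by (auto simp: f_def poly_prod)
qed

section \<open>Simplicity and the common norm of primitive idempotents\<close>

context simple_euclidean_jordan_algebra
begin

lemma e_nonzero: "e \<noteq> 0"
proof
  assume "e = 0"
  then have "x = 0" for x :: 'a using unit[of x] by simp
  then show False by (metis SOME_Basis nonzero_Basis)
qed

lemma spectral:
  obtains C l where "orth_prims C" "\<Sum>C = e" "x = (\<Sum>p\<in>C. l p *\<^sub>R p)"
proof -
  show ?thesis using spectral_in_idempotent[of e x] that e_nonzero by (auto simp: unit)
qed

lemma orth_primsD:
  assumes "orth_prims C"
  shows "finite C" "p \<in> C \<Longrightarrow> prim p" "p \<in> C \<Longrightarrow> q \<in> C \<Longrightarrow> p \<noteq> q \<Longrightarrow> p \<diamondop> q = 0"
    "p \<in> C \<Longrightarrow> p \<diamondop> p = p"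
  using assms prim_idem by (auto simp: orth_prims_def)

lemma prim_orthogonal_iff:
  assumes "prim p" "prim q"
  shows "p \<bullet> q = 0 \<longleftrightarrow> p \<diamondop> q = 0"
proof
  show "p \<bullet> q = 0 \<Longrightarrow> p \<diamondop> q = 0"
    using orthogonal_idempotents assms prim_idem by blast
  show "p \<diamondop> q = 0 \<Longrightarrow> p \<bullet> q = 0"
    using inner_assoc[of p p q] prim_idem[OF assms(1)] by simp
qed

lemma orth_prims_inner:
  assumes "orth_prims C" "q \<in> C"
  shows "(\<Sum>p\<in>C. l p *\<^sub>R p) \<bullet> q = l q * (q \<bullet> q)"
proof -
  have "p \<bullet> q = 0" if "p \<in> C" "p \<noteq> q" for p
    using that orth_primsD[OF assms(1)] assms(2) prim_orthogonal_iff by blast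
  then have "(\<Sum>p\<in>C. l p *\<^sub>R p) \<bullet> q = (\<Sum>p\<in>C. if p = q then l p * (p \<bullet> q) else 0)"
    by (auto simp: inner_sum_left intro!: sum.cong)
  then show ?thesis using assms orth_primsD(1) by (simp add: sum.delta)
qed

lemma orth_prims_mult:
  assumes "orth_prims C" "q \<in> C"
  shows "(\<Sum>p\<in>C. l p *\<^sub>R p) \<diamondop> q = l q *\<^sub>R q"
proof -
  have "(\<Sum>p\<in>C. l p *\<^sub>R p) \<diamondop> q = (\<Sum>p\<in>C. l p *\<^sub>R (p \<diamondop> q))"
    by (simp add: jp.sum_left jp_simps)
  also have "\<dots> = (\<Sum>p\<in>C. if p = q then l p *\<^sub>R p else 0)"
    using orth_primsD[OF assms(1)] assms(2) by (intro sum.cong) auto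
  finally show ?thesis using assms orth_primsD(1) by (simp add: sum.delta)
qed

text \<open>Primitive idempotents of different norms are orthogonal, so those of a given norm span an ideal.\<close>

lemma prim_norm_unique:
  assumes "prim c" "prim d"
  shows "c \<bullet> c = d \<bullet> d"
proof (rule ccontr)
  assume ne: "c \<bullet> c \<noteq> d \<bullet> d"
  define S where "S = {p. prim p \<and> p \<bullet> p = c \<bullet> c}"
  have zero: "p \<diamondop> q = 0" if "prim p" "prim q" "p \<bullet> p \<noteq> q \<bullet> q" for p q
    using prim_norm_eq[OF that(1,2)] prim_orthogonal_iff that by blast
  have prim_mult: "p \<diamondop> q \<in> span S" if p: "prim p" and q: "q \<in> S" for p q
  proof (cases "p \<bullet> p = c \<bullet> c")
    case False
    then show ?thesis using zero[of p q] p q by (auto simp: S_def span_zero)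
  next
    case True
    obtain C l where C: "orth_prims C" "p \<diamondop> q = (\<Sum>p\<in>C. l p *\<^sub>R p)"
      by (rule spectral)
    \<comment> \<open>The component of the product along a primitive s of another norm is measured
      by pairing p s with q, and p s = 0.\<close>
    have "l s *\<^sub>R s \<in> span S" if s: "s \<in> C" for s
    proof (cases "s \<bullet> s = c \<bullet> c")
      case True
      then show ?thesis using s orth_primsD(2)[OF C(1)] by (auto simp: S_def intro: span_base span_scale)
    next
      case False
      have "prim s" using orth_primsD[OF C(1)] s by blast
      have "(p \<diamondop> q) \<bullet> s = q \<bullet> (p \<diamondop> s)" by (rule inner_assoc)
      also have "p \<diamondop> s = 0" using zero[OF p \<open>prim s\<close>] True False by simp
      finally have "l s * (s \<bullet> s) = 0" using orth_prims_inner[OF C(1) s] C(2) by simp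
      then show ?thesis using prim_nz[OF \<open>prim s\<close>] by (simp add: span_zero)
    qed
    then show ?thesis unfolding C(2) by (intro span_sum)
  qed
  have "x \<diamondop> y \<in> span S" if "y \<in> span S" for x y
  proof -
    obtain C l where C: "orth_prims C" "x = (\<Sum>p\<in>C. l p *\<^sub>R p)"
      by (rule spectral)
    have "p \<diamondop> y \<in> span S" if "prim p" for p
      using \<open>y \<in> span S\<close>
    proof (induction rule: span_induct)
      case base
      then show ?case by (auto simp: subspace_def jp_simps span_add span_scale span_zero)
    next
      case (step q) then show ?case using prim_mult that by blast
    qed
    then show ?thesis
      unfolding C(2) jp.sum_left jp.scaleR_left
      using orth_primsD[OF C(1)] by (intro span_sum span_scale) blast
  qed
  then have "span S = {0} \<or> span S = UNIV"
    by (intro simple subspace_span)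
  moreover have "c \<in> span S" using assms by (intro span_base) (simp add: S_def)
  ultimately have "d \<in> span S" using prim_nz[OF assms(1)] by auto
  moreover have "orthogonal d p" if "p \<in> S" for p
    using prim_norm_eq[OF assms(2), of p] ne that unfolding S_def orthogonal_def by force
  ultimately have "orthogonal d d" by (rule orthogonal_to_span)
  then show False using prim_nz[OF assms(2)] by (simp add: orthogonal_def)
qed

text \<open>Independent of the choice by \<open>prim_norm_unique\<close>; it is the factor between
  the inner product of the type and the trace form.\<close>

definition nu :: real where
  "nu = (SOME c. prim c) \<bullet> (SOME c. prim c)"

lemma ex_prim: "\<exists>c. prim c"
proof -
  obtain C l where C: "orth_prims C" "\<Sum>C = e" "e = (\<Sum>p\<in>C. l p *\<^sub>R p)"
    by (rule spectral)
  have "C \<noteq> {}" using C(2) e_nonzero by auto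
  then show ?thesis using orth_primsD[OF C(1)] by blast
qed

lemma prim_nu: "prim c \<Longrightarrow> c \<bullet> c = nu"
  unfolding nu_def by (metis ex_prim prim_norm_unique someI_ex)

lemma nu_pos: "nu > 0"
  using ex_prim prim_nu prim_nz by (metis inner_gt_zero_iff)

lemma inner_e: "c \<diamondop> c = c \<Longrightarrow> c \<bullet> e = c \<bullet> c"
  using inner_assoc[of c c e] by (simp add: unit_right)

lemma orth_prims_inner_e:
  assumes "orth_prims C"
  shows "(\<Sum>p\<in>C. l p *\<^sub>R p) \<bullet> e = (\<Sum>p\<in>C. l p) * nu"
  using orth_primsD[OF assms] prim_nu
  by (simp add: inner_sum_left sum_distrib_right inner_e)

lemma orth_prims_idem:
  assumes "orth_prims C" shows "\<Sum>C \<diamondop> \<Sum>C = \<Sum>C"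
  using orth_prims_mult[OF assms, of _ "\<lambda>_. 1"] by (simp add: jp.sum_right)

lemma card_orth_prims:
  assumes "orth_prims C" shows "\<Sum>C \<bullet> \<Sum>C = real (card C) * nu"
  using orth_prims_inner_e[OF assms, of "\<lambda>_. 1"] inner_e[OF orth_prims_idem[OF assms]] by simp

subsection \<open>Degree, rank and trace\<close>

lemma pw_spectral:
  assumes "orth_prims C" "\<Sum>C = e" "x = (\<Sum>p\<in>C. l p *\<^sub>R p)"
  shows "pw x k = (\<Sum>p\<in>C. l p ^ k *\<^sub>R p)"
proof (induction k)
  case 0 then show ?case using assms by simp
next
  case (Suc k)
  have "x \<diamondop> (\<Sum>p\<in>C. l p ^ k *\<^sub>R p) = (\<Sum>p\<in>C. l p ^ k *\<^sub>R (x \<diamondop> p))"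
    by (simp add: jp.sum_right jp_simps)
  also have "\<dots> = (\<Sum>p\<in>C. l p ^ Suc k *\<^sub>R p)"
    using orth_prims_mult[OF assms(1)] assms(3) by (intro sum.cong) auto
  finally show ?case by (simp only: pw_Suc Suc)
qed

lemma poly_spectral:
  assumes "orth_prims C" "\<Sum>C = e" "x = (\<Sum>p\<in>C. l p *\<^sub>R p)" "degree f \<le> n"
  shows "(\<Sum>i\<le>n. coeff f i *\<^sub>R pw x i) = (\<Sum>p\<in>C. poly f (l p) *\<^sub>R p)"
proof -
  have "(\<Sum>i\<le>n. coeff f i *\<^sub>R pw x i) = (\<Sum>i\<le>n. \<Sum>p\<in>C. (coeff f i * l p ^ i) *\<^sub>R p)"
    by (simp add: pw_spectral[OF assms(1-3)] scaleR_sum_right)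
  also have "\<dots> = (\<Sum>p\<in>C. \<Sum>i\<le>n. (coeff f i * l p ^ i) *\<^sub>R p)"
    by (rule sum.swap)
  also have "\<dots> = (\<Sum>p\<in>C. poly f (l p) *\<^sub>R p)"
    by (simp add: poly_eq_sum[OF assms(4)] scaleR_sum_left)
  finally show ?thesis .
qed

text \<open>A relation would be a nonzero polynomial of degree at most k that vanishes at more than
  k distinct eigenvalues.\<close>

lemma pw_not_in_span:
  assumes C: "orth_prims C" "\<Sum>C = e" "x = (\<Sum>p\<in>C. l p *\<^sub>R p)" and k: "k < card (l ` C)"
  shows "pw x k \<notin> span (pw x ` {..<k})"
proof
  assume "pw x k \<in> span (pw x ` {..<k})"
  then obtain u where u: "pw x k = (\<Sum>i<k. u i *\<^sub>R pw x i)"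
    using span_image_finite[of "pw x k" "pw x" "{..<k}"] by auto
  define f where "f = monom 1 k - (\<Sum>i<k. monom (u i) i)"
  have cf: "coeff f i = (if i = k then 1 else if i < k then - u i else 0)" for i
    by (auto simp: f_def coeff_sum)
  have "degree f \<le> k" by (rule degree_le) (simp add: cf)
  have "f \<noteq> 0" using cf[of k] by auto
  have "(\<Sum>p\<in>C. poly f (l p) *\<^sub>R p) = (\<Sum>i\<le>k. coeff f i *\<^sub>R pw x i)"
    using poly_spectral[OF C \<open>degree f \<le> k\<close>] by simp
  also have "\<dots> = 0"
    unfolding lessThan_Suc_atMost[symmetric] by (simp add: cf u sum_negf)
  finally have "poly f (l q) = 0" if "q \<in> C" for q
    using orth_prims_inner[OF C(1) that, of "\<lambda>p. poly f (l p)"] orth_primsD(2)[OF C(1) that] prim_nz by auto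
  then have "l ` C \<subseteq> {t. poly f t = 0}" by auto
  then have "card (l ` C) \<le> card {t. poly f t = 0}"
    using poly_roots_finite[OF \<open>f \<noteq> 0\<close>] card_mono by blast
  then show False
    using card_poly_roots_bound[OF \<open>f \<noteq> 0\<close>] \<open>degree f \<le> k\<close> k by linarith
qed

lemma jdegree_eq:
  assumes C: "orth_prims C" "\<Sum>C = e" "x = (\<Sum>p\<in>C. l p *\<^sub>R p)"
  shows "jdegree (\<diamondop>) e x = card (l ` C)"
  unfolding jdegree_def
proof (rule Least_equality)
  define n where "n = card (l ` C)"
  \<comment> \<open>The product runs over distinct eigenvalues, without multiplicity: this is the
    minimal polynomial of x.\<close>
  define f :: "real poly" where "f = (\<Prod>a\<in>l ` C. [:- a, 1:])"
  have fin: "finite (l ` C)" using orth_primsD[OF C(1)] by blast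
  note f = monic_roots_poly[OF fin, where l = "\<lambda>a. a", folded f_def n_def]
  have "(\<Sum>i<Suc n. coeff f i *\<^sub>R pw x i) = 0"
    using poly_spectral[OF C, of f n] f(1,4) unfolding lessThan_Suc_atMost by simp
  then have "(\<Sum>i<n. coeff f i *\<^sub>R pw x i) + pw x n = 0"
    using f(2) by simp
  then have "pw x n = - (\<Sum>i<n. coeff f i *\<^sub>R pw x i)"
    by (metis add_eq_0_iff)
  also have "\<dots> \<in> span (pw x ` {..<n})"
    by (intro span_neg span_sum span_scale span_base) auto
  finally show "pw x (card (l ` C)) \<in> span (pw x ` {..<card (l ` C)})"
    by (simp add: n_def)
next
  fix k assume "pw x k \<in> span (pw x ` {..<k})"
  then show "card (l ` C) \<le> k"
    using pw_not_in_span[OF C] not_le by blast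
qed

lemma card_frame_unique:
  assumes "orth_prims C" "\<Sum>C = e" "orth_prims D" "\<Sum>D = e"
  shows "card C = card D"
  using card_orth_prims[OF assms(1)] card_orth_prims[OF assms(3)] assms nu_pos by simp

text \<open>All frames have the same size because they have the same trace. The size bounds the
  number of distinct eigenvalues of any element, and distinct coefficients on one frame attain
  it.\<close>

lemma card_frame:
  assumes "orth_prims C" "\<Sum>C = e"
  shows "card C = jrank (\<diamondop>) e"
proof -
  have "jdegree (\<diamondop>) e x \<le> card C" for x
  proof -
    obtain D l where D: "orth_prims D" "\<Sum>D = e" "x = (\<Sum>p\<in>D. l p *\<^sub>R p)" by (rule spectral)
    have "card (l ` D) \<le> card C"
      using card_image_le[OF orth_primsD(1)[OF D(1)], of l] card_frame_unique[OF assms D(1,2)] by simp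
    then show ?thesis using jdegree_eq[OF D] by simp
  qed
  moreover have "card C \<in> range (jdegree (\<diamondop>) e)"
  proof -
    obtain h :: "'a \<Rightarrow> nat" where h: "inj_on h C"
      using finite_imp_inj_to_nat_seg[OF orth_primsD(1)[OF assms(1)]] by blast
    then have "inj_on (\<lambda>p. real (h p)) C" by (auto simp: inj_on_def)
    from card_image[OF this] show ?thesis
      using jdegree_eq[OF assms refl, of "\<lambda>p. real (h p)"] by (metis rangeI)
  qed
  ultimately show ?thesis
    unfolding jrank_def by (intro Max_eqI[symmetric]) (auto intro: finite_subset[of _ "{..card C}"])
qed

lemma rank_nu: "e \<bullet> e = real (jrank (\<diamondop>) e) * nu"
  by (metis card_frame card_orth_prims spectral)

lemma rank_pos: "jrank (\<diamondop>) e > 0"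
proof -
  show ?thesis using rank_nu nu_pos e_nonzero by (cases "jrank (\<diamondop>) e") auto
qed

text \<open>Here the product runs over C, so eigenvalues count with multiplicity and the coefficient
  is the full sum even when some coincide.\<close>

lemma monic_spectral_relation:
  assumes C: "orth_prims C" "\<Sum>C = e" "x = (\<Sum>p\<in>C. l p *\<^sub>R p)" and s: "card C = Suc s"
  shows "pw x (Suc s) - (\<Sum>p\<in>C. l p) *\<^sub>R pw x s \<in> span (pw x ` {..<s})"
proof -
  define f :: "real poly" where "f = (\<Prod>p\<in>C. [:- l p, 1:])"
  have fin: "finite C" using orth_primsD[OF C(1)] by blast
  have ne: "C \<noteq> {}" using s by auto
  note f = monic_roots_poly[OF fin, where l = l, folded f_def, unfolded s]
  define S where "S = (\<Sum>i<s. coeff f i *\<^sub>R pw x i)"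
  have "(\<Sum>i<Suc (Suc s). coeff f i *\<^sub>R pw x i) = 0"
    using poly_spectral[OF C, of f "Suc s"] f(1,4) unfolding lessThan_Suc_atMost by simp
  then have "S + coeff f s *\<^sub>R pw x s + pw x (Suc s) = 0"
    using f(2) by (simp add: S_def)
  moreover have "coeff f s = - (\<Sum>p\<in>C. l p)" using f(3)[OF ne] by simp
  ultimately have "S + (pw x (Suc s) - (\<Sum>p\<in>C. l p) *\<^sub>R pw x s) = 0"
    by (simp add: algebra_simps)
  then have "pw x (Suc s) - (\<Sum>p\<in>C. l p) *\<^sub>R pw x s = - S"
    by (metis add_eq_0_iff)
  also have "- S \<in> span (pw x ` {..<s})"
    unfolding S_def by (intro span_neg span_sum span_scale span_base) auto
  finally show ?thesis .
qed

lemma jtrace_eq: "jtrace (\<diamondop>) e = (\<lambda>x. (x \<bullet> e) / nu)"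
  unfolding jtrace_def
proof (rule the_equality, intro conjI allI impI)
  let ?r = "jrank (\<diamondop>) e"
  show "linear (\<lambda>x. (x \<bullet> e) / nu)"
    by (auto intro!: linearI simp: inner_simps add_divide_distrib)
  fix x assume x: "regular (\<diamondop>) e x"
  obtain C l where C: "orth_prims C" "\<Sum>C = e" "x = (\<Sum>p\<in>C. l p *\<^sub>R p)" by (rule spectral)
  have cC: "card C = ?r" using card_frame[OF C(1,2)] .
  obtain s where s: "?r = Suc s" using rank_pos gr0_implies_Suc by blast
  have "(x \<bullet> e) / nu = (\<Sum>p\<in>C. l p)"
    using orth_prims_inner_e[OF C(1)] C(3) nu_pos by simp
  then show "pw x ?r - ((x \<bullet> e) / nu) *\<^sub>R pw x (?r - 1) \<in> span (pw x ` {..<?r - 1})"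
    using monic_spectral_relation[OF C, of s] cC unfolding s by simp
next
  let ?r = "jrank (\<diamondop>) e"
  fix t :: "'a \<Rightarrow> real"
  assume t: "linear t \<and> (\<forall>x. regular (\<diamondop>) e x \<longrightarrow>
    pw x ?r - t x *\<^sub>R pw x (?r - 1) \<in> span (pw x ` {..<?r - 1}))"
  \<comment> \<open>Were t x another number, the difference of the two relations would put a power
    below the degree of x into the span of lower powers.\<close>
  have reg: "t x = (\<Sum>p\<in>C. l p)" if C: "orth_prims C" "\<Sum>C = e" "x = (\<Sum>p\<in>C. l p *\<^sub>R p)" and inj: "inj_on l C" for C x and l
  proof (rule ccontr)
    assume ne: "t x \<noteq> (\<Sum>p\<in>C. l p)"
    have cC: "card C = ?r" using card_frame[OF C(1,2)] .
    obtain s where s: "?r = Suc s" using rank_pos gr0_implies_Suc by blast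
    have 1: "pw x ?r - (\<Sum>p\<in>C. l p) *\<^sub>R pw x s \<in> span (pw x ` {..<s})"
      using monic_spectral_relation[OF C, of s] cC unfolding s by simp
    have "card (l ` C) = ?r" using card_image[OF inj] cC by simp
    then have "regular (\<diamondop>) e x" unfolding regular_def using jdegree_eq[OF C] by simp
    then have 2: "pw x ?r - t x *\<^sub>R pw x s \<in> span (pw x ` {..<s})" using t s by auto
    have "(t x - (\<Sum>p\<in>C. l p)) *\<^sub>R pw x s \<in> span (pw x ` {..<s})"
      using span_diff[OF 1 2] by (simp add: scaleR_left_diff_distrib)
    then have "pw x s \<in> span (pw x ` {..<s})"
      using ne span_scale[of "(t x - (\<Sum>p\<in>C. l p)) *\<^sub>R pw x s" _ "1 / (t x - (\<Sum>p\<in>C. l p))"] by simp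
    then show False
      using pw_not_in_span[OF C, of s] \<open>card (l ` C) = ?r\<close> s by simp
  qed
  show "t = (\<lambda>x. (x \<bullet> e) / nu)"
  proof
    fix x
    obtain C l where C: "orth_prims C" "\<Sum>C = e" "x = (\<Sum>p\<in>C. l p *\<^sub>R p)" by (rule spectral)
    have fin: "finite C" using orth_primsD[OF C(1)] by blast
    have "t q = 1" if q: "q \<in> C" for q
    proof -
      obtain h :: "'a \<Rightarrow> nat" and n where h: "inj_on h C" and n: "h ` C = {i. i < n}"
        using finite_imp_inj_to_nat_seg[OF fin] by blast
      define l1 where "l1 p = real (h p)" for p
      \<comment> \<open>On C the values of h lie below n, so raising the one at q by n keeps all
        eigenvalues distinct. The two regular elements differ by n q, which yields t q = 1 by
        linearity.\<close>
      define l2 where "l2 p = (if p = q then real (h p) + real n else real (h p))" for p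
      have hn: "h p < n" if "p \<in> C" for p using n that by auto
      have n0: "n > 0" using hn q by fastforce
      have "inj_on l1 C" using h by (auto simp: inj_on_def l1_def)
      have "inj_on l2 C"
      proof (rule inj_onI)
        fix a b assume "a \<in> C" "b \<in> C" "l2 a = l2 b"
        then show "a = b"
          using hn[of a] hn[of b] inj_onD[OF h, of a b] by (auto simp: l2_def split: if_splits)
      qed
      have l2: "l2 p = l1 p + (if p = q then real n else 0)" for p by (simp add: l1_def l2_def)
      have "(\<Sum>p\<in>C. l2 p *\<^sub>R p) = (\<Sum>p\<in>C. l1 p *\<^sub>R p + (if p = q then real n *\<^sub>R p else 0))"
        unfolding l2 by (intro sum.cong) (auto simp: scaleR_add_left)
      then have "(\<Sum>p\<in>C. l2 p *\<^sub>R p) = (\<Sum>p\<in>C. l1 p *\<^sub>R p) + real n *\<^sub>R q"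
        using fin q by (simp add: sum.distrib)
      moreover have "(\<Sum>p\<in>C. l2 p) = (\<Sum>p\<in>C. l1 p) + real n"
        unfolding l2 using fin q by (simp add: sum.distrib)
      ultimately have "t (real n *\<^sub>R q) = real n"
        using reg[OF C(1,2) refl \<open>inj_on l1 C\<close>] reg[OF C(1,2) refl \<open>inj_on l2 C\<close>] t
        by (simp add: linear_add)
      then show ?thesis using n0 t by (simp add: linear_scale)
    qed
    then have "t x = (\<Sum>p\<in>C. l p)"
      unfolding C(3) using t by (simp add: linear_sum linear_scale)
    then show "t x = (x \<bullet> e) / nu"
      using orth_prims_inner_e[OF C(1)] C(3) nu_pos by simp
  qed
qed

section \<open>The trace form and reflections at primitive idempotents\<close>

abbreviation tf :: "'a \<Rightarrow> 'a \<Rightarrow> real" where "tf \<equiv> tform (\<diamondop>) e"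

lemma tf_eq: "tf x y = (x \<bullet> y) / nu"
  using inner_assoc[of x y e] by (simp add: tform_def jtrace_eq unit_right inner_commute)


lemma prim_jordan_idempotent: "prim c \<Longrightarrow> jordan_idempotent (\<diamondop>) e c"
  using jordan_idempotentI prim_idem by blast

lemmas reflect_prim_mult = jordan_idempotent.reflect_mult[OF prim_jordan_idempotent]
  and reflect_prim_reflect = jordan_idempotent.reflect_reflect[OF prim_jordan_idempotent]

lemma reflect_prim_e: "prim c \<Longrightarrow> reflect c e = e"
  by (simp add: reflect_def unit_right prim_idem)

lemma reflect_prim_self: "prim c \<Longrightarrow> reflect c c = c"
  by (simp add: reflect_def prim_idem)

lemma reflect_annihilated: "c \<diamondop> x = 0 \<Longrightarrow> reflect c x = x"
  by (simp add: reflect_def)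

text \<open>Splitting p into k primitive idempotents gives it inner product k \<open>nu\<close> with
  e, so k = 1. This avoids checking decompositions of p by hand.\<close>

lemma prim_if_trace:
  assumes "p \<diamondop> p = p" "p \<bullet> e = nu"
  shows "prim p"
proof -
  have "p \<noteq> 0" using assms nu_pos by auto
  then obtain C l where C: "orth_prims C" "\<Sum>C = p"
    using spectral_in_idempotent[of p p] assms by blast
  have "real (card C) * nu = 1 * nu"
    using card_orth_prims[OF C(1)] inner_e[OF assms(1)] assms(2) C(2) by simp
  then have "card C = 1" using nu_pos by simp
  then obtain c where "C = {c}" by (auto simp: card_1_singleton_iff)
  then show ?thesis using C orth_primsD(2)[OF C(1)] by auto
qed

subsection \<open>Off-diagonal Peirce spaces\<close>

abbreviation offdiag :: "'a \<Rightarrow> 'a \<Rightarrow> 'a set" where "offdiag \<equiv> offdiag_peirce_space (\<diamondop>)"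

lemma offdiag_mem: "z \<in> offdiag c d \<longleftrightarrow> c \<diamondop> z = (1/2) *\<^sub>R z \<and> d \<diamondop> z = (1/2) *\<^sub>R z"
  by (simp add: offdiag_peirce_space_def)

lemma subspace_offdiag: "subspace (offdiag c d)"
  by (auto simp: subspace_def offdiag_mem jp_simps scaleR_add_right)

text \<open>By \<open>peirce_half_rep\<close>, L(d) is twice its square on
  \<open>peirce c (1/2)\<close>, so multiplication by d maps into its eigenspace for 1/2.\<close>

lemma mult_offdiag:
  assumes "c \<diamondop> c = c" "d \<diamondop> d = d" "c \<diamondop> d = 0" "u \<in> peirce c (1/2)"
  shows "d \<diamondop> u \<in> offdiag c d"
proof -
  interpret jordan_idempotent "(\<diamondop>)" e c by (rule jordan_idempotentI[OF assms(1)])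
  have d: "d \<in> peirce c 0" using assms by (simp add: mem_peirce)
  have "d \<diamondop> u = 2 *\<^sub>R (d \<diamondop> (d \<diamondop> u))"
    using peirce_half_rep[OF d d assms(4)] assms(2) by (simp add: scaleR_2)
  then have "d \<diamondop> (d \<diamondop> u) = (1/2) *\<^sub>R (d \<diamondop> u)"
    by (metis (no_types) divide_self_if mult_1 scaleR_one scaleR_scaleR times_divide_eq_left zero_neq_numeral mult.commute)
  moreover have "c \<diamondop> (d \<diamondop> u) = (1/2) *\<^sub>R (d \<diamondop> u)"
    using peirce_0_mult[OF d assms(4)] by (simp add: mem_peirce)
  ultimately show ?thesis by (simp add: offdiag_mem)
qed

text \<open>The elements of \<open>peirce c 0\<close> that annihilate \<open>peirce c (1/2)\<close> form an ideal, so only \<open>0\<close>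
  does.\<close>

lemma offdiag_nontrivial:
  assumes "prim c" "prim d" "c \<diamondop> d = 0"
  obtains z where "z \<in> offdiag c d" "z \<noteq> 0"
proof -
  interpret J: jordan_idempotent "(\<diamondop>)" e c by (rule prim_jordan_idempotent[OF assms(1)])
  define I where "I = {x. c \<diamondop> x = 0 \<and> (\<forall>u\<in>peirce c (1/2). x \<diamondop> u = 0)}"
  have "subspace I" by (auto simp: I_def subspace_def jp_simps)
  moreover have "y \<diamondop> x \<in> I" if x: "x \<in> I" for x y
  proof -
    obtain y1 yh y0 where y: "y = y1 + yh + y0" "y1 \<in> peirce c 1" "yh \<in> peirce c (1/2)" "y0 \<in> peirce c 0"
      by (rule J.peirce_decomp)
    have x0: "x \<in> peirce c 0" using x by (simp add: I_def mem_peirce)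
    have "yh \<diamondop> x = 0" using x y(3) commute[of yh x] by (simp add: I_def)
    moreover have "y1 \<diamondop> x = 0" using J.peirce_1_0_mult[OF y(2) x0] .
    ultimately have yx: "y \<diamondop> x = y0 \<diamondop> x" using y(1) by (simp add: jp_simps)
    have "c \<diamondop> (y0 \<diamondop> x) = 0" using J.peirce_0_mult[OF y(4) x0] by (simp add: mem_peirce)
    moreover have "(y0 \<diamondop> x) \<diamondop> u = 0" if u: "u \<in> peirce c (1/2)" for u
      using J.peirce_half_rep[OF y(4) x0 u] J.peirce_0_mult[OF y(4) u] x u by (simp add: I_def)
    ultimately show ?thesis unfolding yx I_def by blast
  qed
  ultimately have "I = {0} \<or> I = UNIV" by (rule simple)
  moreover have "c \<notin> I" using prim_idem[OF assms(1)] prim_nz[OF assms(1)] by (simp add: I_def)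
  ultimately have "d \<notin> I" using prim_nz[OF assms(2)] by blast
  then obtain u where u: "u \<in> peirce c (1/2)" "d \<diamondop> u \<noteq> 0" using assms(3) by (auto simp: I_def)
  then show ?thesis
    using that mult_offdiag[OF prim_idem prim_idem] assms by blast
qed

text \<open>The product lies under c + d, and its parts under c and under d are multiples of c and d
  by primitivity; pairing with each gives the same coefficient.\<close>

lemma offdiag_mult:
  assumes "prim c" "prim d" "c \<diamondop> d = 0" "z \<in> offdiag c d" "w \<in> offdiag c d"
  shows "z \<diamondop> w = (z \<bullet> w / (2 * nu)) *\<^sub>R (c + d)"
proof -
  have cc: "c \<diamondop> c = c" "d \<diamondop> d = d" "d \<diamondop> c = 0"
    using assms prim_idem commute[of d c] by auto
  interpret h: jordan_idempotent "(\<diamondop>)" e "c + d"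
    by (rule jordan_idempotentI) (simp add: jp_simps cc assms(3))
  have "z \<in> peirce (c + d) 1" "w \<in> peirce (c + d) 1"
    using assms(4,5) by (simp_all add: mem_peirce offdiag_mem jp_simps scaleR_add_left[symmetric])
  then have h: "z \<diamondop> w = c \<diamondop> (z \<diamondop> w) + d \<diamondop> (z \<diamondop> w)"
    using h.peirce_1_mult[of z w 1] by (simp add: mem_peirce jp_simps)
  have part: "p \<diamondop> (z \<diamondop> w) = (z \<bullet> w / (2 * nu)) *\<^sub>R p" if p: "prim p" "p = c \<or> p = d" for p
  proof -
    interpret p: jordan_idempotent "(\<diamondop>)" e p by (rule prim_jordan_idempotent[OF p(1)])
    have zw: "p \<diamondop> z = (1/2) *\<^sub>R z" "p \<diamondop> w = (1/2) *\<^sub>R w" using p assms(4,5) by (auto simp: offdiag_mem)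
    then have "p \<diamondop> (p \<diamondop> (z \<diamondop> w)) = p \<diamondop> (z \<diamondop> w)"
      by (intro p.peirce_half_mult) (simp_all add: mem_peirce)
    then obtain \<mu> where \<mu>: "p \<diamondop> (z \<diamondop> w) = \<mu> *\<^sub>R p" using prim_peirce_1[OF p(1)] by blast
    have "(p \<diamondop> (z \<diamondop> w)) \<bullet> p = (z \<diamondop> w) \<bullet> p"
      using inner_assoc[of p "z \<diamondop> w" p] p.idem by simp
    also have "\<dots> = w \<bullet> (z \<diamondop> p)" by (rule inner_assoc)
    also have "\<dots> = z \<bullet> w / 2" using zw commute[of z p] by (simp add: inner_commute)
    finally have "\<mu> * nu = z \<bullet> w / 2" using \<mu> prim_nu[OF p(1)] by simp
    then have "\<mu> = z \<bullet> w / (2 * nu)" using nu_pos by (simp add: field_simps)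
    then show ?thesis using \<mu> by simp
  qed
  have "c \<diamondop> (z \<diamondop> w) = (z \<bullet> w / (2 * nu)) *\<^sub>R c" "d \<diamondop> (z \<diamondop> w) = (z \<bullet> w / (2 * nu)) *\<^sub>R d"
    using part assms by blast+
  then show ?thesis using h by (simp add: scaleR_add_right)
qed

subsection \<open>Pairs of primitive idempotents\<close>

text \<open>In a matrix model \<open>c = v v\<^sup>*\<close>, \<open>d = w w\<^sup>*\<close> with unit vectors \<open>v\<close>, \<open>w\<close>, one has \<open>\<beta> = \<langle>v,w\<rangle>\<close> and
  \<open>z = v w\<^sup>* + w v\<^sup>*\<close>, and \<open>mix\<close> corresponds to the vector \<open>a v + b w\<close>.\<close>

definition link :: "'a \<Rightarrow> 'a \<Rightarrow> real \<Rightarrow> 'a \<Rightarrow> bool" where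
  "link c d \<beta> z \<longleftrightarrow> prim c \<and> prim d \<and> \<beta> \<ge> 0 \<and> c \<diamondop> d = (\<beta>/2) *\<^sub>R z \<and>
     c \<diamondop> z = \<beta> *\<^sub>R c + (1/2) *\<^sub>R z \<and> d \<diamondop> z = \<beta> *\<^sub>R d + (1/2) *\<^sub>R z \<and> z \<diamondop> z = \<beta> *\<^sub>R z + c + d"

definition mix :: "'a \<Rightarrow> 'a \<Rightarrow> 'a \<Rightarrow> real \<Rightarrow> real \<Rightarrow> 'a" where
  "mix c d z a b = a\<^sup>2 *\<^sub>R c + b\<^sup>2 *\<^sub>R d + (a * b) *\<^sub>R z"

lemma linkD:
  assumes "link c d \<beta> z"
  shows "prim c" "prim d" "\<beta> \<ge> 0" "c \<diamondop> d = (\<beta>/2) *\<^sub>R z" "d \<diamondop> c = (\<beta>/2) *\<^sub>R z"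
    "c \<diamondop> z = \<beta> *\<^sub>R c + (1/2) *\<^sub>R z" "z \<diamondop> c = \<beta> *\<^sub>R c + (1/2) *\<^sub>R z"
    "d \<diamondop> z = \<beta> *\<^sub>R d + (1/2) *\<^sub>R z" "z \<diamondop> d = \<beta> *\<^sub>R d + (1/2) *\<^sub>R z"
    "z \<diamondop> z = \<beta> *\<^sub>R z + c + d" "c \<diamondop> c = c" "d \<diamondop> d = d"
proof -
  show "prim c" "prim d" "\<beta> \<ge> 0" "c \<diamondop> d = (\<beta>/2) *\<^sub>R z" "c \<diamondop> z = \<beta> *\<^sub>R c + (1/2) *\<^sub>R z"
    "d \<diamondop> z = \<beta> *\<^sub>R d + (1/2) *\<^sub>R z" "z \<diamondop> z = \<beta> *\<^sub>R z + c + d"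
    using assms by (simp_all only: link_def)
  then show "d \<diamondop> c = (\<beta>/2) *\<^sub>R z" "z \<diamondop> c = \<beta> *\<^sub>R c + (1/2) *\<^sub>R z" "z \<diamondop> d = \<beta> *\<^sub>R d + (1/2) *\<^sub>R z"
    "c \<diamondop> c = c" "d \<diamondop> d = d"
    using commute[of d c] commute[of z c] commute[of z d] prim_idem by simp_all
qed

text \<open>The number 2 \<open>nu\<close> is the inner product of c + d with e, hence the norm that
  makes the square of z equal to c + d.\<close>

lemma link_offdiag_iff:
  "link c d 0 z \<longleftrightarrow> prim c \<and> prim d \<and> c \<diamondop> d = 0 \<and> z \<in> offdiag c d \<and> z \<bullet> z = 2 * nu"
proof
  assume l: "link c d 0 z"
  have "(z \<diamondop> z) \<bullet> e = z \<bullet> z" using inner_assoc[of z z e] by (simp add: unit_right)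
  moreover have "(c + d) \<bullet> e = 2 * nu"
    using linkD(1,2)[OF l] prim_nu inner_e prim_idem by (simp add: inner_simps)
  ultimately show "prim c \<and> prim d \<and> c \<diamondop> d = 0 \<and> z \<in> offdiag c d \<and> z \<bullet> z = 2 * nu"
    using linkD[OF l] by (simp add: offdiag_mem)
next
  assume "prim c \<and> prim d \<and> c \<diamondop> d = 0 \<and> z \<in> offdiag c d \<and> z \<bullet> z = 2 * nu"
  then show "link c d 0 z"
    using offdiag_mult[of c d z z] nu_pos by (auto simp: link_def offdiag_mem)
qed

lemma ex_link_orthogonal:
  assumes "prim c" "prim d" "c \<diamondop> d = 0"
  obtains z where "link c d 0 z"
proof -
  obtain z where z: "z \<in> offdiag c d" "z \<noteq> 0" using offdiag_nontrivial[OF assms] .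
  let ?z = "(sqrt (2 * nu) / norm z) *\<^sub>R z"
  have "?z \<bullet> ?z = 2 * nu"
    using z nu_pos by (simp add: dot_square_norm power2_eq_square)
  moreover have "?z \<in> offdiag c d" using z subspace_offdiag subspace_scale by blast
  ultimately show ?thesis using that assms link_offdiag_iff by blast
qed

lemma prim_mult_prim:
  assumes "prim c"
  shows "2 *\<^sub>R (c \<diamondop> (c \<diamondop> x)) - c \<diamondop> x = (c \<bullet> x / nu) *\<^sub>R c"
  using prim_mult_left[OF assms, of x] prim_nu[OF assms] by simp

lemma inner_prim_nonneg:
  assumes "prim c" "prim d" shows "c \<bullet> d \<ge> 0"
proof -
  interpret jordan_idempotent "(\<diamondop>)" e c by (rule prim_jordan_idempotent[OF assms(1)])
  obtain x1 xh x0 where x: "d = x1 + xh + x0" "x1 \<in> peirce c 1" "xh \<in> peirce c (1/2)" "x0 \<in> peirce c 0"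
    by (rule peirce_decomp)
  have o: "x1 \<bullet> xh = 0" "x1 \<bullet> x0 = 0" "xh \<bullet> x0 = 0"
    using x peirce_orthogonal by force+
  have "c \<diamondop> d = x1 + (1/2) *\<^sub>R xh"
    using x by (simp add: jp_simps mem_peirce)
  then have "(c \<diamondop> d) \<bullet> d = x1 \<bullet> x1 + (1/2) * (xh \<bullet> xh)"
    using o by (simp add: x(1) inner_simps inner_commute)
  moreover have "(c \<diamondop> d) \<bullet> d = c \<bullet> d"
    using inner_assoc[of d c d] prim_idem[OF assms(2)] by (simp add: commute[of d c])
  ultimately show ?thesis using inner_ge_zero[of x1] inner_ge_zero[of xh] by linarith
qed

text \<open>If c and d are not orthogonal, the first equation of \<open>link\<close> forces z to be
  a multiple of \<open>c \<diamondop> d\<close>. If they are, it says nothing about z, which then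
  comes from the nontrivial off-diagonal space of a simple algebra.\<close>

lemma ex_link:
  assumes "prim c" "prim d"
  obtains \<beta> z where "link c d \<beta> z"
proof (cases "c \<bullet> d = 0")
  case True
  then show ?thesis using that ex_link_orthogonal assms prim_orthogonal_iff by metis
next
  case False
  define \<alpha> where "\<alpha> = c \<bullet> d / nu"
  define g where "g = c \<diamondop> d"
  define \<beta> where "\<beta> = sqrt \<alpha>"
  have \<alpha>: "\<alpha> > 0" using False inner_prim_nonneg[OF assms] nu_pos by (simp add: \<alpha>_def)
  have \<beta>: "\<beta> > 0" "\<beta> * \<beta> = \<alpha>" using \<alpha> by (simp_all add: \<beta>_def)
  have g: "c \<diamondop> g = (1/2) *\<^sub>R (\<alpha> *\<^sub>R c + g)" "d \<diamondop> g = (1/2) *\<^sub>R (\<alpha> *\<^sub>R d + g)"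
    using prim_mult_left[OF assms(1), of d] prim_mult_left[OF assms(2), of c] prim_nu[OF assms(1)] prim_nu[OF assms(2)]
    by (simp_all add: g_def \<alpha>_def commute[of d c] inner_commute[of d c])
  have gg: "2 *\<^sub>R (g \<diamondop> g) = \<alpha> *\<^sub>R g + (1/2) *\<^sub>R (\<alpha> *\<^sub>R c + \<alpha> *\<^sub>R d)"
    using prim_pair_square_aux[OF assms] prim_nu[OF assms(1)] prim_nu[OF assms(2)]
    by (simp add: g_def \<alpha>_def)
  let ?z = "(2/\<beta>) *\<^sub>R g"
  have "link c d \<beta> ?z"
    unfolding link_def
  proof (intro conjI assms)
    show "c \<diamondop> d = (\<beta> / 2) *\<^sub>R ?z" using \<beta> by (simp add: g_def)
    show "c \<diamondop> ?z = \<beta> *\<^sub>R c + (1/2) *\<^sub>R ?z" "d \<diamondop> ?z = \<beta> *\<^sub>R d + (1/2) *\<^sub>R ?z"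
      using \<beta>(1) by (simp_all add: jp_simps g scaleR_add_right \<beta>(2)[symmetric])
    have "?z \<diamondop> ?z = (2 / \<alpha>) *\<^sub>R (2 *\<^sub>R (g \<diamondop> g))"
      using \<beta>(1) by (simp add: jp_simps \<beta>(2)[symmetric])
    also have "\<dots> = 2 *\<^sub>R g + c + d"
      unfolding gg using \<alpha> by (simp add: scaleR_add_right)
    finally show "?z \<diamondop> ?z = \<beta> *\<^sub>R ?z + c + d" using \<beta>(1) by simp
  qed (use \<beta> in simp)
  then show ?thesis using that by blast
qed

lemma link_inner:
  assumes "link c d \<beta> z"
  shows "z \<bullet> e = 2 * \<beta> * nu" "c \<bullet> d = \<beta>\<^sup>2 * nu" "z \<bullet> c = 2 * \<beta> * nu"
proof -
  note l = linkD[OF assms]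
  have "(c \<diamondop> z) \<bullet> c = z \<bullet> c" using inner_assoc[of c z c] l by simp
  then show zc: "z \<bullet> c = 2 * \<beta> * nu"
    using prim_nu[OF l(1)] by (simp add: l(6) inner_simps)
  have "(c \<diamondop> z) \<bullet> e = z \<bullet> c" using inner_assoc[of c z e] by (simp add: unit_right)
  then show ze: "z \<bullet> e = 2 * \<beta> * nu"
    using zc prim_nu[OF l(1)] inner_e[OF l(11)] by (simp add: l(6) inner_simps)
  have "(c \<diamondop> d) \<bullet> e = c \<bullet> d" using inner_assoc[of c d e] by (simp add: unit_right inner_commute)
  then show "c \<bullet> d = \<beta>\<^sup>2 * nu" using ze by (simp add: l(4) power2_eq_square)
qed

text \<open>The factor is the squared length of a v + b w in the matrix model. It also gives the
  trace, so dividing by it yields a primitive idempotent.\<close>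

lemma mix_square:
  assumes "link c d \<beta> z"
  shows "mix c d z a b \<diamondop> mix c d z a b = (a\<^sup>2 + b\<^sup>2 + 2 * a * b * \<beta>) *\<^sub>R mix c d z a b"
  unfolding mix_def
  by (rule vector_inner_eqI)
     (simp add: jp_simps linkD(4-12)[OF assms] inner_simps power2_eq_square algebra_simps)

lemma mix_trace:
  assumes "link c d \<beta> z"
  shows "mix c d z a b \<bullet> e = (a\<^sup>2 + b\<^sup>2 + 2 * a * b * \<beta>) * nu"
  using link_inner[OF assms] prim_nu inner_e linkD[OF assms] by (simp add: mix_def inner_simps algebra_simps)

lemma prim_scaled:
  assumes "x \<diamondop> x = t *\<^sub>R x" "x \<bullet> e = t * nu" "t \<noteq> 0"
  shows "prim ((1/t) *\<^sub>R x)"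
  using assms by (intro prim_if_trace) (simp_all add: jp_simps)

lemma prim_mix:
  assumes "link c d \<beta> z" "a\<^sup>2 + b\<^sup>2 + 2 * a * b * \<beta> \<noteq> 0"
  shows "prim ((1 / (a\<^sup>2 + b\<^sup>2 + 2 * a * b * \<beta>)) *\<^sub>R mix c d z a b)"
  using mix_square[OF assms(1)] mix_trace[OF assms(1)] assms(2) by (intro prim_scaled)

text \<open>In the matrix model the idempotent belongs to the line through v + w, and the reflection
  in that line exchanges the unit vectors v and w.\<close>

lemma reflect_midpoint:
  assumes "link c d \<beta> z"
  shows "reflect ((1 / (2 + 2 * \<beta>)) *\<^sub>R (c + d + z)) c = d"
proof -
  note l = linkD[OF assms]
  define p where "p = (1 / (2 + 2 * \<beta>)) *\<^sub>R (c + d + z)"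
  have \<beta>: "2 + 2 * \<beta> > 0" using l(3) by simp
  have "(c + d + z) \<diamondop> c = (1 + \<beta>) *\<^sub>R c + ((1 + \<beta>) / 2) *\<^sub>R z" "(c + d + z) \<diamondop> z = (1 + \<beta>) *\<^sub>R (c + d + z)"
    by (rule vector_inner_eqI, simp add: jp_simps l(4-12) inner_simps algebra_simps add_divide_distrib)+
  then have "p \<diamondop> c = ((1 / (2 + 2 * \<beta>)) * (1 + \<beta>)) *\<^sub>R (c + (1/2) *\<^sub>R z)"
    "p \<diamondop> z = ((1 / (2 + 2 * \<beta>)) * (1 + \<beta>)) *\<^sub>R (c + d + z)"
    unfolding p_def jp.scaleR_left by (simp_all add: scaleR_add_right)
  moreover have "(1 / (2 + 2 * \<beta>)) * (1 + \<beta>) = 1/2" using \<beta> by (simp add: field_simps)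
  ultimately have "p \<diamondop> c = (1/2) *\<^sub>R (c + (1/2) *\<^sub>R z)" "p \<diamondop> z = (1/2) *\<^sub>R (c + d + z)"
    by simp_all
  then have "reflect p c = d"
    unfolding reflect_def by - (rule vector_inner_eqI, simp add: jp_simps inner_simps add_divide_distrib)
  then show ?thesis by (simp add: p_def)
qed

text \<open>Pairing a z with z gives a paired with the square of z, a combination of z, c and d, all
  orthogonal to a; positivity of L(a) does the rest. So motions built from c, d and z fix such
  idempotents a.\<close>

lemma link_annihilated:
  assumes "link c d \<beta> z" "a \<diamondop> a = a" "a \<diamondop> c = 0" "a \<diamondop> d = 0"
  shows "a \<diamondop> z = 0"
proof -
  interpret jordan_idempotent "(\<diamondop>)" e a by (rule jordan_idempotentI[OF assms(2)])
  note l = linkD[OF assms(1)]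
  have "(a \<diamondop> c) \<bullet> z = a \<bullet> (c \<diamondop> z)"
    using inner_assoc[of c a z] commute[of c a] by simp
  moreover have "a \<bullet> c = 0" "a \<bullet> d = 0"
    using inner_assoc[of a a c] inner_assoc[of a a d] assms by auto
  ultimately have az: "a \<bullet> z = 0" using assms(3) by (simp add: l(6) inner_simps)
  have "(a \<diamondop> z) \<bullet> z = a \<bullet> (z \<diamondop> z)"
    using inner_assoc[of z a z] commute[of z a] by simp
  then have "(a \<diamondop> z) \<bullet> z = 0"
    using az \<open>a \<bullet> c = 0\<close> \<open>a \<bullet> d = 0\<close> by (simp add: l(10) inner_simps)
  then show ?thesis by (rule L_nonneg_zero)
qed

text \<open>\<open>S\<close> is an arc of primitive idempotents from \<open>c\<close> to the midpoint \<open>p\<close> of \<open>c\<close> and \<open>d\<close>.\<close>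

lemma prim_swap:
  assumes "prim c" "prim d"
  obtains p S where "connected S" "S \<subseteq> Collect prim" "p \<in> S" "c \<in> S" "reflect p c = d"
    "\<And>a q. q \<in> S \<Longrightarrow> a \<diamondop> a = a \<Longrightarrow> a \<diamondop> c = 0 \<Longrightarrow> a \<diamondop> d = 0 \<Longrightarrow> a \<diamondop> q = 0"
proof -
  obtain \<beta> z where l: "link c d \<beta> z" using ex_link[OF assms] .
  \<comment> \<open>The squared length of v + t w; it is positive on the unit interval because
    \<beta> is nonnegative.\<close>
  define \<tau> where "\<tau> t = 1\<^sup>2 + t\<^sup>2 + 2 * 1 * t * \<beta>" for t :: real
  define \<gamma> where "\<gamma> t = (1 / \<tau> t) *\<^sub>R mix c d z 1 t" for t
  have \<tau>: "\<tau> t > 0" if "t \<in> {0..1}" for t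
  proof -
    have "t * \<beta> \<ge> 0" using that linkD(3)[OF l] by simp
    then have "0 < 1 + (t\<^sup>2 + 2 * (t * \<beta>))" by (intro add_pos_nonneg add_nonneg_nonneg) auto
    then show ?thesis by (simp add: \<tau>_def)
  qed
  show ?thesis
  proof (rule that[of "\<gamma> ` {0..1}" "\<gamma> 1"])
    have "continuous_on {0..1} \<gamma>"
      unfolding \<gamma>_def mix_def using \<tau> unfolding \<tau>_def
      by (intro continuous_intros ballI) fastforce
    then show "connected (\<gamma> ` {0..1})" by (intro connected_continuous_image) auto
    show "\<gamma> ` {0..1} \<subseteq> Collect prim"
    proof
      fix x assume "x \<in> \<gamma> ` {0..1}"
      then obtain t where t: "t \<in> {0..1}" "x = \<gamma> t" by blast
      have "prim (\<gamma> t)" unfolding \<gamma>_def \<tau>_def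
        by (rule prim_mix[OF l]) (use \<tau>[OF t(1)] in \<open>simp add: \<tau>_def\<close>)
      then show "x \<in> Collect prim" using t(2) by simp
    qed
    show "\<gamma> 1 \<in> \<gamma> ` {0..1}" by simp
    have "\<gamma> 0 = c" by (simp add: \<gamma>_def \<tau>_def mix_def)
    then show "c \<in> \<gamma> ` {0..1}" by force
    have "\<gamma> 1 = (1 / (2 + 2 * \<beta>)) *\<^sub>R (c + d + z)" by (simp add: \<gamma>_def \<tau>_def mix_def)
    then show "reflect (\<gamma> 1) c = d" using reflect_midpoint[OF l] by simp
    fix a q assume "q \<in> \<gamma> ` {0..1}" "a \<diamondop> a = a" "a \<diamondop> c = 0" "a \<diamondop> d = 0"
    then show "a \<diamondop> q = 0"
      using link_annihilated[OF l] by (auto simp: \<gamma>_def mix_def jp_simps)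
  qed
qed


subsection \<open>The structure group\<close>

text \<open>At p = q and t = 1 this is the identity, the starting point of the paths below; the
  factor t reaches positive multiples of idempotents.\<close>

definition reflect2 :: "real \<Rightarrow> 'a \<Rightarrow> 'a \<Rightarrow> 'a \<Rightarrow>\<^sub>L 'a" where
  "reflect2 t p q = Blinfun (\<lambda>x. t *\<^sub>R reflect p (reflect q x))"

lemma reflect2_apply [simp]: "blinfun_apply (reflect2 t p q) x = t *\<^sub>R reflect p (reflect q x)"
proof -
  have "bounded_linear (\<lambda>x. t *\<^sub>R reflect p (reflect q x))"
    by (intro bounded_linear_const_scaleR bounded_linear_compose[OF bounded_linear_reflect]
        bounded_linear_reflect)
  then show ?thesis by (simp add: reflect2_def bounded_linear_Blinfun_apply)
qed

lemma continuous_on_reflect2: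
  "continuous_on S (\<lambda>u. reflect2 (fst u) (snd u) q)"
proof (rule continuous_on_blinfun_componentwise)
  fix i :: 'a
  show "continuous_on S (\<lambda>u. blinfun_apply (reflect2 (fst u) (snd u) q) i)"
    by (simp add: reflect_def[of "snd _"]) (intro continuous_intros jp.continuous_on)
qed

lemma P2_prim: "prim c \<Longrightarrow> P2 (\<diamondop>) c c x = (c \<bullet> x / nu) *\<^sub>R c"
  using prim_mult_prim[of c x] prim_idem[of c] by (simp add: P2_def scaleR_2)

lemma P2_e: "P2 (\<diamondop>) x x e = x \<diamondop> x"
  by (simp add: P2_def unit_right)

lemma reflect2_structure_group:
  assumes "prim p" "prim q" "t > 0"
  shows "reflect2 t p q \<in> structure_group (\<diamondop>) e"
  unfolding structure_group_def
\<comment> \<open>Reflections are self-adjoint, so the adjoint of the product is the product in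
  reverse order; being automorphisms, they carry P(x) to P of the image.\<close>
proof (intro CollectI conjI exI[of _ "reflect2 t q p"] allI)
  note r = reflect_prim_reflect[OF assms(1)] reflect_prim_reflect[OF assms(2)]
  have "reflect2 t p q (reflect2 (1/t) q p x) = x" "reflect2 (1/t) q p (reflect2 t p q x) = x" for x
    using assms(3) by (simp_all add: reflect_simps r)
  then show "bij (blinfun_apply (reflect2 t p q))"
    by (intro bijI inj_on_inverseI[of _ "blinfun_apply (reflect2 (1/t) q p)"] surjI) auto
  show "tf (reflect2 t p q x) y = tf x (reflect2 t q p y)" for x y
    by (simp add: tf_eq reflect_self_adjoint)
  show "P2 (\<diamondop>) (reflect2 t p q x) (reflect2 t p q x) =
      blinfun_apply (reflect2 t p q) \<circ> P2 (\<diamondop>) x x \<circ> blinfun_apply (reflect2 t q p)" for x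
  proof
    fix y
    define w where "w = reflect q (reflect p y)"
    have "y = reflect p (reflect q w)" by (simp add: w_def r)
    then show "P2 (\<diamondop>) (reflect2 t p q x) (reflect2 t p q x) y =
      (blinfun_apply (reflect2 t p q) \<circ> P2 (\<diamondop>) x x \<circ> blinfun_apply (reflect2 t q p)) y"
      by (simp add: P2_def jp_simps r reflect_simps reflect_prim_mult[OF assms(1)] reflect_prim_mult[OF assms(2)]
          scaleR_diff_right scaleR_add_right)
  qed
qed

lemma reflect2_str_group0:
  assumes "connected S" "S \<subseteq> Collect prim" "p \<in> S" "q \<in> S" "t > 0"
  shows "reflect2 t p q \<in> str_group0 (\<diamondop>) e"
proof -
  \<comment> \<open>Only the first reflection and the scalar move, while q stays fixed.\<close>
  let ?T = "(\<lambda>u. reflect2 (fst u) (snd u) q) ` ({0<..} \<times> S)"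
  have "connected ?T"
    using assms(1) by (intro connected_continuous_image continuous_on_reflect2 connected_Times) auto
  moreover have "?T \<subseteq> structure_group (\<diamondop>) e"
  proof
    fix g assume "g \<in> ?T"
    then obtain s p' where g: "g = reflect2 s p' q" "s > 0" "p' \<in> S" by auto
    have "prim p'" "prim q" using assms(2,4) g by auto
    then show "g \<in> structure_group (\<diamondop>) e" unfolding g(1) using g(2) by (rule reflect2_structure_group)
  qed
  moreover have "reflect2 1 q q = id_blinfun"
    using assms(2,4) by (intro blinfun_eqI) (auto simp: reflect_prim_reflect)
  then have "id_blinfun \<in> ?T" using assms(4) by (force intro: rev_image_eqI[of "(1, q)"])
  moreover have "reflect2 t p q \<in> ?T" using assms by (force intro: rev_image_eqI[of "(t, p)"])
  ultimately show ?thesis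
    unfolding str_group0_def connected_component_def mem_Collect_eq by blast
qed

lemma reflect2_KL:
  assumes "connected S" "S \<subseteq> Collect prim" "p \<in> S" "q \<in> S"
  shows "reflect2 1 p q \<in> KL (\<diamondop>) e"
proof -
  have "prim p" "prim q" using assms by auto
  then show ?thesis
    using reflect2_str_group0[OF assms, of 1] by (simp add: KL_def reflect_prim_e)
qed

lemma str_group0_subset: "str_group0 (\<diamondop>) e \<subseteq> structure_group (\<diamondop>) e"
  unfolding str_group0_def by (rule connected_component_subset)

text \<open>At x = e the defining identity makes the adjoint h the inverse of k, so k is orthogonal
  and h fixes e. Evaluating the identity for P(k x) at e then shows that k preserves squares, hence
  products.\<close>

lemma KL_automorphism:
  assumes "k \<in> KL (\<diamondop>) e"
  shows "bij (blinfun_apply k)" "k e = e" "k (x \<diamondop> y) = k x \<diamondop> k y" "k x \<bullet> k y = x \<bullet> y"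
proof -
  show ke: "k e = e" using assms by (simp add: KL_def)
  have "k \<in> structure_group (\<diamondop>) e" using assms str_group0_subset by (auto simp: KL_def)
  then obtain h :: "'a \<Rightarrow>\<^sub>L 'a" where bij: "bij (blinfun_apply k)"
    and h: "\<And>x y. tf (k x) y = tf x (h y)"
    and P: "\<And>x. P2 (\<diamondop>) (k x) (k x) = blinfun_apply k \<circ> P2 (\<diamondop>) x x \<circ> blinfun_apply h"
    unfolding structure_group_def by blast
  show "bij (blinfun_apply k)" by fact
  have "k (h y) = y" for y
    using fun_cong[OF P[of e], of y] by (simp add: ke P2_def unit)
  then have hk: "h (k y) = y" for y using bij by (metis bij_is_inj injD)
  show "k x \<bullet> k y = x \<bullet> y" using h[of x "k y"] nu_pos by (simp add: hk tf_eq)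
  have sq: "k x \<diamondop> k x = k (x \<diamondop> x)" for x
    using fun_cong[OF P[of x], of e] hk[of e] by (simp add: P2_e ke)
  have "2 *\<^sub>R (k (x \<diamondop> y)) = 2 *\<^sub>R (k x \<diamondop> k y)"
    using sq[of "x + y"] sq[of x] sq[of y] commute[of y x] commute[of "k y" "k x"]
    by (simp add: jp_simps blinfun.add_right scaleR_2)
  then show "k (x \<diamondop> y) = k x \<diamondop> k y" by simp
qed

lemma KL_prim:
  assumes "k \<in> KL (\<diamondop>) e" "prim c" shows "prim (k c)"
proof (rule prim_if_trace)
  show "k c \<diamondop> k c = k c"
    using KL_automorphism(3)[OF assms(1), of c c] prim_idem[OF assms(2)] by simp
  show "k c \<bullet> e = nu"
    using KL_automorphism(2,4)[OF assms(1)] inner_e prim_idem[OF assms(2)] prim_nu[OF assms(2)] by metis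
qed

subsection \<open>The orbit of a primitive idempotent\<close>

text \<open>Primitive idempotents are reached by \<open>prim_swap\<close>, their multiples by the
  scalar. Conversely P(h c) inherits rank one from P(c), which makes the square of h c a multiple of
  h c; connectedness keeps the multiple positive.\<close>

lemma Xi_eq:
  assumes "prim c"
  shows "Xi (\<diamondop>) e c = {t *\<^sub>R p | t p. t > 0 \<and> prim p}"
proof (intro equalityI subsetI)
  fix x assume "x \<in> {t *\<^sub>R p | t p. t > 0 \<and> prim p}"
  then obtain t d where x: "x = t *\<^sub>R d" "t > 0" "prim d" by blast
  obtain p S where S: "connected S" "S \<subseteq> Collect prim" "p \<in> S" "c \<in> S" "reflect p c = d"
    using prim_swap[OF assms x(3)] .
  have "reflect2 t p c c = x" using assms by (simp add: reflect_prim_self S x)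
  then show "x \<in> Xi (\<diamondop>) e c"
    using reflect2_str_group0[OF S(1-4) x(2)] unfolding Xi_def by blast
next
  fix x assume "x \<in> Xi (\<diamondop>) e c"
  then obtain g where g: "g \<in> str_group0 (\<diamondop>) e" "x = blinfun_apply g c" by (auto simp: Xi_def)
  then obtain T where T: "connected T" "T \<subseteq> structure_group (\<diamondop>) e" "id_blinfun \<in> T" "g \<in> T"
    unfolding str_group0_def connected_component_def by blast
  have sq: "h c \<diamondop> h c = ((h c \<bullet> e) / nu) *\<^sub>R h c \<and> h c \<bullet> e \<noteq> 0" if "h \<in> T" for h :: "'a \<Rightarrow>\<^sub>L 'a"
  proof -
    obtain h' :: "'a \<Rightarrow>\<^sub>L 'a" where bij: "bij (blinfun_apply h)"
      and h': "\<And>x y. tf (h x) y = tf x (h' y)"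
      and P: "\<And>x. P2 (\<diamondop>) (h x) (h x) = blinfun_apply h \<circ> P2 (\<diamondop>) x x \<circ> blinfun_apply h'"
    proof -
      have "h \<in> structure_group (\<diamondop>) e" using T(2) \<open>h \<in> T\<close> by blast
      then show ?thesis using that unfolding structure_group_def by blast
    qed
    have "h c \<diamondop> h c = h (P2 (\<diamondop>) c c (h' e))"
      using fun_cong[OF P[of c], of e] by (simp add: P2_e)
    also have "\<dots> = ((h c \<bullet> e) / nu) *\<^sub>R h c"
      using h'[of c e] by (simp only: P2_prim[OF assms] tf_eq blinfun.scaleR_right)
    finally have 1: "h c \<diamondop> h c = ((h c \<bullet> e) / nu) *\<^sub>R h c" .
    have "h c \<noteq> 0" using bij prim_nz[OF assms] by (metis bij_is_inj injD blinfun.zero_right)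
    moreover have "(h c \<diamondop> h c) \<bullet> e = h c \<bullet> h c" using inner_assoc[of "h c" "h c" e] by (simp add: unit_right)
    ultimately have "h c \<bullet> e \<noteq> 0" using 1 by auto
    with 1 show ?thesis by blast
  qed
  \<comment> \<open>The trace of h c never vanishes on T and is positive at the identity, so it
    cannot become negative.\<close>
  have "connected ((\<lambda>h. blinfun_apply h c \<bullet> e) ` T)"
    by (intro connected_continuous_image continuous_intros T)
  moreover have "c \<bullet> e \<in> (\<lambda>h. blinfun_apply h c \<bullet> e) ` T"
    using T(3) by (force intro: rev_image_eqI)
  moreover have "c \<bullet> e > 0" using inner_e[OF prim_idem] prim_nu nu_pos assms by simp
  moreover have "0 \<notin> (\<lambda>h. blinfun_apply h c \<bullet> e) ` T" using sq by auto
  ultimately have pos: "x \<bullet> e > 0"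
    using T(4) g(2) unfolding connected_iff_interval by (metis (no_types, lifting) imageI less_eq_real_def not_less)
  define t where "t = (x \<bullet> e) / nu"
  have t: "t > 0" using pos nu_pos by (simp add: t_def)
  have "prim ((1/t) *\<^sub>R x)"
    using sq[OF T(4)] g(2) t nu_pos by (intro prim_scaled) (simp_all add: t_def)
  then show "x \<in> {t *\<^sub>R p | t p. t > 0 \<and> prim p}"
    using t by (intro CollectI exI[of _ t] exI[of _ "(1/t) *\<^sub>R x"]) simp
qed

lemma SS_eq:
  assumes "prim c"
  shows "SS (\<diamondop>) e c = Collect prim"
proof -
  have "tnorm (\<diamondop>) e (t *\<^sub>R p) = 1 \<longleftrightarrow> t = 1" if "t > 0" "prim p" for t p
    using that prim_nu[OF that(2)] nu_pos by (simp add: tnorm_def tf_eq)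
  note norm = this
  show ?thesis
  proof (intro equalityI subsetI)
    fix x assume "x \<in> Collect prim"
    then have x: "prim x" by simp
    then have "x \<in> Xi (\<diamondop>) e c"
      unfolding Xi_eq[OF assms] by (intro CollectI exI[of _ 1] exI[of _ x]) simp
    then show "x \<in> SS (\<diamondop>) e c"
      using norm[of 1 x] x by (simp add: SS_def)
  qed (auto simp: SS_def Xi_eq[OF assms] norm)
qed

text \<open>The last clause allows frames to be moved one member at a time: members already in
  place, and orthogonal to both c and d, stay fixed.\<close>

lemma KL_trans:
  assumes "prim c" "prim d"
  obtains k where "k \<in> KL (\<diamondop>) e" "k c = d"
    "\<forall>a. a \<diamondop> a = a \<and> a \<diamondop> c = 0 \<and> a \<diamondop> d = 0 \<longrightarrow> k a = a"
proof -
  show ?thesis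
  proof (rule prim_swap[OF assms])
    fix p S
    assume S: "connected S" "S \<subseteq> Collect prim" "p \<in> S" "c \<in> S" "reflect p c = d"
      and ann: "\<And>a q. q \<in> S \<Longrightarrow> a \<diamondop> a = a \<Longrightarrow> a \<diamondop> c = 0 \<Longrightarrow> a \<diamondop> d = 0 \<Longrightarrow> a \<diamondop> q = 0"
    show thesis
    proof (rule that[of "reflect2 1 p c"])
      show "reflect2 1 p c \<in> KL (\<diamondop>) e" by (rule reflect2_KL[OF S(1-4)])
      show "reflect2 1 p c c = d" using assms S by (simp add: reflect_prim_self)
      have "reflect2 1 p c a = a" if a: "a \<diamondop> a = a" "a \<diamondop> c = 0" "a \<diamondop> d = 0" for a
      proof -
        have "p \<diamondop> a = 0" "c \<diamondop> a = 0"
          using ann[OF S(3) a] a(2) by (simp_all only: commute[of p a] commute[of c a])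
        then show ?thesis by (simp add: reflect_annihilated)
      qed
      then show "\<forall>a. a \<diamondop> a = a \<and> a \<diamondop> c = 0 \<and> a \<diamondop> d = 0 \<longrightarrow> reflect2 1 p c a = a"
        by blast
    qed
  qed
qed

lemma KL_offdiag_dim:
  assumes k: "k \<in> KL (\<diamondop>) e"
  shows "dim (offdiag (k a) (k b)) = dim (offdiag a b)"
proof -
  note K = KL_automorphism[OF k]
  have lin: "linear (blinfun_apply k)" by (intro bounded_linear.linear blinfun.bounded_linear_right)
  have inj: "inj (blinfun_apply k)" using K(1) bij_is_inj by blast
  have "offdiag (k a) (k b) = blinfun_apply k ` offdiag a b"
  proof (intro equalityI subsetI)
    fix y assume y: "y \<in> offdiag (k a) (k b)"
    obtain x where x: "y = k x" using K(1) by (metis bij_pointE)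
    have "k (a \<diamondop> x) = k ((1/2) *\<^sub>R x)" "k (b \<diamondop> x) = k ((1/2) *\<^sub>R x)"
      using y by (simp_all add: K(3) x offdiag_mem blinfun.scaleR_right)
    then have "x \<in> offdiag a b" using inj by (auto simp: offdiag_mem dest: injD)
    then show "y \<in> blinfun_apply k ` offdiag a b" using x by blast
  next
    fix y assume "y \<in> blinfun_apply k ` offdiag a b"
    then show "y \<in> offdiag (k a) (k b)"
      by (auto simp: offdiag_mem K(3)[symmetric] blinfun.scaleR_right)
  qed
  then show ?thesis using dim_image_eq[OF lin inj_on_subset[OF inj]] by simp
qed

lemma offdiag_dim_const:
  assumes "prim a" "prim b" "a \<diamondop> b = 0" "prim c" "prim d" "c \<diamondop> d = 0"
  shows "dim (offdiag a b) = dim (offdiag c d)"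
proof -
  obtain k where k: "k \<in> KL (\<diamondop>) e" "k a = c" using KL_trans[OF assms(1,4)] by metis
  have "c \<diamondop> k b = 0" using KL_automorphism(3)[OF k(1), of a b] assms(3) k(2) by (simp add: blinfun.zero_right)
  obtain k' where k': "k' \<in> KL (\<diamondop>) e" "k' (k b) = d"
    "\<forall>a. a \<diamondop> a = a \<and> a \<diamondop> k b = 0 \<and> a \<diamondop> d = 0 \<longrightarrow> k' a = a"
    using KL_trans[OF KL_prim[OF k(1) assms(2)] assms(5)] by blast
  have "k' c = c" using k'(3) prim_idem[OF assms(4)] \<open>c \<diamondop> k b = 0\<close> assms(6) by blast
  show ?thesis
    using KL_offdiag_dim[OF k(1), of a b] KL_offdiag_dim[OF k'(1), of c "k b"] k(2) k'(2) \<open>k' c = c\<close> by simp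
qed

lemma jordan_frame_iff: "jordan_frame (\<diamondop>) e C \<longleftrightarrow> orth_prims C \<and> \<Sum>C = e"
  by (auto simp: jordan_frame_def orth_prims_def)

lemma ex_frame_containing:
  assumes "orth_prims A"
  obtains C where "A \<subseteq> C" "orth_prims C" "\<Sum>C = e"
proof -
  define s where "s = \<Sum>A"
  have fin: "finite A" using assms by (simp add: orth_prims_def)
  have s: "s \<diamondop> s = s" using orth_prims_idem[OF assms(1)] by (simp add: s_def)
  note c = complement_idem[OF unit s unit]
  show ?thesis
  proof (cases "e - s = 0")
    case True
    then show ?thesis using that[of A] assms by (simp add: s_def)
  next
    case False
    then obtain C where C: "orth_prims C" "\<Sum>C = e - s" "\<forall>p\<in>C. (e - s) \<diamondop> p = p"
      using spectral_in_idempotent[OF c(1), of "e - s"] c(1) by blast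
    have orth: "a \<diamondop> p = 0" if "a \<in> A" "p \<in> C" for a p
    proof (rule sub_idempotents_orthogonal[OF s c(1) c(3)])
      show "s \<diamondop> a = a" using orth_prims_mult[OF assms(1) that(1), of "\<lambda>_. 1"] by (simp add: s_def)
      show "(e - s) \<diamondop> p = p" using C that by blast
    qed
    have disj: "A \<inter> C = {}"
      using orth assms unfolding orth_prims_def primitive_idempotent_def by fastforce
    have "orth_prims (A \<union> C)"
      using assms C(1) orth commute unfolding orth_prims_def by (metis Un_iff finite_Un)
    moreover have "\<Sum>(A \<union> C) = e"
      using disj fin orth_primsD(1)[OF C(1)] C(2) by (simp add: sum.union_disjoint s_def)
    ultimately show ?thesis using that by blast
  qed
qed

lemma extend_orth_prims:
  assumes "orth_prims A" "\<Sum>A \<noteq> e"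
  obtains p where "prim p" "\<And>a. a \<in> A \<Longrightarrow> a \<diamondop> p = 0"
proof -
  obtain C where C: "A \<subseteq> C" "orth_prims C" "\<Sum>C = e" using ex_frame_containing[OF assms(1)] .
  then have "A \<noteq> C" using assms(2) by auto
  then obtain p where p: "p \<in> C" "p \<notin> A" using C(1) by blast
  have "a \<diamondop> p = 0" if "a \<in> A" for a using orth_primsD(3)[OF C(2)] C(1) p that by blast
  then show ?thesis using that orth_primsD(2)[OF C(2) p(1)] by blast
qed

lemma offdiag_peirce_dim_eq:
  assumes "jrank (\<diamondop>) e > 1" "prim a" "prim b" "a \<diamondop> b = 0"
  shows "dim (offdiag a b) = offdiag_peirce_dim (\<diamondop>) e"
proof -
  \<comment> \<open>A frame through a and b makes the condition in the definite description
    effective, so its value is unique.\<close>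
  obtain C where C: "{a, b} \<subseteq> C" "orth_prims C" "\<Sum>C = e"
    using ex_frame_containing[of "{a,b}"] assms commute[of b a] by (auto simp: orth_prims_def)
  have ab: "a \<noteq> b" using assms prim_idem prim_nz by metis
  have "offdiag_peirce_dim (\<diamondop>) e = dim (offdiag a b)"
    unfolding offdiag_peirce_dim_def
  proof (rule the_equality)
    show "\<forall>C. jordan_frame (\<diamondop>) e C \<longrightarrow> (\<forall>c\<in>C. \<forall>d\<in>C. c \<noteq> d \<longrightarrow> dim (offdiag c d) = dim (offdiag a b))"
      using offdiag_dim_const assms unfolding jordan_frame_def by metis
    show "n = dim (offdiag a b)"
      if "\<forall>C. jordan_frame (\<diamondop>) e C \<longrightarrow> (\<forall>c\<in>C. \<forall>d\<in>C. c \<noteq> d \<longrightarrow> dim (offdiag c d) = n)" for n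
      using that C ab jordan_frame_iff by (metis insert_subset)
  qed
  then show ?thesis by simp
qed

subsection \<open>Transitivity of the stabilizer\<close>

lemma KL_stab_frame:
  assumes "prim c" "prim f" "prim f'" "c \<diamondop> f = 0" "c \<diamondop> f' = 0"
  obtains k where "k \<in> KL_stab (\<diamondop>) e c" "k f = f'"
proof -
  obtain k where k: "k \<in> KL (\<diamondop>) e" "k f = f'"
    "\<forall>a. a \<diamondop> a = a \<and> a \<diamondop> f = 0 \<and> a \<diamondop> f' = 0 \<longrightarrow> k a = a"
    using KL_trans[OF assms(2,3)] by blast
  have "k c = c" using k(3) assms(4,5) prim_idem[OF assms(1)] by blast
  then show ?thesis using that k(1,2) by (simp add: KL_stab_def)
qed

lemma KL_stab_link:
  assumes "k \<in> KL_stab (\<diamondop>) e c" "link c f 0 z"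
  shows "link c (k f) 0 (k z)"
proof -
  have k: "k \<in> KL (\<diamondop>) e" "k c = c" using assms by (auto simp: KL_stab_def)
  note K = KL_automorphism[OF k(1)] and l = linkD[OF assms(2)]
  have "c \<diamondop> k f = k (c \<diamondop> f)" "c \<diamondop> k z = k (c \<diamondop> z)" "k f \<diamondop> k z = k (f \<diamondop> z)" "k z \<diamondop> k z = k (z \<diamondop> z)"
    using K(3) k(2) by metis+
  then show ?thesis
    unfolding link_def using l KL_prim[OF k(1)] k(2)
    by (simp add: blinfun.scaleR_right blinfun.add_right blinfun.zero_right)
qed

text \<open>Since m has squared norm 2 \<open>nu\<close>, the reflection at the midpoint acts on the
  off-diagonal space as the reflection in the line through m.\<close>

lemma reflect_link_midpoint:
  assumes "link c f 0 m" "z \<in> offdiag c f"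
  shows "reflect ((1/2) *\<^sub>R (c + f + m)) z = (m \<bullet> z / nu) *\<^sub>R m - z"
proof -
  note l = linkD[OF assms(1)]
  define b where "b = m \<bullet> z / (2 * nu)"
  have "m \<in> offdiag c f" using assms(1) link_offdiag_iff by blast
  then have mz: "m \<diamondop> z = b *\<^sub>R (c + f)" using offdiag_mult[OF l(1,2) _ _ assms(2)] l(4) by (simp add: b_def)
  define p where "p = (1/2) *\<^sub>R (c + f + m)"
  have pz: "p \<diamondop> z = (1/2) *\<^sub>R (z + b *\<^sub>R (c + f))"
    using assms(2) by (simp add: p_def jp_simps mz offdiag_mem)
      (rule vector_inner_eqI, simp add: inner_simps)
  have pc: "p \<diamondop> (c + f) = (1/2) *\<^sub>R (c + f + m)"
    by (rule vector_inner_eqI) (simp add: p_def jp_simps l(4-12) inner_simps add_divide_distrib)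
  have "p \<diamondop> (p \<diamondop> z) = (1/2) *\<^sub>R ((1/2) *\<^sub>R (z + b *\<^sub>R (c + f)) + b *\<^sub>R ((1/2) *\<^sub>R (c + f + m)))"
    unfolding pz jp.scaleR_right jp.add_right[of p z] pc ..
  then have "reflect p z = (2 * b) *\<^sub>R m - z"
    unfolding reflect_def pz by - (rule vector_inner_eqI, simp add: inner_simps algebra_simps)
  then show ?thesis by (simp add: p_def b_def)
qed

text \<open>Reflecting in the line of z and then in the bisector of z and w carries z to w. Each
  factor exchanges c and f, so the product fixes both. Along the segment from z to the midpoint of z
  and w the direction m is defined, as the segment meets 0 only if w = - z.\<close>

lemma KL_stab_rotate:
  assumes z: "link c f 0 z" and w: "link c f 0 w" and ne: "w \<noteq> - z"
  obtains k where "k \<in> KL_stab (\<diamondop>) e c" "k f = f" "k z = w"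
proof -
  note l = linkD[OF z]
  have cf: "c \<diamondop> f = 0" using l by simp
  have zz: "z \<in> offdiag c f" "z \<bullet> z = 2 * nu" and ww: "w \<in> offdiag c f" "w \<bullet> w = 2 * nu"
    using z w link_offdiag_iff by blast+
  define v where "v t = z + t *\<^sub>R (w - z)" for t :: real
  define m where "m t = (sqrt (2 * nu) / norm (v t)) *\<^sub>R v t" for t
  have v0: "v t \<noteq> 0" if "t \<in> {0..1/2}" for t
  proof
    assume "v t = 0"
    then have *: "(1 - t) *\<^sub>R z = - (t *\<^sub>R w)" by (simp add: v_def algebra_simps)
    then have "((1 - t) *\<^sub>R z) \<bullet> ((1 - t) *\<^sub>R z) = (t *\<^sub>R w) \<bullet> (t *\<^sub>R w)" by simp
    then have "(1 - t)\<^sup>2 = t\<^sup>2" using zz ww nu_pos by (simp add: power2_eq_square)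
    then have t: "t = 1/2" by (simp add: power2_eq_square algebra_simps)
    have "(1/2) *\<^sub>R z = (1/2) *\<^sub>R (- w)" using *[unfolded t] by simp
    then have "z = - w" by (metis scaleR_cancel_left divide_eq_0_iff zero_neq_numeral zero_neq_one)
    then show False using ne by simp
  qed
  have link: "link c f 0 (m t)" if "t \<in> {0..1/2}" for t
  proof -
    have "m t \<in> offdiag c f"
      unfolding m_def v_def using zz ww subspace_offdiag[of c f] by (simp add: subspace_add subspace_diff subspace_scale)
    moreover have "m t \<bullet> m t = 2 * nu"
      using v0[OF that] nu_pos by (simp add: m_def dot_square_norm power2_eq_square)
    ultimately show ?thesis using l cf link_offdiag_iff by blast
  qed
  define p where "p t = (1/2) *\<^sub>R (c + f + m t)" for t
  have pp: "prim (p t)" if "t \<in> {0..1/2}" for t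
    using prim_mix[OF link[OF that], of 1 1] by (simp add: p_def mix_def)
  let ?S = "p ` {0..1/2}"
  have "continuous_on {0..1/2} p"
    unfolding p_def m_def using v0 unfolding v_def by (intro continuous_intros) auto
  then have "connected ?S" by (intro connected_continuous_image) auto
  moreover have "?S \<subseteq> Collect prim" using pp by auto
  moreover have "p (1/2) \<in> ?S" "p 0 \<in> ?S" by auto
  ultimately have K: "reflect2 1 (p (1/2)) (p 0) \<in> KL (\<diamondop>) e" by (rule reflect2_KL)
  have swap: "reflect (p t) c = f" "reflect (p t) f = c" if "t \<in> {0..1/2}" for t
  proof -
    show 1: "reflect (p t) c = f" using reflect_midpoint[OF link[OF that]] by (simp add: p_def)
    show "reflect (p t) f = c" using reflect_prim_reflect[OF pp[OF that], of c] 1 by simp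
  qed
  have m0: "m 0 = z"
    using zz nu_pos by (simp add: m_def v_def norm_eq_sqrt_inner)
  have r0: "reflect (p 0) z = z"
  proof -
    have "reflect (p 0) z = 2 *\<^sub>R z - z"
      using reflect_link_midpoint[OF link zz(1), of 0] nu_pos by (simp add: p_def m0 zz)
    then show ?thesis by (simp add: scaleR_2)
  qed
  have r1: "reflect (p (1/2)) z = w"
  proof -
    define s where "s = z \<bullet> w"
    define x where "x = v (1/2)"
    have x: "x = (1/2) *\<^sub>R (z + w)" unfolding x_def v_def
      by (rule vector_inner_eqI) (simp add: inner_simps diff_divide_distrib)
    have xx: "x \<bullet> x = (2 * nu + s) / 2" "x \<bullet> z = (2 * nu + s) / 2"
      unfolding x using zz ww by (simp_all add: inner_simps inner_commute[of w z] s_def add_divide_distrib)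
    have "x \<noteq> 0" using v0[of "1/2"] by (simp add: x_def)
    then have pos: "2 * nu + s > 0" using xx(1) by (metis inner_gt_zero_iff zero_less_divide_iff zero_less_numeral not_numeral_less_zero)
    define A where "A = sqrt (2 * nu) / norm x"
    have mA: "m (1/2) = A *\<^sub>R x" by (simp add: m_def A_def x_def)
    have AA: "A * A = 2 * nu / (x \<bullet> x)"
      using nu_pos by (simp add: A_def dot_square_norm power2_eq_square)
    have "(m (1/2) \<bullet> z / nu) *\<^sub>R m (1/2) = (A * A * (x \<bullet> z) / nu) *\<^sub>R x"
      by (simp add: mA mult_ac)
    also have "A * A * (x \<bullet> z) / nu = 2"
      unfolding AA xx using pos nu_pos by simp
    finally have "reflect (p (1/2)) z = 2 *\<^sub>R x - z"
      using reflect_link_midpoint[OF link zz(1), of "1/2"] by (simp add: p_def)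
    then show ?thesis by (simp add: x)
  qed
  show ?thesis
  proof (rule that[of "reflect2 1 (p (1/2)) (p 0)"])
    show "reflect2 1 (p (1/2)) (p 0) \<in> KL_stab (\<diamondop>) e c"
      using K swap[of 0] swap[of "1/2"] by (simp add: KL_stab_def)
    show "reflect2 1 (p (1/2)) (p 0) f = f" using swap[of 0] swap[of "1/2"] by simp
    show "reflect2 1 (p (1/2)) (p 0) z = w" by (simp add: r0 r1)
  qed
qed

lemma link_neg: "link c f 0 z \<Longrightarrow> link c f 0 (- z)"
  by (simp add: link_offdiag_iff subspace_neg[OF subspace_offdiag])

text \<open>This is where \<open>r > 2\<close> or \<open>d > 1\<close> is needed: for the symmetric \<open>2 \<times> 2\<close> matrices the stabilizer
  acts trivially on the one-dimensional off-diagonal space.\<close>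

lemma link_orbit_neg:
  assumes l: "link c f 0 z" and rd: "jrank (\<diamondop>) e > 1" "jrank (\<diamondop>) e > 2 \<or> offdiag_peirce_dim (\<diamondop>) e > 1"
    and inv: "\<And>k f' z'. k \<in> KL_stab (\<diamondop>) e c \<Longrightarrow> link c f' 0 z' \<Longrightarrow> G (k f') (k z') = G f' z'"
  shows "G f (- z) = G f z"
proof (cases "jrank (\<diamondop>) e > 2")
  case True
  note L = linkD[OF l]
  have cf: "c \<diamondop> f = 0" "f \<diamondop> c = 0" "c \<noteq> f" using L prim_nz[OF L(1)] by auto
  have cfo: "orth_prims {c, f}" using L cf by (auto simp: orth_prims_def)
  have "c + f \<noteq> e"
  proof
    assume "c + f = e"
    then have "card {c, f} = jrank (\<diamondop>) e" using card_frame[OF cfo] cf(3) by simp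
    then show False using True cf(3) by simp
  qed
  \<comment> \<open>A third primitive idempotent gives the sign change: the reflection at f negates
    z and the one at h fixes it, while c and f are fixed by both. An arc from f to h connects the
    product to the identity.\<close>
  then obtain h where h: "prim h" "c \<diamondop> h = 0" "f \<diamondop> h = 0"
  proof -
    have "\<Sum>{c, f} = c + f" using cf(3) by simp
    then obtain h where "prim h" "\<And>a. a \<in> {c, f} \<Longrightarrow> a \<diamondop> h = 0"
      using extend_orth_prims[OF cfo] \<open>c + f \<noteq> e\<close> by metis
    then show ?thesis using that[of h] by simp
  qed
  obtain z' where lz: "link f h 0 z'" using ex_link_orthogonal[OF L(2) h(1,3)] .
  define \<gamma> where "\<gamma> t = (1 / ((1-t)\<^sup>2 + t\<^sup>2)) *\<^sub>R mix f h z' (1-t) t" for t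
  have pos: "(1-t)\<^sup>2 + t\<^sup>2 > 0" for t :: real
    by (simp add: sum_power2_gt_zero_iff)
  have prim: "prim (\<gamma> t)" for t
    using prim_mix[OF lz, of "1 - t" t] pos[of t] by (simp add: \<gamma>_def)
  have "continuous_on {0..1} \<gamma>"
    unfolding \<gamma>_def mix_def using pos by (intro continuous_intros) (simp add: less_imp_neq)
  then have "connected (\<gamma> ` {0..1})" by (intro connected_continuous_image) auto
  moreover have "\<gamma> ` {0..1} \<subseteq> Collect prim" using prim by auto
  moreover have "h = \<gamma> 1" "f = \<gamma> 0" by (simp_all add: \<gamma>_def mix_def)
  then have "h \<in> \<gamma> ` {0..1}" "f \<in> \<gamma> ` {0..1}" by (metis atLeastAtMost_iff image_eqI order_refl zero_le_one)+
  ultimately have K: "reflect2 1 h f \<in> KL (\<diamondop>) e" by (rule reflect2_KL)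
  have hc: "h \<diamondop> c = 0" "h \<diamondop> f = 0" using h commute[of h c] commute[of h f] by simp_all
  have hz: "h \<diamondop> z = 0" by (rule link_annihilated[OF l prim_idem[OF h(1)] hc])
  have "reflect2 1 h f \<in> KL_stab (\<diamondop>) e c"
    using K by (simp add: KL_stab_def reflect_annihilated cf hc)
  moreover have "reflect2 1 h f f = f" by (simp add: reflect_prim_self[OF L(2)] reflect_annihilated hc)
  moreover have "reflect f z = - z" using L by (intro reflect_half) (simp add: mem_peirce)
  then have "reflect2 1 h f z = - z" by (simp add: reflect_annihilated hz jp_simps)
  ultimately show ?thesis using inv[OF _ l, of "reflect2 1 h f"] by simp
next
  case False
  note L = linkD[OF l]
  have zV: "z \<in> offdiag c f" "z \<bullet> z = 2 * nu" "c \<diamondop> f = 0" using l link_offdiag_iff by blast+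
  have d: "dim (offdiag c f) > 1"
    using offdiag_peirce_dim_eq[OF rd(1) L(1,2) zV(3)] False rd(2) by simp
  \<comment> \<open>In rank two a second direction is needed: the antipode is reached by two
    rotations, from z to w and from w to - z.\<close>
  have "\<not> offdiag c f \<subseteq> span {z}"
  proof
    assume "offdiag c f \<subseteq> span {z}"
    then have "dim (offdiag c f) \<le> card {z}" by (intro dim_le_card) auto
    then show False using d by simp
  qed
  then obtain y where y: "y \<in> offdiag c f" "y \<notin> span {z}" by blast
  have y0: "y \<noteq> 0" using y(2) span_zero by auto
  define w where "w = (sqrt (2 * nu) / norm y) *\<^sub>R y"
  have "w \<bullet> w = 2 * nu" using y0 nu_pos by (simp add: w_def dot_square_norm power2_eq_square)
  moreover have "w \<in> offdiag c f" using y subspace_offdiag subspace_scale unfolding w_def by blast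
  ultimately have lw: "link c f 0 w" using L zV link_offdiag_iff by blast
  have w: "w \<notin> span {z}"
  proof
    assume "w \<in> span {z}"
    then have "(norm y / sqrt (2 * nu)) *\<^sub>R w \<in> span {z}" by (rule span_scale)
    then show False using y y0 nu_pos by (simp add: w_def)
  qed
  then have ne: "w \<noteq> - z" "- z \<noteq> - w"
    using span_base[of z "{z}"] span_neg[of z "{z}"] by auto
  obtain k where k: "k \<in> KL_stab (\<diamondop>) e c" "k f = f" "k z = w" using KL_stab_rotate[OF l lw ne(1)] .
  obtain k' where k': "k' \<in> KL_stab (\<diamondop>) e c" "k' f = f" "k' w = - z"
    using KL_stab_rotate[OF lw link_neg[OF l] ne(2)] .
  show ?thesis using inv[OF k(1) l] inv[OF k'(1) lw] k k' by simp
qed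

text \<open>G stands for any function of the pair invariant under the stabilizer; \<open>f\<close>
  and then z are matched by group elements, with the antipodal case treated separately.\<close>

lemma link_orbit:
  assumes l: "link c f 0 z" and l': "link c f' 0 z'"
    and rd: "jrank (\<diamondop>) e > 1" "jrank (\<diamondop>) e > 2 \<or> offdiag_peirce_dim (\<diamondop>) e > 1"
    and inv: "\<And>k f' z'. k \<in> KL_stab (\<diamondop>) e c \<Longrightarrow> link c f' 0 z' \<Longrightarrow> G (k f') (k z') = G f' z'"
  shows "G f' z' = G f z"
proof -
  obtain k where k: "k \<in> KL_stab (\<diamondop>) e c" "k f' = f"
    using KL_stab_frame[of c f' f] linkD[OF l] linkD[OF l'] by auto
  have lk: "link c f 0 (k z')" using KL_stab_link[OF k(1) l'] k(2) by simp
  have "G f' z' = G f (k z')" using inv[OF k(1) l'] k(2) by simp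
  also have "\<dots> = G f z"
  proof (cases "k z' = - z")
    case True
    then show ?thesis using link_orbit_neg[where G = G, OF l rd inv] by simp
  next
    case False
    then obtain k' where k': "k' \<in> KL_stab (\<diamondop>) e c" "k' f = f" "k' z = k z'"
      using KL_stab_rotate[OF l lk] by blast
    then show ?thesis using inv[OF k'(1) l] by simp
  qed
  finally show ?thesis .
qed

end

subsection \<open>Directional derivatives of polynomial functions\<close>

lemma partialI: "(f has_derivative f') (at x) \<Longrightarrow> partial v f x = f' v"
  using frechet_derivative_at[of f f' x] by (simp add: partial_def)

lemma has_derivative_partial:
  "real_polynomial_function f \<Longrightarrow> (f has_derivative (\<lambda>v. partial v f x)) (at x)"
  using differentiable_at_real_polynomial_function[of f x UNIV]
  by (simp add: partial_def frechet_derivative_works)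

lemma linear_partial: "real_polynomial_function f \<Longrightarrow> linear (\<lambda>v. partial v f x)"
  using has_derivative_linear[OF has_derivative_partial] .

lemma partial_const: "partial v (\<lambda>x. a) x = 0"
  by (rule partialI) (rule has_derivative_const)

lemma partial_bounded_linear: "bounded_linear f \<Longrightarrow> partial v f x = f v"
  by (rule partialI) (rule bounded_linear_imp_has_derivative)

lemma partial_add:
  assumes "real_polynomial_function f" "real_polynomial_function g"
  shows "partial v (\<lambda>x. f x + g x) x = partial v f x + partial v g x"
  by (rule partialI) (intro has_derivative_add has_derivative_partial assms)

lemma partial_mult:
  assumes "real_polynomial_function f" "real_polynomial_function g"
  shows "partial v (\<lambda>x. f x * g x) x = f x * partial v g x + partial v f x * g x"
  by (rule partialI) (intro has_derivative_mult has_derivative_partial assms)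

lemma partial_cmult:
  assumes "real_polynomial_function f"
  shows "partial v (\<lambda>x. a * f x) x = a * partial v f x"
  using partial_mult[OF real_polynomial_function.intros(2) assms, of v a x] by (simp add: partial_const)

lemma real_polynomial_function_partial:
  fixes f :: "'a::euclidean_space \<Rightarrow> real"
  shows "real_polynomial_function f \<Longrightarrow> real_polynomial_function (partial v f)"
proof (induction f rule: real_polynomial_function.induct)
  case (linear f)
  then have "partial v f = (\<lambda>x. f v)" by (auto simp: partial_bounded_linear)
  then show ?case by auto
next
  case (const c)
  have "partial v (\<lambda>x::'a. c) = (\<lambda>x. 0)" by (auto simp: partial_const)
  then show ?case by auto
next
  case (add f g)
  then have "partial v (\<lambda>x. f x + g x) = (\<lambda>x. partial v f x + partial v g x)"
    by (auto simp: partial_add)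
  then show ?case using add by auto
next
  case (mult f g)
  then have "partial v (\<lambda>x. f x * g x) = (\<lambda>x. f x * partial v g x + partial v f x * g x)"
    by (auto simp: partial_mult)
  then show ?case using mult by auto
qed

lemma linear_partial2_left:
  fixes f :: "'a::euclidean_space \<Rightarrow> real"
  shows "real_polynomial_function f \<Longrightarrow> linear (\<lambda>a. partial a (partial b f) x)"
  by (intro linear_partial real_polynomial_function_partial)

lemma linear_partial2_right:
  fixes f :: "'a::euclidean_space \<Rightarrow> real"
  assumes f: "real_polynomial_function f"
  shows "linear (\<lambda>b. partial a (partial b f) x)"
proof (rule linearI)
  fix b c
  have "partial (b + c) f = (\<lambda>x. partial b f x + partial c f x)"
    using linear_add[OF linear_partial[OF f]] by auto
  then show "partial a (partial (b + c) f) x = partial a (partial b f) x + partial a (partial c f) x"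
    using partial_add[OF real_polynomial_function_partial[OF f] real_polynomial_function_partial[OF f]] by simp
next
  fix r b
  have "partial (r *\<^sub>R b) f = (\<lambda>x. r * partial b f x)"
    using linear_scale[OF linear_partial[OF f]] by auto
  then show "partial a (partial (r *\<^sub>R b) f) x = r *\<^sub>R partial a (partial b f) x"
    using partial_cmult[OF real_polynomial_function_partial[OF f]] by simp
qed

text \<open>This is the second derivative at s = 0 of a function that is constantly zero.\<close>

lemma partial_along_parabola:
  fixes f :: "'a::euclidean_space \<Rightarrow> real"
  assumes f: "real_polynomial_function f" and z: "\<And>s. f (c + s *\<^sub>R u + s\<^sup>2 *\<^sub>R w) = 0"
  shows "partial u (partial u f) c + 2 * partial w f c = 0"
proof -
  define \<gamma> where "\<gamma> s = c + s *\<^sub>R u + s\<^sup>2 *\<^sub>R w" for s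
  have \<gamma>: "(\<gamma> has_vector_derivative u + (2 * s) *\<^sub>R w) (at s)" for s
    unfolding \<gamma>_def by (auto intro!: derivative_eq_intros)
  have chain: "((\<lambda>s. g (\<gamma> s)) has_vector_derivative partial (u + (2 * s) *\<^sub>R w) g (\<gamma> s)) (at s)"
    if "real_polynomial_function g" for g s
    using vector_derivative_diff_chain_within[OF \<gamma>[of s], of g "\<lambda>v. partial v g (\<gamma> s)"]
      has_derivative_at_withinI[OF has_derivative_partial[OF that]] by (simp add: o_def)
  have "partial (u + (2 * s) *\<^sub>R w) f (\<gamma> s) = 0" for s
  proof -
    have "(\<lambda>s. f (\<gamma> s)) = (\<lambda>s. 0)" using z by (simp add: \<gamma>_def)
    then show ?thesis
      using chain[OF f, of s] vector_derivative_unique_at[OF _ has_vector_derivative_const] by metis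
  qed
  then have "(\<lambda>s. partial u f (\<gamma> s) + 2 * s * partial w f (\<gamma> s)) = (\<lambda>s. 0)"
    by (simp add: linear_add[OF linear_partial[OF f]] linear_scale[OF linear_partial[OF f]])
  moreover have "((\<lambda>s. partial u f (\<gamma> s) + 2 * s * partial w f (\<gamma> s)) has_vector_derivative
      partial (u + (2 * 0) *\<^sub>R w) (partial u f) (\<gamma> 0) +
      (2 * 0 * partial (u + (2 * 0) *\<^sub>R w) (partial w f) (\<gamma> 0) + 2 * partial w f (\<gamma> 0))) (at 0)"
    using chain[OF real_polynomial_function_partial[OF f, of u], of 0]
      chain[OF real_polynomial_function_partial[OF f, of w], of 0]
    by (intro has_vector_derivative_add has_vector_derivative_mult) (auto intro!: derivative_eq_intros)
  ultimately have "((\<lambda>s. 0) has_vector_derivative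
      partial u (partial u f) (\<gamma> 0) + 2 * partial w f (\<gamma> 0)) (at (0::real))"
    by simp
  then have "partial u (partial u f) (\<gamma> 0) + 2 * partial w f (\<gamma> 0) = 0"
    by (metis vector_derivative_unique_at has_vector_derivative_const)
  then show ?thesis by (simp add: \<gamma>_def)
qed

context simple_euclidean_jordan_algebra
begin

subsection \<open>Orthonormal bases for the trace form\<close>

lemma tf_bilinear:
  "tf (x + y) w = tf x w + tf y w" "tf w (x + y) = tf w x + tf w y"
  "tf (a *\<^sub>R x) w = a * tf x w" "tf w (a *\<^sub>R x) = a * tf w x"
  by (simp_all add: tf_eq inner_simps add_divide_distrib)

lemma tf_commute: "tf x y = tf y x"
  by (simp add: tf_eq inner_commute)

lemma tf_assoc: "tf (x \<diamondop> y) w = tf y (x \<diamondop> w)"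
  by (simp add: tf_eq inner_assoc)

lemma linear_tf: "linear (\<lambda>x. tf x y)" "linear (tf y)"
  by (auto intro!: linearI simp: tf_bilinear)

lemma bounded_linear_tf: "bounded_linear (\<lambda>x. tf x y)"
  using linear_tf(1) by (simp add: linear_conv_bounded_linear)

lemma tf_prim: "prim p \<Longrightarrow> tf p p = 1" "prim p \<Longrightarrow> tf p e = 1"
  using prim_nu nu_pos inner_e[OF prim_idem] by (auto simp: tf_eq)

lemma tf_e: "tf e e = real (jrank (\<diamondop>) e)"
  using rank_nu nu_pos by (simp add: tf_eq)

abbreviation "tonb \<equiv> trace_orthonormal_basis (\<diamondop>) e"

lemma tonb_finite:
  assumes "tonb E" shows "finite E"
proof -
  have "pairwise orthogonal E"
    using assms nu_pos unfolding trace_orthonormal_basis_def pairwise_def orthogonal_def tf_eq by fastforce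
  moreover have "0 \<notin> E"
    using assms unfolding trace_orthonormal_basis_def tf_eq by fastforce
  ultimately show ?thesis
    using pairwise_orthogonal_independent independent_imp_finite by blast
qed

lemma tonb_expand:
  assumes "tonb E" shows "(\<Sum>a\<in>E. tf a x *\<^sub>R a) = x"
proof -
  have "x \<in> span E" using assms by (simp add: trace_orthonormal_basis_def)
  then show ?thesis
  proof (induction rule: span_induct)
    case base
    show ?case
      by (auto simp: subspace_def tf_bilinear scaleR_add_left sum.distrib scaleR_sum_right[symmetric]
          scaleR_scaleR[symmetric] linear_0[OF linear_tf(2)] simp del: scaleR_scaleR)
  next
    case (step b)
    have "(\<Sum>a\<in>E. tf a b *\<^sub>R a) = (\<Sum>a\<in>E. if a = b then a else 0)"
      using assms step by (intro sum.cong) (auto simp: trace_orthonormal_basis_def)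
    then show ?case using step tonb_finite[OF assms] by simp
  qed
qed

lemma tonb_parseval:
  assumes "tonb E" shows "(\<Sum>a\<in>E. tf a x * tf a y) = tf x y"
proof -
  have "tf x y = tf (\<Sum>a\<in>E. tf a x *\<^sub>R a) y" by (simp add: tonb_expand[OF assms])
  also have "\<dots> = (\<Sum>a\<in>E. tf a x * tf a y)"
    by (simp add: linear_sum[OF linear_tf(1)] tf_bilinear)
  finally show ?thesis by simp
qed

lemma linear_tonb_sum:
  assumes "tonb E" "linear g" shows "(\<Sum>a\<in>E. tf a x * g a) = (g x :: real)"
proof -
  have "g x = g (\<Sum>a\<in>E. tf a x *\<^sub>R a)" by (simp add: tonb_expand[OF assms(1)])
  then show ?thesis by (simp add: linear_sum[OF assms(2)] linear_scale[OF assms(2)])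
qed

text \<open>The sum is the trace of a bilinear form composed with L(x). The given basis can thus be
  replaced by one adapted to a point of the orbit.\<close>

lemma tonb_trace_unique:
  assumes "tonb E" "tonb F" and H: "\<And>b. linear (\<lambda>a. H a b)" "\<And>a. linear (H a)"
  shows "(\<Sum>a\<in>E. H a (x \<diamondop> a)) = (\<Sum>h\<in>F. (H h (x \<diamondop> h) :: real))"
proof -
  have lin: "linear (\<lambda>y. H a (x \<diamondop> y))" for a
    by (rule linearI) (simp_all add: jp_simps linear_add[OF H(2)] linear_scale[OF H(2)])
  have "(\<Sum>a\<in>E. H a (x \<diamondop> a)) = (\<Sum>a\<in>E. \<Sum>h\<in>F. tf h a * H a (x \<diamondop> h))"
    by (simp add: linear_tonb_sum[OF assms(2) lin])
  also have "\<dots> = (\<Sum>h\<in>F. \<Sum>a\<in>E. tf a h * H a (x \<diamondop> h))"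
    by (subst sum.swap) (simp add: tf_commute)
  also have "\<dots> = (\<Sum>h\<in>F. H h (x \<diamondop> h))"
    by (simp add: linear_tonb_sum[OF assms(1) H(1)])
  finally show ?thesis .
qed

lemma ex_subspace_tonb:
  assumes "subspace S"
  obtains U where "U \<subseteq> S" "span U = S" "finite U" "card U = dim S"
    "\<And>a b. a \<in> U \<Longrightarrow> b \<in> U \<Longrightarrow> tf a b = (if a = b then 1 else 0)"
proof -
  obtain B where B: "B \<subseteq> S" "pairwise orthogonal B" "\<And>x. x \<in> B \<Longrightarrow> norm x = 1"
    "independent B" "card B = dim S" "span B = S"
    using orthonormal_basis_subspace[OF assms] by blast
  have fin: "finite B" using B(4) independent_imp_finite by blast
  \<comment> \<open>The trace form is the inner product divided by \<open>nu\<close>, so unit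
    vectors are stretched by \<open>sqrt nu\<close>.\<close>
  define f where "f x = sqrt nu *\<^sub>R x" for x :: 'a
  have s: "sqrt nu \<noteq> 0" using nu_pos by simp
  have inj: "inj_on f B" using s by (auto simp: inj_on_def f_def)
  show ?thesis
  proof (rule that[of "f ` B"])
    show "f ` B \<subseteq> S" using B(1) assms by (auto simp: f_def subspace_scale)
    have "b \<in> span (f ` B)" if "b \<in> B" for b
    proof -
      have "(1 / sqrt nu) *\<^sub>R f b \<in> span (f ` B)" using that by (intro span_scale span_base) auto
      then show ?thesis using s by (simp add: f_def)
    qed
    then have "span B \<subseteq> span (f ` B)" by (intro span_minimal) auto
    moreover have "span (f ` B) \<subseteq> S" using \<open>f ` B \<subseteq> S\<close> assms by (rule span_minimal)
    ultimately show "span (f ` B) = S" using B(6) by blast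
    show "finite (f ` B)" using fin by simp
    show "card (f ` B) = dim S" using card_image[OF inj] B(5) by simp
    fix a b assume "a \<in> f ` B" "b \<in> f ` B"
    then obtain x y where xy: "a = f x" "b = f y" "x \<in> B" "y \<in> B" by blast
    have "x \<bullet> y = (if x = y then 1 else 0)"
      using B(2,3) xy by (auto simp: pairwise_def orthogonal_def norm_eq_1)
    moreover have "a = b \<longleftrightarrow> x = y" using s by (simp add: xy f_def)
    ultimately show "tf a b = (if a = b then 1 else 0)"
      using nu_pos by (simp add: xy f_def tf_eq)
  qed
qed

subsection \<open>The Bessel operator\<close>

definition bessel_tr :: "'a set \<Rightarrow> real \<Rightarrow> ('a \<Rightarrow> real) \<Rightarrow> 'a \<Rightarrow> real" where
  "bessel_tr E lam f x = tf e (bessel (\<diamondop>) E lam f x)"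

text \<open>By associativity of the form each of the three terms of P gives the same number, with
  signs 1, 1, -1.\<close>

lemma tf_P2: "tf e (P2 (\<diamondop>) a b x) = tf b (x \<diamondop> a)"
proof -
  have "e \<bullet> (y \<diamondop> w) = y \<bullet> w" for y w
    using inner_assoc[of y w e] by (simp add: unit_right inner_commute)
  moreover have "a \<bullet> (b \<diamondop> x) = b \<bullet> (x \<diamondop> a)" "b \<bullet> (a \<diamondop> x) = b \<bullet> (x \<diamondop> a)" "(a \<diamondop> b) \<bullet> x = b \<bullet> (x \<diamondop> a)"
    using inner_assoc[of x b a] inner_assoc[of a b x]
    by (simp_all add: commute[of b x] commute[of a x] inner_commute)
  ultimately show ?thesis by (simp add: P2_def tf_eq inner_simps)
qed

lemma bessel_tr_eq:
  assumes E: "tonb E" and f: "real_polynomial_function f"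
  shows "bessel_tr E lam f x = (\<Sum>a\<in>E. partial a (partial (x \<diamondop> a) f) x) + lam * partial e f x"
proof -
  have "bessel_tr E lam f x = (\<Sum>a\<in>E. \<Sum>b\<in>E. tf b (x \<diamondop> a) * partial a (partial b f) x)
      + lam * (\<Sum>a\<in>E. tf e a * partial a f x)"
    by (simp add: bessel_tr_def bessel_def linear_add[OF linear_tf(2)] linear_sum[OF linear_tf(2)]
        linear_scale[OF linear_tf(2)] tf_P2 mult.commute)
  also have "(\<Sum>a\<in>E. tf e a * partial a f x) = (\<Sum>a\<in>E. tf a e * partial a f x)"
    by (simp add: tf_commute[of e])
  finally show ?thesis
    by (simp add: linear_tonb_sum[OF E linear_partial2_right[OF f]] linear_tonb_sum[OF E linear_partial[OF f]])
qed

text \<open>In the matrix model the parabola consists of multiples of the rank-one matrices of v + s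
  w; 1 + s^2 is the squared length.\<close>

lemma Xi_mix:
  assumes "prim c" "link p j 0 z" "t > 0"
  shows "t *\<^sub>R (p + s *\<^sub>R z + s\<^sup>2 *\<^sub>R j) \<in> Xi (\<diamondop>) e c"
proof -
  have pos: "1 + s\<^sup>2 > 0" by (simp add: add_pos_nonneg)
  have "prim ((1 / (1 + s\<^sup>2)) *\<^sub>R mix p j z 1 s)"
    using prim_mix[OF assms(2), of 1 s] pos by simp
  moreover have "t *\<^sub>R (p + s *\<^sub>R z + s\<^sup>2 *\<^sub>R j) = (t * (1 + s\<^sup>2)) *\<^sub>R ((1 / (1 + s\<^sup>2)) *\<^sub>R mix p j z 1 s)"
    using pos by (simp add: mix_def add_ac)
  moreover have "t * (1 + s\<^sup>2) > 0" using pos assms(3) by simp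
  ultimately show ?thesis unfolding Xi_eq[OF assms(1)] by blast
qed

text \<open>At a multiple x of p, every member of this basis is an eigenvector of L(x), so the trace
  in the operator only involves second derivatives \<open>H h h\<close>; the block \<open>U0\<close>
  drops out.\<close>

lemma adapted_tonb:
  assumes "jrank (\<diamondop>) e > 1" "orth_prims C" "\<Sum>C = e" "p \<in> C"
  obtains U U0 where "tonb (insert p (U0 \<union> (\<Union>j\<in>C - {p}. U j)))"
    "\<And>G. (\<Sum>h\<in>insert p (U0 \<union> (\<Union>j\<in>C - {p}. U j)). G h) =
      (G p + (\<Sum>h\<in>U0. G h) + (\<Sum>j\<in>C-{p}. \<Sum>h\<in>U j. G h) :: real)"
    "U0 \<subseteq> peirce p 0" "\<And>j. j \<in> C - {p} \<Longrightarrow> U j \<subseteq> offdiag p j"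
    "\<And>j. j \<in> C - {p} \<Longrightarrow> card (U j) = offdiag_peirce_dim (\<diamondop>) e"
    "\<And>j h. j \<in> C - {p} \<Longrightarrow> h \<in> U j \<Longrightarrow> tf h h = 1"
proof -
  note C = orth_primsD[OF assms(2)]
  have pp: "prim p" "p \<diamondop> p = p" using C assms(4) by blast+
  interpret J: jordan_idempotent "(\<diamondop>)" e p by (rule jordan_idempotentI[OF pp(2)])
  have jj: "prim j" "j \<diamondop> j = j" "p \<diamondop> j = 0" "j \<diamondop> p = 0" if "j \<in> C - {p}" for j
    using C assms(4) that by blast+
  obtain U0 where U0: "U0 \<subseteq> peirce p 0" "span U0 = peirce p 0" "finite U0"
    "\<And>a b. a \<in> U0 \<Longrightarrow> b \<in> U0 \<Longrightarrow> tf a b = (if a = b then 1 else 0)"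
    using ex_subspace_tonb[OF subspace_peirce] by metis
  have "\<exists>U. U \<subseteq> offdiag p j \<and> span U = offdiag p j \<and> finite U \<and> card U = dim (offdiag p j) \<and>
    (\<forall>a\<in>U. \<forall>b\<in>U. tf a b = (if a = b then 1 else 0))" for j
    using ex_subspace_tonb[OF subspace_offdiag[of p j]] by metis
  then obtain U where U: "\<And>j. U j \<subseteq> offdiag p j" "\<And>j. span (U j) = offdiag p j" "\<And>j. finite (U j)"
    "\<And>j. card (U j) = dim (offdiag p j)"
    "\<And>j a b. a \<in> U j \<Longrightarrow> b \<in> U j \<Longrightarrow> tf a b = (if a = b then 1 else 0)"
    by metis
  have Uh: "u \<in> peirce p (1/2)" if "u \<in> U j" for u j
    using that U(1)[of j] by (auto simp: offdiag_mem mem_peirce)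
  have p1: "p \<in> peirce p 1" using pp by (simp add: mem_peirce)
  have o_pU: "p \<bullet> u = 0" if "u \<in> U j" for u j
    using peirce_orthogonal[OF p1 Uh[OF that]] by simp
  have o_p0: "p \<bullet> u = 0" if "u \<in> U0" for u
    using peirce_orthogonal[OF p1, of u 0] that U0(1) by auto
  have o_0U: "u0 \<bullet> u = 0" if "u0 \<in> U0" "u \<in> U j" for u0 u j
    using peirce_orthogonal[of u0 p 0 u "1/2"] that U0(1) Uh by auto
  have o_UU: "u \<bullet> v = 0" if "u \<in> U i" "v \<in> U j" "i \<noteq> j" "i \<in> C - {p}" "j \<in> C - {p}" for u v i j
  proof -
    have ij: "i \<diamondop> j = 0" "j \<diamondop> i = 0" using that C by blast+
    \<comment> \<open>The element v lies under p + j, to which the idempotent i is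
      orthogonal.\<close>
    have "i \<diamondop> v = 0"
    proof (rule sub_idempotents_orthogonal[of i "p + j"])
      show "(p + j) \<diamondop> (p + j) = p + j" using pp jj[OF that(5)] by (simp add: jp_simps)
      show "i \<diamondop> (p + j) = 0" using ij jj[OF that(4)] by (simp add: jp_simps)
      show "(p + j) \<diamondop> v = v" using that(2) U(1)[of j]
        by (auto simp: jp_simps offdiag_mem scaleR_add_left[symmetric])
    qed (use jj[OF that(4)] in auto)
    then have "v \<in> peirce i 0" by (simp add: mem_peirce)
    moreover have "u \<in> peirce i (1/2)" using that(1) U(1)[of i] by (auto simp: offdiag_mem mem_peirce)
    ultimately show ?thesis using peirce_orthogonal by force
  qed
  have nz: "x \<bullet> x \<noteq> 0" if "tf x x = 1" for x using that by (auto simp: tf_eq)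
  have d1: "p \<notin> U0 \<union> (\<Union>j\<in>C - {p}. U j)"
    using o_pU[of p] o_p0[of p] prim_nz[OF pp(1)] by auto
  have d2: "U0 \<inter> (\<Union>j\<in>C - {p}. U j) = {}"
  proof -
    have False if "x \<in> U0" "x \<in> U j" for x j using o_0U[OF that] nz[of x] U0(4)[of x x] that by simp
    then show ?thesis by blast
  qed
  have d3: "U i \<inter> U j = {}" if "i \<in> C - {p}" "j \<in> C - {p}" "i \<noteq> j" for i j
  proof -
    have False if "x \<in> U i" "x \<in> U j" for x
      using o_UU[OF that \<open>i \<noteq> j\<close>] nz[of x] U(5)[of x i x] that \<open>i \<in> C - {p}\<close> \<open>j \<in> C - {p}\<close> by simp
    then show ?thesis by blast
  qed
  let ?V = "\<Union>j\<in>C - {p}. U j" and ?F = "insert p (U0 \<union> (\<Union>j\<in>C - {p}. U j))"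
  have fin: "finite ?V" using C(1) U(3) by auto
  have "x \<in> span ?F" for x
  proof -
    obtain x1 xh x0 where x: "x = x1 + xh + x0" "x1 \<in> peirce p 1" "xh \<in> peirce p (1/2)" "x0 \<in> peirce p 0"
      by (rule J.peirce_decomp)
    obtain \<mu> where "x1 = \<mu> *\<^sub>R p" using prim_peirce_1[OF pp(1)] x(2) by (auto simp: mem_peirce)
    moreover have "p \<in> span ?F" by (intro span_base) simp
    ultimately have 1: "x1 \<in> span ?F" by (simp add: span_scale)
    have "x0 \<in> span U0" using x(4) U0(2) by simp
    then have 0: "x0 \<in> span ?F" using span_mono[of U0 ?F] by auto
    have "j \<diamondop> xh \<in> span ?F" if "j \<in> C - {p}" for j
    proof -
      have "j \<diamondop> xh \<in> span (U j)"
        using mult_offdiag[OF pp(2) jj(2)[OF that] jj(3)[OF that] x(3)] U(2) by simp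
      then show ?thesis using span_mono[of "U j" ?F] that by auto
    qed
    then have "2 *\<^sub>R (\<Sum>j\<in>C - {p}. j \<diamondop> xh) \<in> span ?F" by (intro span_scale span_sum)
    \<comment> \<open>The unit is the sum of the frame, and p contributes half of \<open>xh\<close>;
      the remaining members contribute the other half.\<close>
    moreover have "xh = 2 *\<^sub>R (\<Sum>j\<in>C - {p}. j \<diamondop> xh)"
    proof -
      have "xh = \<Sum>C \<diamondop> xh" using assms(3) by (simp add: unit)
      also have "\<dots> = p \<diamondop> xh + (\<Sum>j\<in>C - {p}. j \<diamondop> xh)"
        using C(1) assms(4) by (simp add: jp.sum_left jp.add_left sum.remove)
      finally have "xh = (1/2) *\<^sub>R xh + (\<Sum>j\<in>C - {p}. j \<diamondop> xh)" using x(3) by (simp add: mem_peirce)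
      note half = this
      show ?thesis
      proof (rule vector_inner_eqI)
        fix w
        show "xh \<bullet> w = (2 *\<^sub>R (\<Sum>j\<in>C - {p}. j \<diamondop> xh)) \<bullet> w"
          using arg_cong[OF half, of "\<lambda>v. v \<bullet> w"] by (simp add: inner_simps)
      qed
    qed
    ultimately have "xh \<in> span ?F" by simp
    then show ?thesis using 0 1 x(1) by (simp add: span_add)
  qed
  then have span: "span ?F = UNIV" by blast
  have tf0: "tf a b = 0 \<longleftrightarrow> a \<bullet> b = 0" for a b using nu_pos by (simp add: tf_eq)
  have "tf a b = (if a = b then 1 else 0)" if "a \<in> ?F" "b \<in> ?F" for a b
  proof (cases "a = b")
    case True
    then show ?thesis using that tf_prim(1)[OF pp(1)] U0(4)[of a a] U(5)[of a _ a] by auto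
  next
    case False
    have "a \<bullet> b = 0"
      using that False
    proof (elim insertE UnE UN_E)
      assume "a = p" "b \<in> U0" then show ?thesis using o_p0 by simp
    next
      fix j assume "a = p" "b \<in> U j" then show ?thesis using o_pU by simp
    next
      assume "a \<in> U0" "b = p" then show ?thesis using o_p0 by (simp add: inner_commute)
    next
      assume "a \<in> U0" "b \<in> U0" then show ?thesis using U0(4)[of a b] False tf0[of a b] by simp
    next
      fix j assume "a \<in> U0" "b \<in> U j" then show ?thesis using o_0U by simp
    next
      fix j assume "a \<in> U j" "b = p" then show ?thesis using o_pU by (simp add: inner_commute)
    next
      fix j assume "a \<in> U j" "b \<in> U0" then show ?thesis using o_0U[of b a] by (simp add: inner_commute)
    next
      fix i j assume "i \<in> C - {p}" "a \<in> U i" "j \<in> C - {p}" "b \<in> U j"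
      then show ?thesis using o_UU[of a i b j] U(5)[of a i b] False tf0[of a b] by (cases "i = j") auto
    qed auto
    then show ?thesis using False tf0 by simp
  qed
  then have tonb: "tonb ?F" using span by (simp add: trace_orthonormal_basis_def)
  show ?thesis
  proof (rule that[OF tonb])
    fix G :: "'a \<Rightarrow> real"
    have "sum G ?F = G p + (sum G U0 + sum G ?V)"
      using d1 d2 fin U0(3) by (simp add: sum.union_disjoint)
    also have "sum G ?V = (\<Sum>j\<in>C - {p}. sum G (U j))"
      using C(1) U(3) d3 by (intro sum.UNION_disjoint) auto
    finally show "sum G ?F = G p + sum G U0 + (\<Sum>j\<in>C-{p}. sum G (U j))" by simp
    show "U0 \<subseteq> peirce p 0" by fact
    fix j assume j: "j \<in> C - {p}"
    show "U j \<subseteq> offdiag p j" by (rule U(1))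
    show "card (U j) = offdiag_peirce_dim (\<diamondop>) e"
      using U(4) offdiag_peirce_dim_eq[OF assms(1) pp(1) jj(1)[OF j] jj(3)[OF j]] by simp
    fix h assume "h \<in> U j"
    then show "tf h h = 1" using U(5) by simp
  qed
qed

text \<open>A second derivative along \<open>u \<in> peirce p (1/2)\<close> is traded for a first derivative, since a
  parabola through \<open>p\<close> with direction \<open>u\<close> runs inside the orbit.\<close>

lemma bessel_tangential:
  assumes rk: "jrank (\<diamondop>) e > 1" and c: "prim c" and E: "tonb E"
    and f: "real_polynomial_function f" and z: "\<And>x. x \<in> Xi (\<diamondop>) e c \<Longrightarrow> f x = 0"
    and x: "x \<in> Xi (\<diamondop>) e c" and lam: "lam = real (offdiag_peirce_dim (\<diamondop>) e) / 2"
  shows "bessel_tr E lam f x = 0"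
proof -
  obtain t p where tp: "x = t *\<^sub>R p" "t > 0" "prim p" using x unfolding Xi_eq[OF c] by blast
  obtain C where C: "{p} \<subseteq> C" "orth_prims C" "\<Sum>C = e"
    using ex_frame_containing[of "{p}"] tp(3) by (auto simp: orth_prims_def)
  have pC: "p \<in> C" using C(1) by simp
  define H where "H a b = partial a (partial b f) x" for a b
  define D where "D v = partial v f x" for v
  have H: "linear (\<lambda>a. H a b)" "linear (H a)" for a b
    unfolding H_def using linear_partial2_left[OF f] linear_partial2_right[OF f] by auto
  have D: "linear D" unfolding D_def by (rule linear_partial[OF f])
  have ray: "s *\<^sub>R p \<in> Xi (\<diamondop>) e c" if "s > 0" for s
    using that tp(3) unfolding Xi_eq[OF c] by blast
  have Dp: "D p = 0"
  proof -
    \<comment> \<open>A parabola degenerated to a ray isolates the first derivative.\<close>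
    have "f (x + s *\<^sub>R 0 + s\<^sup>2 *\<^sub>R p) = 0" for s
      using z[OF ray[of "t + s\<^sup>2"]] tp(1,2) by (simp add: scaleR_add_left add_pos_nonneg)
    from partial_along_parabola[OF f this] show ?thesis
      using linear_0[OF H(1)] by (simp add: H_def[symmetric] D_def)
  qed
  have Hpp: "H p p = 0"
  proof -
    \<comment> \<open>This coefficient makes t + s + \<kappa> s^2 positive for all s, so the
      parabola stays in the orbit; its first-order contribution vanishes by
      \<open>Dp\<close>.\<close>
    define \<kappa> where "\<kappa> = 1 / t"
    have "f (x + s *\<^sub>R p + s\<^sup>2 *\<^sub>R (\<kappa> *\<^sub>R p)) = 0" for s
    proof -
      have "t\<^sup>2 + s * t + s\<^sup>2 = (t + s / 2)\<^sup>2 + 3 / 4 * s\<^sup>2" by (simp add: power2_eq_square field_simps)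
      also have "\<dots> > 0"
        using tp(2) by (cases "s = 0") (auto intro: add_nonneg_pos)
      finally have "t + s + s\<^sup>2 * \<kappa> > 0"
        using tp(2) by (simp add: \<kappa>_def field_simps power2_eq_square)
      from z[OF ray[OF this]] show ?thesis by (simp add: tp(1) scaleR_add_left)
    qed
    from partial_along_parabola[OF f this] show ?thesis
      using Dp by (simp add: H_def D_def[symmetric] linear_scale[OF D])
  qed
  show ?thesis
  proof (rule adapted_tonb[OF rk C(2,3) pC])
    fix U and U0 :: "'a set"
    assume F: "tonb (insert p (U0 \<union> (\<Union>j\<in>C - {p}. U j)))"
      and sum: "\<And>G. (\<Sum>h\<in>insert p (U0 \<union> (\<Union>j\<in>C - {p}. U j)). G h) =
        (G p + (\<Sum>h\<in>U0. G h) + (\<Sum>j\<in>C-{p}. \<Sum>h\<in>U j. G h) :: real)"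
      and U0: "U0 \<subseteq> peirce p 0" and U: "\<And>j. j \<in> C - {p} \<Longrightarrow> U j \<subseteq> offdiag p j"
      and cU: "\<And>j. j \<in> C - {p} \<Longrightarrow> card (U j) = offdiag_peirce_dim (\<diamondop>) e"
      and nU: "\<And>j h. j \<in> C - {p} \<Longrightarrow> h \<in> U j \<Longrightarrow> tf h h = 1"
    have Hu: "H h (x \<diamondop> h) = - (1/2) * D j" if j: "j \<in> C - {p}" and h: "h \<in> U j" for j h
    proof -
      have jp: "prim j" "p \<diamondop> j = 0" using orth_primsD[OF C(2)] j pC by blast+
      \<comment> \<open>A basis vector has squared norm \<open>nu\<close>, whereas
        \<open>link\<close> requires 2 \<open>nu\<close>.\<close>
      define w where "w = sqrt 2 *\<^sub>R h"
      have ho: "h \<in> offdiag p j" using U[OF j] h by blast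
      have "w \<in> offdiag p j" unfolding w_def using ho subspace_offdiag subspace_scale by blast
      moreover have "w \<bullet> w = 2 * nu" using nU[OF j h] nu_pos by (simp add: w_def tf_eq)
      ultimately have l: "link p j 0 w" using tp(3) jp link_offdiag_iff by blast
      have "f (x + s *\<^sub>R (t *\<^sub>R w) + s\<^sup>2 *\<^sub>R (t *\<^sub>R j)) = 0" for s
        using z[OF Xi_mix[OF c l tp(2), of s]] by (simp add: tp(1) scaleR_add_right mult.commute)
      from partial_along_parabola[OF f this] have "H (t *\<^sub>R w) (t *\<^sub>R w) + 2 * D (t *\<^sub>R j) = 0"
        by (simp add: H_def D_def)
      then have "t * (t * (2 * H h h) + 2 * D j) = 0"
        by (simp add: w_def linear_scale[OF H(1)] linear_scale[OF H(2)] linear_scale[OF D] algebra_simps)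
      then have "t * H h h = - D j" using tp(2) by simp
      moreover have "H h (x \<diamondop> h) = (t / 2) * H h h"
        using ho by (simp add: tp(1) jp_simps offdiag_mem linear_scale[OF H(2)])
      ultimately show ?thesis by simp
    qed
    have H0: "H h (x \<diamondop> h) = 0" if "h \<in> U0" for h
      using that U0 by (auto simp: tp(1) jp_simps mem_peirce linear_0[OF H(2)])
    have "(\<Sum>a\<in>E. H a (x \<diamondop> a)) = H p (x \<diamondop> p) + (\<Sum>h\<in>U0. H h (x \<diamondop> h)) + (\<Sum>j\<in>C-{p}. \<Sum>h\<in>U j. H h (x \<diamondop> h))"
      unfolding tonb_trace_unique[of E _ H, OF E F H] by (rule sum)
    also have "H p (x \<diamondop> p) = 0"
      using Hpp prim_idem[OF tp(3)] by (simp add: tp(1) jp_simps linear_scale[OF H(2)])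
    also have "(\<Sum>h\<in>U0. H h (x \<diamondop> h)) = 0" using H0 by simp
    \<comment> \<open>Each of the d members of \<open>U j\<close> gives - D j / 2: this is where the
      value of \<open>lam\<close> is used.\<close>
    also have "(\<Sum>j\<in>C-{p}. \<Sum>h\<in>U j. H h (x \<diamondop> h)) = (\<Sum>j\<in>C-{p}. - lam * D j)"
      using Hu cU by (intro sum.cong) (simp_all add: lam)
    also have "\<dots> = - lam * D (\<Sum>j\<in>C-{p}. j)"
      by (simp add: linear_sum[OF D] sum_distrib_left)
    also have "(\<Sum>j\<in>C-{p}. j) = e - p"
      using C(3) pC orth_primsD(1)[OF C(2)] by (simp add: sum_diff1)
    also have "D (e - p) = D e" using Dp by (simp add: linear_diff[OF D])
    finally show ?thesis
      unfolding bessel_tr_eq[OF E f] H_def D_def by simp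
  qed
qed

end

section \<open>Univariate polynomials: degree bound and evenness\<close>

lemma real_polynomial_function_poly:
  fixes g :: "real \<Rightarrow> real"
  assumes "real_polynomial_function g"
  obtains P where "\<And>x. g x = poly P x"
proof -
  obtain a n where "g = (\<lambda>x. \<Sum>i\<le>n. a i * x ^ i)"
    using real_polynomial_function_imp_sum[OF assms] by blast
  then have "g x = poly (\<Sum>i\<le>n. monom (a i) i) x" for x
    by (simp add: poly_sum poly_monom)
  then show ?thesis using that by blast
qed

lemma poly_eq_if_eq_nonzero:
  fixes P Q :: "real poly"
  assumes "\<And>x. x \<noteq> 0 \<Longrightarrow> poly P x = poly Q x" shows "P = Q"
proof -
  have "poly ([:0, 1:] * P) x = poly ([:0, 1:] * Q) x" for x
    using assms by (cases "x = 0") auto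
  then have "poly ([:0, 1:] * P) = poly ([:0, 1:] * Q)" by (rule ext)
  then have "[:0, 1:] * P = [:0, 1:] * Q" by (simp only: poly_eq_poly_eq_iff)
  then show ?thesis by simp
qed

text \<open>This is how homogeneity of a polynomial in two variables bounds its degree in one of
  them. The proof clears the inverse by the reflected polynomial and compares degrees.\<close>

lemma degree_le_if_reversible:
  fixes P R :: "real poly"
  assumes "\<And>s. s \<noteq> 0 \<Longrightarrow> poly P s = s ^ n * poly R (inverse s)"
  shows "degree P \<le> n"
proof (cases "P = 0")
  case False
  have "monom 1 (degree R) * P = monom 1 n * reflect_poly R"
  proof (rule poly_eq_if_eq_nonzero)
    fix x :: real assume "x \<noteq> 0"
    then show "poly (monom 1 (degree R) * P) x = poly (monom 1 n * reflect_poly R) x"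
      using assms[of x] poly_reflect_poly_nz[of x R] by (simp add: poly_monom)
  qed
  moreover have "degree (monom 1 (degree R) * P) = degree R + degree P"
    using False by (simp add: degree_mult_eq degree_monom_eq)
  moreover have "degree (monom 1 n * reflect_poly R) \<le> n + degree R"
    using degree_mult_le[of "monom 1 n" "reflect_poly R"] degree_reflect_poly_le[of R]
      degree_monom_le[of "1::real" n] by linarith
  ultimately show ?thesis by simp
qed simp

lemma even_poly_in_square:
  fixes P :: "real poly"
  assumes even: "\<And>s. poly P (- s) = poly P s" and deg: "degree P \<le> 2 * m"
  obtains H where "degree H \<le> m" "\<And>s. poly P s = poly H (s\<^sup>2)"
proof -
  have "poly (pcompose P [:0, -1:]) = poly P" using even by (auto simp: poly_pcompose)
  then have "pcompose P [:0, -1:] = P" by (simp only: poly_eq_poly_eq_iff)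
  then have "(- 1) ^ i * coeff P i = coeff P i" for i
    using coeff_pcompose_linear[of P "-1" i] by simp
  then have odd: "coeff P i = 0" if "odd i" for i using that by (metis add.inverse_neutral mult_minus1
        uminus_power_if power_one neg_equal_zero mult_minus_left mult_1)
  define H where "H = (\<Sum>i\<le>m. monom (coeff P (2 * i)) i)"
  have split: "(\<Sum>i\<le>2 * n. coeff P i * s ^ i) = (\<Sum>i\<le>n. coeff P (2 * i) * (s\<^sup>2) ^ i)" for n s
  proof (induction n)
    case (Suc n)
    have "{..2 * Suc n} = insert (2 * n + 2) (insert (2 * n + 1) {..2 * n})" by auto
    then show ?case using Suc odd[of "2 * n + 1"] by (simp add: power_mult[symmetric] power_add)
  qed simp
  show ?thesis
  proof (rule that[of H])
    show "degree H \<le> m" unfolding H_def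
      by (intro degree_sum_le) (auto intro: order_trans[OF degree_monom_le])
    show "poly P s = poly H (s\<^sup>2)" for s
      unfolding poly_eq_sum[OF deg] split by (simp add: H_def poly_sum poly_monom)
  qed
qed

context simple_euclidean_jordan_algebra
begin

subsection \<open>Polynomials in \<open>(x|c)\<close> and \<open>(x|e)\<close>\<close>

definition mono2 :: "'a \<Rightarrow> nat \<Rightarrow> nat \<Rightarrow> 'a \<Rightarrow> real" where
  "mono2 c k l x = tf x c ^ k * tf x e ^ l"

lemma real_polynomial_function_mono2: "real_polynomial_function (mono2 c k l)"
  unfolding mono2_def
  by (intro real_polynomial_function.intros(4) real_polynomial_function_power
      real_polynomial_function.intros(1) bounded_linear_tf)

lemma partial_mono2:
  "partial b (mono2 c k l) x =
     real k * tf b c * mono2 c (k - 1) l x + real l * tf b e * mono2 c k (l - 1) x"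
proof -
  have "((\<lambda>x. tf x c ^ k * tf x e ^ l) has_derivative
     (\<lambda>v. tf x c ^ k * (real l * (tf v e * tf x e ^ (l - 1))) + real k * (tf v c * tf x c ^ (k - 1)) * tf x e ^ l)) (at x)"
    by (auto intro!: derivative_eq_intros bounded_linear_imp_has_derivative[OF bounded_linear_tf])
  from partialI[OF this, of b] show ?thesis by (simp add: mono2_def[abs_def] algebra_simps)
qed

lemma partial2_mono2:
  "partial a (partial b (mono2 c k l)) x =
     real k * tf b c * (real (k - 1) * tf a c * mono2 c (k - 1 - 1) l x + real l * tf a e * mono2 c (k - 1) (l - 1) x)
     + real l * tf b e * (real k * tf a c * mono2 c (k - 1) (l - 1) x + real (l - 1) * tf a e * mono2 c k (l - 1 - 1) x)"
proof -
  have "partial b (mono2 c k l) =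
     (\<lambda>x. real k * tf b c * mono2 c (k - 1) l x + real l * tf b e * mono2 c k (l - 1) x)"
    by (rule ext) (rule partial_mono2)
  then show ?thesis
    using real_polynomial_function_mono2
    by (simp add: partial_add partial_cmult partial_mono2 real_polynomial_function.intros)
qed

lemma bessel_tr_mono2:
  assumes E: "tonb E" and c: "prim c"
  shows "bessel_tr E lam (mono2 c k l) x =
     real k * (real k - 1 + lam) * mono2 c (k - 1) l x
     + real l * (real l - 1 + 2 * real k + real (jrank (\<diamondop>) e) * lam) * mono2 c k (l - 1) x"
proof -
  have cc: "tf (x \<diamondop> c) c = tf x c"
    using tf_assoc[of c x c] prim_idem[OF c] commute[of x c] tf_assoc[of x c c] by (metis tf_commute)
  have ce: "tf (x \<diamondop> c) e = tf x c"
    using tf_assoc[of x c e] tf_commute[of c x] by (simp add: unit_right)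
  \<comment> \<open>Parseval contracts the basis. For v and w among c and e the result is again
    \<xi> or \<tau>, since c is idempotent.\<close>
  have s: "(\<Sum>a\<in>E. tf (x \<diamondop> a) v * tf a w) = tf (x \<diamondop> v) w" for v w
    using tonb_parseval[OF E, of "x \<diamondop> v" w] by (simp add: tf_assoc)
  let ?M = "\<lambda>k l. mono2 c k l x"
  have "(\<Sum>a\<in>E. partial a (partial (x \<diamondop> a) (mono2 c k l)) x) =
     real k * (real (k - 1) * (\<Sum>a\<in>E. tf (x \<diamondop> a) c * tf a c) * ?M (k - 1 - 1) l + real l * (\<Sum>a\<in>E. tf (x \<diamondop> a) c * tf a e) * ?M (k - 1) (l - 1))
     + real l * (real k * (\<Sum>a\<in>E. tf (x \<diamondop> a) e * tf a c) * ?M (k - 1) (l - 1) + real (l - 1) * (\<Sum>a\<in>E. tf (x \<diamondop> a) e * tf a e) * ?M k (l - 1 - 1))"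
    unfolding partial2_mono2
    by (simp add: sum.distrib sum_distrib_left sum_distrib_right algebra_simps)
  also have "\<dots> = real k * (real (k - 1) * (tf x c * ?M (k - 1 - 1) l) + real l * (tf x c * ?M (k - 1) (l - 1)))
     + real l * (real k * (tf x c * ?M (k - 1) (l - 1)) + real (l - 1) * (tf x e * ?M k (l - 1 - 1)))"
    unfolding s by (simp add: unit_right cc ce mult.assoc)
  also have "\<dots> = real k * (real k - 1) * ?M (k - 1) l + 2 * real k * real l * ?M k (l - 1)
     + real l * (real l - 1) * ?M k (l - 1)"
  proof -
    \<comment> \<open>The truncated exponents are harmless: whenever one truncates, the accompanying
      numerical factor is zero.\<close>
    have 1: "real k * (tf x c * ?M (k - 1) j) = real k * ?M k j" for j
      by (cases k) (auto simp: mono2_def)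
    have 2: "real k * (real (k - 1) * (tf x c * ?M (k - 1 - 1) l)) = real k * (real k - 1) * ?M (k - 1) l"
      by (cases k; cases "k - 1") (auto simp: mono2_def)
    have 3: "real l * (real (l - 1) * (tf x e * ?M k (l - 1 - 1))) = real l * (real l - 1) * ?M k (l - 1)"
      by (cases l; cases "l - 1") (auto simp: mono2_def)
    have 4: "real l * (real k * (tf x c * ?M (k - 1) (l - 1))) = real l * (real k * ?M k (l - 1))"
      by (simp only: 1)
    have 5: "real k * (real l * (tf x c * ?M (k - 1) (l - 1))) = real l * (real k * ?M k (l - 1))"
      using 1[of "l - 1"] by (simp add: mult.left_commute[of "real k" "real l"])
    show ?thesis unfolding distrib_left 2 3 4 5 by (simp add: mult_ac)
  qed
  finally show ?thesis
    unfolding bessel_tr_eq[OF E real_polynomial_function_mono2] partial_mono2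
    using tf_prim(2)[OF c] tf_e tf_commute[of e c] by (simp add: algebra_simps)
qed

lemma bessel_tr_add:
  assumes "tonb E" "real_polynomial_function f" "real_polynomial_function g"
  shows "bessel_tr E lam (\<lambda>x. f x + g x) x = bessel_tr E lam f x + bessel_tr E lam g x"
proof -
  have "partial b (\<lambda>x. f x + g x) = (\<lambda>x. partial b f x + partial b g x)" for b
    using partial_add[OF assms(2,3)] by auto
  then show ?thesis
    using assms real_polynomial_function_partial[OF assms(2)] real_polynomial_function_partial[OF assms(3)]
    by (simp add: bessel_tr_eq real_polynomial_function.intros(3) partial_add sum.distrib algebra_simps)
qed

lemma bessel_tr_cmult:
  assumes "tonb E" "real_polynomial_function f"
  shows "bessel_tr E lam (\<lambda>x. a * f x) x = a * bessel_tr E lam f x"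
proof -
  have "partial b (\<lambda>x. a * f x) = (\<lambda>x. a * partial b f x)" for b
    using partial_cmult[OF assms(2)] by auto
  moreover have "real_polynomial_function (\<lambda>x. a * f x)"
    using assms(2) by (intro real_polynomial_function.intros(2,4))
  ultimately show ?thesis
    using assms real_polynomial_function_partial[OF assms(2)]
    by (simp add: bessel_tr_eq partial_cmult sum_distrib_left algebra_simps)
qed

lemma bessel_tr_sum:
  assumes "tonb E" "finite K" "\<And>k. k \<in> K \<Longrightarrow> real_polynomial_function (f k)"
  shows "bessel_tr E lam (\<lambda>x. \<Sum>k\<in>K. A k * f k x) x = (\<Sum>k\<in>K. A k * bessel_tr E lam (f k) x)"
  using assms(2,3)
proof (induction rule: finite_induct)
  case empty
  have "bessel_tr E lam (\<lambda>x. 0 * 0) x = 0 * bessel_tr E lam (\<lambda>x. 0) x"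
    by (intro bessel_tr_cmult[OF assms(1)] real_polynomial_function.intros(2))
  then show ?case by simp
next
  case (insert k K)
  have "real_polynomial_function (\<lambda>x. A k * f k x)"
    using insert.prems by (intro real_polynomial_function.intros(2,4)) auto
  moreover have "real_polynomial_function (\<lambda>x. \<Sum>k\<in>K. A k * f k x)"
    using insert by (intro real_polynomial_function_sum real_polynomial_function.intros(2,4)) auto
  ultimately show ?case
    using insert by (simp add: bessel_tr_add[OF assms(1)] bessel_tr_cmult[OF assms(1)])
qed

text \<open>A polynomial in \<xi> made homogeneous of degree m by powers of \<tau>, which is 1 on
  primitive idempotents.\<close>

definition zonal :: "'a \<Rightarrow> nat \<Rightarrow> (nat \<Rightarrow> real) \<Rightarrow> 'a \<Rightarrow> real" where
  "zonal c m A x = (\<Sum>k\<le>m. A k * mono2 c k (m - k) x)"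

lemma real_polynomial_function_zonal: "real_polynomial_function (zonal c m A)"
  unfolding zonal_def
  by (intro real_polynomial_function_sum real_polynomial_function.intros(2,4) real_polynomial_function_mono2) auto

lemma zonal_scale: "zonal c m A (t *\<^sub>R x) = t ^ m * zonal c m A x"
proof -
  have "t ^ k * t ^ (m - k) = t ^ m" if "k \<le> m" for k using that by (simp add: power_add[symmetric])
  then have "mono2 c k (m - k) (t *\<^sub>R x) = t ^ m * mono2 c k (m - k) x" if "k \<le> m" for k
    using that by (simp add: mono2_def tf_bilinear power_mult_distrib mult_ac)
  then show ?thesis by (simp add: zonal_def sum_distrib_left mult.left_commute)
qed

lemma bessel_tr_zonal_0: "tonb E \<Longrightarrow> prim c \<Longrightarrow> bessel_tr E lam (zonal c 0 A) x = 0"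
  using bessel_tr_sum[of E "{..0}" "\<lambda>k. mono2 c k (0 - k)" lam A x] real_polynomial_function_mono2
  by (simp add: zonal_def[abs_def] bessel_tr_mono2)

lemma bessel_tr_zonal_Suc:
  assumes E: "tonb E" and c: "prim c"
  shows "bessel_tr E lam (zonal c (Suc n) A) x =
    (\<Sum>k\<le>n. (A (Suc k) * (real (Suc k) * (real k + lam)) +
       A k * (real (Suc n - k) * (real n + real k + real (jrank (\<diamondop>) e) * lam))) * mono2 c k (n - k) x)"
proof -
  define u where "u k = A k * (real k * (real k - 1 + lam) * mono2 c (k - 1) (Suc n - k) x)" for k
  define v where "v k = A k * (real (Suc n - k) * (real n + real k + real (jrank (\<diamondop>) e) * lam) * mono2 c k (Suc n - k - 1) x)" for k
  have "bessel_tr E lam (zonal c (Suc n) A) x = (\<Sum>k\<le>Suc n. u k + v k)"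
    unfolding zonal_def[abs_def]
    using bessel_tr_sum[OF E, of "{..Suc n}" "\<lambda>k. mono2 c k (Suc n - k)" lam A x] real_polynomial_function_mono2
    by (simp add: bessel_tr_mono2[OF E c] u_def v_def of_nat_diff algebra_simps del: sum.atMost_Suc)
  also have "\<dots> = (\<Sum>k\<le>Suc n. u k) + (\<Sum>k\<le>Suc n. v k)" by (rule sum.distrib)
  also have "(\<Sum>k\<le>Suc n. u k) = (\<Sum>k\<le>n. u (Suc k))"
    by (subst sum.atMost_Suc_shift) (simp add: u_def)
  also have "(\<Sum>k\<le>Suc n. v k) = (\<Sum>k\<le>n. v k)" by (simp add: v_def)
  also have "(\<Sum>k\<le>n. u (Suc k)) + (\<Sum>k\<le>n. v k) = (\<Sum>k\<le>n. u (Suc k) + v k)"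
    by (rule sum.distrib[symmetric])
  also have "\<dots> = (\<Sum>k\<le>n. (A (Suc k) * (real (Suc k) * (real k + lam)) +
       A k * (real (Suc n - k) * (real n + real k + real (jrank (\<diamondop>) e) * lam))) * mono2 c k (n - k) x)"
    by (intro sum.cong) (auto simp: u_def v_def algebra_simps)
  finally show ?thesis .
qed

definition hcoeff :: "nat \<Rightarrow> real \<Rightarrow> nat \<Rightarrow> real" where
  "hcoeff m lam k = pochhammer (- real m) k * pochhammer (real m + real (jrank (\<diamondop>) e) * lam - 1) k /
     (fact k * pochhammer lam k)"

lemma hcoeff_0: "hcoeff m lam 0 = 1"
  by (simp add: hcoeff_def)

text \<open>The ratio of consecutive hypergeometric coefficients with denominators cleared, in the
  shape in which \<open>bessel_tr_zonal_Suc\<close> combines A (k + 1) and A k.\<close>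

lemma hcoeff_Suc:
  assumes "lam > 0"
  shows "hcoeff m lam (Suc k) * (real (Suc k) * (real k + lam)) =
    hcoeff m lam k * ((real k - real m) * (real m + real k - 1 + real (jrank (\<diamondop>) e) * lam))"
proof -
  have "real k + lam \<noteq> 0" "lam + real k \<noteq> 0" using assms by linarith+
  moreover have "pochhammer lam k \<noteq> 0" using pochhammer_pos[OF assms, of k] by simp
  moreover have "(fact k :: real) \<noteq> 0" "1 + real k \<noteq> 0" by simp_all
  ultimately show ?thesis
    unfolding hcoeff_def pochhammer_Suc fact_Suc
    by (simp add: divide_simps) (simp add: algebra_simps)
qed

lemma hyp2F1_eq:
  "hyp2F1 (- real m) (real m + real (jrank (\<diamondop>) e) * lam - 1) lam z = (\<Sum>k\<le>m. hcoeff m lam k * z ^ k)"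
  unfolding hyp2F1_def hcoeff_def
  by (rule suminf_finite) (auto simp: pochhammer_of_nat_eq_0_lemma)

lemma zonal_prim:
  assumes "prim x"
  shows "zonal c m (hcoeff m lam) x = hyp2F1 (- real m) (real m + real (jrank (\<diamondop>) e) * lam - 1) lam (tf x c)"
  unfolding hyp2F1_eq using tf_prim(2)[OF assms] by (simp add: zonal_def mono2_def)

lemma bessel_tr_zonal_hcoeff:
  assumes "tonb E" "prim c" "lam > 0"
  shows "bessel_tr E lam (zonal c m (hcoeff m lam)) x = 0"
proof (cases m)
  case 0
  then show ?thesis using bessel_tr_zonal_0[OF assms(1,2)] by simp
next
  case (Suc n)
  have "hcoeff m lam (Suc k) * (real (Suc k) * (real k + lam)) +
       hcoeff m lam k * (real (Suc n - k) * (real n + real k + real (jrank (\<diamondop>) e) * lam)) = 0" if "k \<le> n" for k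
    unfolding hcoeff_Suc[OF assms(3)] using that Suc by (simp add: of_nat_diff algebra_simps)
  then show ?thesis using bessel_tr_zonal_Suc[OF assms(1,2), of lam n "hcoeff m lam" x] Suc by simp
qed

subsection \<open>Invariant polynomials\<close>

text \<open>In the matrix model this is Gram-Schmidt: \<open>j\<close> belongs to the unit vector
  \<open>(w - \<beta> v) / \<surd>(1 - \<beta>\<^sup>2)\<close>.\<close>

lemma prim_as_mix:
  assumes rk: "jrank (\<diamondop>) e > 1" and c: "prim c" and p: "prim p"
  obtains j z a b where "link c j 0 z" "p = mix c j z a b"
proof (cases "p = c")
  case True
  have cc: "orth_prims {c}" using c by (simp add: orth_prims_def)
  have "\<Sum>{c} \<noteq> e" using card_frame[OF cc] rk by auto
  then obtain j where "prim j" "c \<diamondop> j = 0" using extend_orth_prims[OF cc] by (metis singletonI)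
  then obtain z where "link c j 0 z" using ex_link_orthogonal[OF c] by blast
  then show ?thesis using that[of j z 1 0] True by (simp add: mix_def)
next
  case False
  obtain \<beta> w where l: "link c p \<beta> w" using ex_link[OF c p] .
  \<comment> \<open>Strict positivity of the norm of c - p gives \<beta> < 1, so that \<sigma> can
    be a divisor.\<close>
  note L = linkD[OF l] and I = link_inner[OF l]
  have "(c - p) \<bullet> (c - p) > 0" using False by simp
  then have "c \<bullet> p < nu"
    using prim_nu[OF c] prim_nu[OF p] by (simp add: inner_simps inner_commute[of p c])
  then have "\<beta>\<^sup>2 < 1" using I(2) nu_pos by simp
  define \<sigma> where "\<sigma> = sqrt (1 - \<beta>\<^sup>2)"
  have \<sigma>: "\<sigma> > 0" "\<sigma>\<^sup>2 = 1 - \<beta>\<^sup>2" using \<open>\<beta>\<^sup>2 < 1\<close> by (simp_all add: \<sigma>_def)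
  define j where "j = (1 / \<sigma>\<^sup>2) *\<^sub>R (p + \<beta>\<^sup>2 *\<^sub>R c - \<beta> *\<^sub>R w)"
  \<comment> \<open>Writing the vector of p as \<beta> v + \<sigma> u, the element w of the link
    becomes 2 \<beta> c + \<sigma> z, which is solved for z.\<close>
  define z where "z = (1 / \<sigma>) *\<^sub>R (w - (2 * \<beta>) *\<^sub>R c)"
  have "(-\<beta>)\<^sup>2 + 1\<^sup>2 + 2 * (-\<beta>) * 1 * \<beta> = \<sigma>\<^sup>2"
    unfolding \<sigma>(2) by (simp add: power2_eq_square)
  moreover from this have "prim ((1 / \<sigma>\<^sup>2) *\<^sub>R mix c p w (-\<beta>) 1)"
    using prim_mix[OF l, of "-\<beta>" 1] \<sigma>(1) by simp
  moreover have "mix c p w (-\<beta>) 1 = p + \<beta>\<^sup>2 *\<^sub>R c - \<beta> *\<^sub>R w" by (simp add: mix_def)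
  ultimately have j: "prim j" by (simp add: j_def)
  have cj: "c \<diamondop> j = 0"
    by (simp add: j_def jp_simps L power2_eq_square scaleR_add_right)
  have cz: "c \<diamondop> z = (1/2) *\<^sub>R z"
    unfolding z_def by (rule vector_inner_eqI) (simp add: jp_simps L inner_simps algebra_simps)
  have jz: "j \<diamondop> z = (1/2) *\<^sub>R z"
  proof -
    have "(p + \<beta>\<^sup>2 *\<^sub>R c - \<beta> *\<^sub>R w) \<diamondop> (w - (2 * \<beta>) *\<^sub>R c) = (\<sigma>\<^sup>2 / 2) *\<^sub>R (w - (2 * \<beta>) *\<^sub>R c)"
      unfolding \<sigma>(2)
      by (rule vector_inner_eqI) (simp add: jp_simps L inner_simps algebra_simps power2_eq_square diff_divide_distrib)
    then show ?thesis using \<sigma>(1) by (simp add: j_def z_def jp.scaleR_left jp.scaleR_right)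
  qed
  have "z \<bullet> z = 2 * nu"
  proof -
    have "w \<bullet> w = (w \<diamondop> w) \<bullet> e" using inner_assoc[of w w e] by (simp add: unit_right)
    also have "\<dots> = 2 * \<beta>\<^sup>2 * nu + 2 * nu"
      using I prim_nu[OF c] prim_nu[OF p] inner_e prim_idem[OF c] prim_idem[OF p]
      by (simp add: L(10) inner_simps power2_eq_square)
    finally have "(w - (2 * \<beta>) *\<^sub>R c) \<bullet> (w - (2 * \<beta>) *\<^sub>R c) = \<sigma>\<^sup>2 * (2 * nu)"
      using I(3) prim_nu[OF c] unfolding \<sigma>(2)
      by (simp add: inner_simps inner_commute[of c w] algebra_simps power2_eq_square)
    then show ?thesis using \<sigma>(1) by (simp add: z_def power2_eq_square)
  qed
  then have lk: "link c j 0 z" using c j cj cz jz link_offdiag_iff offdiag_mem by blast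
  have "mix c j z \<beta> \<sigma> = \<beta>\<^sup>2 *\<^sub>R c + (p + \<beta>\<^sup>2 *\<^sub>R c - \<beta> *\<^sub>R w) + \<beta> *\<^sub>R (w - (2 * \<beta>) *\<^sub>R c)"
    using \<sigma>(1) by (simp add: mix_def j_def z_def)
  also have "\<dots> = p" by (rule vector_inner_eqI) (simp add: inner_simps power2_eq_square algebra_simps)
  finally show ?thesis using that[OF lk] by metis
qed

text \<open>Invariance is asked for on primitive idempotents only, because the harmonics live on the
  sphere; homogeneity extends it to the multiples that \<open>mix\<close> produces. Equality is
  claimed on the orbit, not on the whole space.\<close>

lemma invariant_is_zonal:
  assumes rk: "jrank (\<diamondop>) e > 1" "jrank (\<diamondop>) e > 2 \<or> offdiag_peirce_dim (\<diamondop>) e > 1"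
    and c: "prim c" and f: "real_polynomial_function f"
    and hom: "\<And>t x. f (t *\<^sub>R x) = t ^ m * f x"
    and inv: "\<And>k x. k \<in> KL_stab (\<diamondop>) e c \<Longrightarrow> prim x \<Longrightarrow> f (blinfun_apply k x) = f x"
  obtains A where "\<And>x. x \<in> Xi (\<diamondop>) e c \<Longrightarrow> f x = zonal c m A x"
proof -
  obtain j0 z0 a0 b0 where l0: "link c j0 0 z0" using prim_as_mix[OF rk(1) c c] .
  have inv_mix: "f (mix c (blinfun_apply k j) (blinfun_apply k z) a b) = f (mix c j z a b)"
    if k: "k \<in> KL_stab (\<diamondop>) e c" and l: "link c j 0 z" for k j z a b
  proof -
    have kc: "blinfun_apply k c = c" using k by (simp add: KL_stab_def)
    have km: "mix c (blinfun_apply k j) (blinfun_apply k z) a b = blinfun_apply k (mix c j z a b)"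
      by (simp add: mix_def blinfun.add_right blinfun.scaleR_right kc)
    show ?thesis
    proof (cases "a\<^sup>2 + b\<^sup>2 = 0")
      case True
      then have "a = 0" "b = 0" by (auto simp: sum_power2_eq_zero_iff)
      then show ?thesis by (simp add: mix_def)
    next
      case False
      define p where "p = (1 / (a\<^sup>2 + b\<^sup>2)) *\<^sub>R mix c j z a b"
      have "prim p" using prim_mix[OF l, of a b] False by (simp add: p_def)
      have "mix c j z a b = (a\<^sup>2 + b\<^sup>2) *\<^sub>R p"
        unfolding p_def scaleR_scaleR using False by (simp del: sum_power2_eq_zero_iff)
      then show ?thesis
        unfolding km using inv[OF k \<open>prim p\<close>] by (simp add: blinfun.scaleR_right hom)
    qed
  qed
  define g where "g s = f (mix c j0 z0 1 s)" for s
  have all: "f (mix c j z a b) = f (mix c j0 z0 a b)" if "link c j 0 z" for j z a b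
    using link_orbit[OF l0 that rk, of "\<lambda>j z. f (mix c j z a b)"] inv_mix by blast
  have poly_mix: "real_polynomial_function (\<lambda>s. f (mix c j z (a s) (b s)))"
    if "real_polynomial_function a" "real_polynomial_function b" for a b :: "real \<Rightarrow> real" and j z
  proof -
    have "polynomial_function (\<lambda>s. mix c j z (a s) (b s))"
      unfolding mix_def using that
      by (intro polynomial_function_add polynomial_function_mult)
         (auto simp: real_polynomial_function_eq[symmetric] intro: real_polynomial_function_power)
    from real_polynomial_function_compose[OF this f] show ?thesis by (simp add: o_def)
  qed
  have idp: "real_polynomial_function (\<lambda>s::real. s)" by (intro real_polynomial_function.intros(1) bounded_linear_ident)
  obtain P where P: "\<And>s. f (mix c j0 z0 1 s) = poly P s"
    using real_polynomial_function_poly[OF poly_mix[OF real_polynomial_function.intros(2) idp]] by blast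
  obtain R where R: "\<And>s. f (mix c j0 z0 s 1) = poly R s"
    using real_polynomial_function_poly[OF poly_mix[OF idp real_polynomial_function.intros(2)]] by blast
  have mix_scale: "mix c j z (t * a) (t * b) = t\<^sup>2 *\<^sub>R mix c j z a b" for j z t a b
    by (simp add: mix_def scaleR_add_right power2_eq_square mult_ac)
  \<comment> \<open>\<open>mix\<close> is quadratic in its two coefficients, so degree m becomes 2
    m, and exchanging the normalized coefficient inverts s.\<close>
  have "poly P s = s ^ (2 * m) * poly R (inverse s)" if "s \<noteq> 0" for s
  proof -
    have "mix c j0 z0 1 s = s\<^sup>2 *\<^sub>R mix c j0 z0 (inverse s) 1"
      using mix_scale[of j0 z0 s "inverse s" 1] that by simp
    then have "f (mix c j0 z0 1 s) = (s\<^sup>2) ^ m * f (mix c j0 z0 (inverse s) 1)" by (simp add: hom)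
    then show ?thesis by (simp add: P R power_mult)
  qed
  then have degP: "degree P \<le> 2 * m" by (rule degree_le_if_reversible)
  have "poly P (- s) = poly P s" for s
  proof -
    \<comment> \<open>A sign change of s is a sign change of \<open>z0\<close>, and f takes the same
      value for both links.\<close>
    have "mix c j0 z0 1 (- s) = mix c j0 (- z0) 1 s" by (simp add: mix_def)
    then show ?thesis using all[OF link_neg[OF l0], of 1 s] P by metis
  qed
  then obtain H where H: "degree H \<le> m" "\<And>s. poly P s = poly H (s\<^sup>2)"
    using even_poly_in_square[OF _ degP] by blast
  \<comment> \<open>On \<open>mix c j z 1 s\<close> one has \<xi> = 1 and \<tau> = 1 + s^2, so H is
    rewritten as a polynomial in \<tau>; the power of \<tau> accompanying \<xi>^k is m - k, hence
    the reversed coefficients \<open>A\<close>.\<close>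
  define K where "K = pcompose H [:-1, 1:]"
  have degK: "degree K \<le> m" using H(1) by (simp add: K_def degree_pcompose)
  define A where "A k = coeff K (m - k)" for k
  have one: "f (mix c j z 1 s) = zonal c m A (mix c j z 1 s)" if l: "link c j 0 z" for j z s
  proof -
    have "tf j c = 0" "tf z c = 0" using link_inner[OF l] by (simp_all add: tf_eq inner_commute[of j c])
    then have "tf (mix c j z 1 s) c = 1" using tf_prim(1)[OF c] by (simp add: mix_def tf_bilinear)
    moreover have "tf (mix c j z 1 s) e = 1 + s\<^sup>2"
      using mix_trace[OF l, of 1 s] nu_pos by (simp add: tf_eq)
    ultimately have "zonal c m A (mix c j z 1 s) = (\<Sum>k\<le>m. coeff K (m - k) * (1 + s\<^sup>2) ^ (m - k))"
      by (simp add: zonal_def mono2_def A_def)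
    also have "\<dots> = (\<Sum>i\<le>m. coeff K i * (1 + s\<^sup>2) ^ i)"
      by (rule sum.reindex_bij_witness[of _ "\<lambda>i. m - i" "\<lambda>i. m - i"]) auto
    also have "\<dots> = poly K (1 + s\<^sup>2)" by (rule poly_eq_sum[OF degK, symmetric])
    also have "\<dots> = poly P s" by (simp add: K_def poly_pcompose H(2))
    finally show ?thesis using all[OF l] P by simp
  qed
  have nonzero: "f (mix c j z a b) = zonal c m A (mix c j z a b)" if l: "link c j 0 z" and "a \<noteq> 0" for j z a b
  proof -
    have "mix c j z a b = a\<^sup>2 *\<^sub>R mix c j z 1 (b / a)"
      using mix_scale[of j z a 1 "b / a"] \<open>a \<noteq> 0\<close> by simp
    then show ?thesis using one[OF l] by (simp add: hom zonal_scale)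
  qed
  have any: "f (mix c j z a b) = zonal c m A (mix c j z a b)" if l: "link c j 0 z" for j z a b
  proof (cases "a = 0")
    case True
    \<comment> \<open>The value at a = 0 cannot be scaled to a = 1; it follows from equality of two
      polynomials in a away from 0.\<close>
    obtain P1 where P1: "\<And>s. f (mix c j z s b) = poly P1 s"
      using real_polynomial_function_poly[OF poly_mix[OF idp real_polynomial_function.intros(2)]] by blast
    have "polynomial_function (\<lambda>s. mix c j z s b)"
      unfolding mix_def
      by (intro polynomial_function_add polynomial_function_mult)
         (auto simp: real_polynomial_function_eq[symmetric] intro: real_polynomial_function_power idp)
    from real_polynomial_function_compose[OF this real_polynomial_function_zonal[of c m A]]
    obtain P2 where P2: "\<And>s. zonal c m A (mix c j z s b) = poly P2 s"
      using real_polynomial_function_poly by (metis comp_apply)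
    have "P1 = P2"
      by (rule poly_eq_if_eq_nonzero) (use nonzero[OF l] P1 P2 in metis)
    then show ?thesis using P1 P2 by simp
  qed (use nonzero[OF l] in blast)
  show ?thesis
  proof (rule that[of A])
    fix x assume "x \<in> Xi (\<diamondop>) e c"
    then obtain t p where tp: "x = t *\<^sub>R p" "prim p" unfolding Xi_eq[OF c] by blast
    obtain j z a b where "link c j 0 z" "p = mix c j z a b" using prim_as_mix[OF rk(1) c tp(2)] .
    then show "f x = zonal c m A x" using any by (simp add: tp(1) hom zonal_scale)
  qed
qed

text \<open>Positivity of \<lambda> keeps the denominators of the hypergeometric coefficients and of
  the recursion away from zero.\<close>

lemma offdiag_peirce_dim_pos:
  assumes "jrank (\<diamondop>) e > 1" shows "offdiag_peirce_dim (\<diamondop>) e > 0"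
proof -
  obtain c where c: "prim c" using ex_prim by blast
  obtain j z a b where l: "link c j 0 z" using prim_as_mix[OF assms c c] .
  note L = linkD[OF l]
  have z: "z \<in> offdiag c j" "z \<bullet> z = 2 * nu" using l link_offdiag_iff by blast+
  have "dim (offdiag c j) \<noteq> 0"
    using z nu_pos unfolding dim_eq_0 by auto
  then show ?thesis using offdiag_peirce_dim_eq[OF assms L(1,2)] L(4) by simp
qed

lemma invariant_harmonic_unique:
  assumes rk: "jrank (\<diamondop>) e > 1" "jrank (\<diamondop>) e > 2 \<or> offdiag_peirce_dim (\<diamondop>) e > 1"
    and c: "prim c" and E: "tonb E" and lam: "lam = real (offdiag_peirce_dim (\<diamondop>) e) / 2"
    and f: "real_polynomial_function f"
    and hom: "\<And>t x. f (t *\<^sub>R x) = t ^ m * f x"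
    and inv: "\<And>k x. k \<in> KL_stab (\<diamondop>) e c \<Longrightarrow> prim x \<Longrightarrow> f (blinfun_apply k x) = f x"
    and harm: "\<And>x. x \<in> Xi (\<diamondop>) e c \<Longrightarrow> bessel_tr E lam f x = 0"
  obtains \<alpha> where "\<And>x. x \<in> Xi (\<diamondop>) e c \<Longrightarrow> f x = \<alpha> * zonal c m (hcoeff m lam) x"
proof -
  obtain A where A: "\<And>x. x \<in> Xi (\<diamondop>) e c \<Longrightarrow> f x = zonal c m A x"
    using invariant_is_zonal[where f = f, OF rk c f hom inv] by blast
  have lam_pos: "lam > 0" using offdiag_peirce_dim_pos[OF rk(1)] lam by simp
  have neg: "real_polynomial_function (\<lambda>x. (-1) * f x)"
    using f by (intro real_polynomial_function.intros(2,4))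
  have harmA: "bessel_tr E lam (zonal c m A) x = 0" if x: "x \<in> Xi (\<diamondop>) e c" for x
  proof -
    \<comment> \<open>The difference of the two extensions vanishes on the orbit, so tangentiality
      transfers harmonicity from f to its zonal form.\<close>
    have "bessel_tr E lam (\<lambda>x. zonal c m A x + (-1) * f x) x = 0"
      using A neg by (intro bessel_tangential[OF rk(1) c E _ _ x lam]
          real_polynomial_function.intros(3) real_polynomial_function_zonal) auto
    then show ?thesis
      using harm[OF x] by (simp only: bessel_tr_add[OF E real_polynomial_function_zonal neg] bessel_tr_cmult[OF E f])
  qed
  have Ak: "A k = A 0 * hcoeff m lam k" if "k \<le> m" for k
  proof (cases m)
    case 0
    then show ?thesis using that by (simp add: hcoeff_0)
  next
    case (Suc n)
    define B where "B k = A (Suc k) * (real (Suc k) * (real k + lam)) +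
       A k * (real (Suc n - k) * (real n + real k + real (jrank (\<diamondop>) e) * lam))" for k
    define PB where "PB = (\<Sum>k\<le>n. monom (B k) k)"
    obtain j z a b where l: "link c j 0 z" using prim_as_mix[OF rk(1) c c] .
    have "poly PB s = 0" if s: "s \<in> {0..1}" for s
    proof -
      \<comment> \<open>This primitive idempotent has \<xi> = s and \<tau> = 1. As s runs through an
        interval, the polynomial \<open>PB\<close> acquires infinitely many roots.\<close>
      define x where "x = mix c j z (sqrt s) (sqrt (1 - s))"
      have "prim x" using prim_mix[OF l, of "sqrt s" "sqrt (1 - s)"] s by (simp add: x_def)
      then have "x \<in> Xi (\<diamondop>) e c"
        unfolding Xi_eq[OF c] by (intro CollectI exI[of _ 1] exI[of _ x]) simp
      then have "(\<Sum>k\<le>n. B k * mono2 c k (n - k) x) = 0"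
        using harmA bessel_tr_zonal_Suc[OF E c, of lam n A x] Suc by (simp add: B_def)
      moreover have "tf j c = 0" "tf z c = 0" using link_inner[OF l] by (simp_all add: tf_eq inner_commute[of j c])
      then have "tf x c = s" using tf_prim(1)[OF c] s by (simp add: x_def mix_def tf_bilinear)
      ultimately show ?thesis
        using tf_prim(2)[OF \<open>prim x\<close>] by (simp add: PB_def mono2_def poly_sum poly_monom)
    qed
    then have "{0..1} \<subseteq> {s. poly PB s = 0}" by blast
    then have "infinite {s. poly PB s = 0}"
      using infinite_super infinite_Icc[of "0::real" 1] by (metis zero_less_one)
    then have "PB = 0" using poly_roots_finite by blast
    have B: "B k = 0" if "k \<le> n" for k
    proof -
      have "coeff PB k = B k" using that by (simp add: PB_def coeff_sum)
      then show ?thesis using \<open>PB = 0\<close> by simp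
    qed
    from that show ?thesis
    proof (induction k)
      case 0
      then show ?case by (simp add: hcoeff_0)
    next
      case (Suc k)
      have k: "k \<le> n" using Suc.prems \<open>m = Suc n\<close> by simp
      have nz: "real (Suc k) * (real k + lam) \<noteq> 0" using lam_pos by simp
      have "A (Suc k) * (real (Suc k) * (real k + lam)) =
          A k * ((real k - real m) * (real m + real k - 1 + real (jrank (\<diamondop>) e) * lam))"
        using B[OF k] k \<open>m = Suc n\<close> unfolding B_def by (simp add: of_nat_diff algebra_simps)
      also have "\<dots> = A 0 * hcoeff m lam (Suc k) * (real (Suc k) * (real k + lam))"
        using Suc hcoeff_Suc[OF lam_pos, of m k] by (simp add: mult.assoc)
      finally show ?case using nz by (metis mult_right_cancel)
    qed
  qed
  have "zonal c m A x = (\<Sum>k\<le>m. A 0 * hcoeff m lam k * mono2 c k (m - k) x)" for x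
    unfolding zonal_def
  proof (intro sum.cong refl)
    fix k assume "k \<in> {..m}"
    then have "k \<le> m" by simp
    from arg_cong[OF Ak[OF this], of "\<lambda>t. t * mono2 c k (m - k) x"]
    show "A k * mono2 c k (m - k) x = A 0 * hcoeff m lam k * mono2 c k (m - k) x" .
  qed
  then have "zonal c m A x = A 0 * zonal c m (hcoeff m lam) x" for x
    by (simp only: zonal_def sum_distrib_left mult.assoc)
  then show ?thesis using that A by metis
qed

subsection \<open>Complex harmonics\<close>

lemma bessel_e_eq:
  "bessel_e (\<diamondop>) e E lam q x =
     Complex (bessel_tr E lam (\<lambda>y. Re (q y)) x) (bessel_tr E lam (\<lambda>y. Im (q y)) x)"
  by (simp add: bessel_e_def bessel_tr_def)

lemma homogeneous_poly_parts:
  assumes "q \<in> homogeneous_poly m"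
  shows "real_polynomial_function (\<lambda>y. Re (q y))" "real_polynomial_function (\<lambda>y. Im (q y))"
    "Re (q (t *\<^sub>R x)) = t ^ m * Re (q x)" "Im (q (t *\<^sub>R x)) = t ^ m * Im (q x)"
proof -
  have q: "polynomial_function q" "q (t *\<^sub>R x) = of_real t ^ m * q x"
    using assms by (auto simp: homogeneous_poly_def)
  show "real_polynomial_function (\<lambda>y. Re (q y))" "real_polynomial_function (\<lambda>y. Im (q y))"
    using q(1) bounded_linear_Re bounded_linear_Im unfolding polynomial_function_def o_def by blast+
  show "Re (q (t *\<^sub>R x)) = t ^ m * Re (q x)" "Im (q (t *\<^sub>R x)) = t ^ m * Im (q x)"
    unfolding q(2) of_real_power[symmetric] by simp_all
qed

lemma zonal_homogeneous_poly: "(\<lambda>x. w * complex_of_real (zonal c m A x)) \<in> homogeneous_poly m"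
proof -
  have "polynomial_function (\<lambda>x. w * complex_of_real (zonal c m A x))"
    unfolding polynomial_function_def
  proof (intro allI impI)
    fix h :: "complex \<Rightarrow> real" assume h: "bounded_linear h"
    have "h (w * complex_of_real y) = h w * y" for y
      using linear_scale[OF bounded_linear.linear[OF h], of y w] by (simp add: scaleR_conv_of_real mult.commute)
    then have "h \<circ> (\<lambda>x. w * complex_of_real (zonal c m A x)) = (\<lambda>x. h w * zonal c m A x)" by auto
    then show "real_polynomial_function (h \<circ> (\<lambda>x. w * complex_of_real (zonal c m A x)))"
      using real_polynomial_function_zonal by (auto intro: real_polynomial_function.intros)
  qed
  then show ?thesis by (simp add: homogeneous_poly_def zonal_scale mult_ac)
qed

lemma KL_inv_prim:
  assumes "k \<in> KL (\<diamondop>) e"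
  shows "prim (inv (blinfun_apply k) x) \<longleftrightarrow> prim x"
proof -
  note K = KL_automorphism[OF assms]
  define y where "y = inv (blinfun_apply k) x"
  have x: "x = k y" using K(1) by (simp add: y_def bij_is_surj surj_f_inv_f)
  have "prim y" if "prim (k y)"
  proof (rule prim_if_trace)
    have "k (y \<diamondop> y) = k y" using prim_idem[OF that] K(3) by simp
    then show "y \<diamondop> y = y" using K(1) by (metis bij_is_inj injD)
    have "y \<bullet> e = k y \<bullet> e" using K(2,4) by metis
    then show "y \<bullet> e = nu" using inner_e[OF prim_idem[OF that]] prim_nu[OF that] by simp
  qed
  then show ?thesis using KL_prim[OF assms, of y] x unfolding y_def[symmetric] by blast
qed

theorem invariant_harmonics:
  assumes rk: "jrank (\<diamondop>) e > 1" "jrank (\<diamondop>) e > 2 \<or> offdiag_peirce_dim (\<diamondop>) e > 1"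
    and c: "prim c" and E: "tonb E" and lam: "lam = real (offdiag_peirce_dim (\<diamondop>) e) / 2"
    and \<phi>: "\<phi> = restr (SS (\<diamondop>) e c) (\<lambda>x. complex_of_real
           (hyp2F1 (- real m) (real m + real (jrank (\<diamondop>) e) * lam - 1) lam (tf x c)))"
  shows "invariant_harmonics_SS (\<diamondop>) e E lam c m = range (\<lambda>w. cscale w \<phi>)" "\<phi> \<noteq> 0"
proof -
  let ?S = "SS (\<diamondop>) e c" and ?X = "Xi (\<diamondop>) e c" and ?Z = "zonal c m (hcoeff m lam)"
  have lam_pos: "lam > 0" using offdiag_peirce_dim_pos[OF rk(1)] lam by simp
  have S: "x \<in> ?S \<longleftrightarrow> prim x" for x using SS_eq[OF c] by simp
  have SX: "x \<in> ?X" if "prim x" for x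
    unfolding Xi_eq[OF c] using that by (intro CollectI exI[of _ 1] exI[of _ x]) simp
  have \<phi>_eq: "\<phi> x = (if prim x then complex_of_real (?Z x) else 0)" for x
    by (simp add: \<phi> restr_def S zonal_prim)
  have "cscale w \<phi> \<in> harmonics_SS (\<diamondop>) e E lam c m" for w
  proof -
    define q where "q = (\<lambda>x. w * complex_of_real (?Z x))"
    have q: "q \<in> homogeneous_poly m" unfolding q_def by (rule zonal_homogeneous_poly)
    have "bessel_e (\<diamondop>) e E lam q x = 0" for x
      by (simp add: bessel_e_eq q_def bessel_tr_cmult[OF E real_polynomial_function_zonal]
          bessel_tr_zonal_hcoeff[OF E c lam_pos] Complex_eq_0)
    then have "restr ?X q \<in> harmonics_Xi (\<diamondop>) e E lam c m"
      using q unfolding harmonics_Xi_def polys_Xi_def by blast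
    moreover have "cscale w \<phi> = restr ?S (restr ?X q)"
      using SX by (auto simp: cscale_def \<phi>_eq restr_def S q_def)
    ultimately show ?thesis unfolding harmonics_SS_def by blast
  qed
  moreover have "cscale w \<phi> (inv (blinfun_apply k) x) = cscale w \<phi> x"
    if "k \<in> KL_stab (\<diamondop>) e c" for w k x
  proof -
    have k: "k \<in> KL (\<diamondop>) e" "k c = c" using that by (auto simp: KL_stab_def)
    note K = KL_automorphism[OF k(1)]
    define y where "y = inv (blinfun_apply k) x"
    have x: "x = k y" using K(1) by (simp add: y_def bij_is_surj surj_f_inv_f)
    have "tf y c = tf x c" using K(4)[of y c] k(2) by (simp add: x tf_eq)
    then show ?thesis
      unfolding y_def[symmetric] using KL_inv_prim[OF k(1), of x]
      by (simp add: cscale_def \<phi> restr_def S y_def)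
  qed
  moreover have "p \<in> range (\<lambda>w. cscale w \<phi>)" if p: "p \<in> invariant_harmonics_SS (\<diamondop>) e E lam c m" for p
  proof -
    have pinv: "p (inv (blinfun_apply k) x) = p x" if "k \<in> KL_stab (\<diamondop>) e c" for k x
      using p that unfolding invariant_harmonics_SS_def by (auto dest: fun_cong)
    obtain q where q: "q \<in> homogeneous_poly m" "p = restr ?S (restr ?X q)"
      and harm: "\<And>x. x \<in> ?X \<Longrightarrow> bessel_e (\<diamondop>) e E lam q x = 0"
      using p unfolding invariant_harmonics_SS_def harmonics_SS_def harmonics_Xi_def by auto
    have pq: "p x = (if prim x then q x else 0)" for x
      using SX by (simp add: q(2) restr_def S)
    have qinv: "q (blinfun_apply k x) = q x" if k: "k \<in> KL_stab (\<diamondop>) e c" and x: "prim x" for k x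
    proof -
      have kK: "k \<in> KL (\<diamondop>) e" using k by (simp add: KL_stab_def)
      then have "inv (blinfun_apply k) (k x) = x"
        using KL_automorphism(1) by (simp add: bij_is_inj)
      then show ?thesis
        using pinv[OF k, of "k x"] KL_prim[OF kK x] x by (simp add: pq)
    qed
    note hp = homogeneous_poly_parts[OF q(1)]
    \<comment> \<open>The operator has real coefficients, so real and imaginary parts are harmonic
      and invariant separately.\<close>
    obtain \<alpha> where \<alpha>: "\<And>x. x \<in> ?X \<Longrightarrow> Re (q x) = \<alpha> * ?Z x"
      using invariant_harmonic_unique[where f = "\<lambda>y. Re (q y)", OF rk c E lam hp(1) hp(3)] qinv harm
      by (simp add: bessel_e_eq Complex_eq_0) blast
    obtain \<beta> where \<beta>: "\<And>x. x \<in> ?X \<Longrightarrow> Im (q x) = \<beta> * ?Z x"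
      using invariant_harmonic_unique[where f = "\<lambda>y. Im (q y)", OF rk c E lam hp(2) hp(4)] qinv harm
      by (simp add: bessel_e_eq Complex_eq_0) blast
    have "p = cscale (Complex \<alpha> \<beta>) \<phi>"
      using \<alpha> \<beta> SX by (auto simp: cscale_def \<phi>_eq pq complex_eq_iff)
    then show ?thesis by blast
  qed
  ultimately show "invariant_harmonics_SS (\<diamondop>) e E lam c m = range (\<lambda>w. cscale w \<phi>)"
    unfolding invariant_harmonics_SS_def by (auto simp: fun_eq_iff)
  \<comment> \<open>At a primitive idempotent orthogonal to c one has \<xi> = 0, and only the
    constant coefficient 1 survives.\<close>
  obtain j z a b where l: "link c j 0 z" using prim_as_mix[OF rk(1) c c] .
  have "tf j c = 0" using link_inner[OF l] by (simp add: tf_eq inner_commute)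
  then have "?Z j = hcoeff m lam 0"
    using tf_prim(2)[OF linkD(2)[OF l]]
    by (simp add: zonal_def mono2_def power_0_left if_distrib[of "\<lambda>t. _ * t"] cong: if_cong)
  then have "\<phi> j \<noteq> 0" using linkD(2)[OF l] by (simp add: \<phi>_eq hcoeff_0)
  then show "\<phi> \<noteq> 0" by auto
qed

end

theorem proposition1p17:
  fixes jp :: "'a::euclidean_space \<Rightarrow> 'a \<Rightarrow> 'a"
    and e c\<^sub>1 :: 'a and E :: "'a set"
    and r d m :: nat and lam :: real
    and \<phi> :: "'a \<Rightarrow> complex"
  assumes "simple_euclidean_jordan_algebra jp e"
    and "r = jrank jp e" and "r > 1"
    and "d = offdiag_peirce_dim jp e"
    and "r > 2 \<or> d > 1"
    and "lam = real d / 2"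
    and "primitive_idempotent jp c\<^sub>1"
    and "trace_orthonormal_basis jp e E"
    and "\<phi> = restr (SS jp e c\<^sub>1) (\<lambda>x. complex_of_real
           (hyp2F1 (- real m) (real m + real r * lam - 1) lam (tform jp e x c\<^sub>1)))"
  shows "\<phi> \<in> harmonics_SS jp e E lam c\<^sub>1 m
    \<and> vector_space.dim cscale (invariant_harmonics_SS jp e E lam c\<^sub>1 m) = 1
    \<and> module.span cscale {\<phi>} = invariant_harmonics_SS jp e E lam c\<^sub>1 m"
proof -
  interpret simple_euclidean_jordan_algebra jp e by fact
  interpret V: vector_space "cscale :: complex \<Rightarrow> ('a \<Rightarrow> complex) \<Rightarrow> _" by (rule vector_space_cscale)
  let ?I = "invariant_harmonics_SS jp e E lam c\<^sub>1 m"
  have rk: "jrank jp e > 1" "jrank jp e > 2 \<or> offdiag_peirce_dim jp e > 1"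
    and lam: "lam = real (offdiag_peirce_dim jp e) / 2"
    using assms(2-6) by simp_all
  note I = invariant_harmonics(1)[OF rk assms(7,8) lam assms(9)[unfolded assms(2)]]
    and nz = invariant_harmonics(2)[OF rk assms(7,8) lam assms(9)[unfolded assms(2)]]
  have span: "V.span {\<phi>} = ?I" unfolding I by (rule V.span_singleton)
  then have mem: "\<phi> \<in> ?I" using V.span_base[of \<phi> "{\<phi>}"] by simp
  then have "V.dim ?I = 1"
    using nz span by (intro V.dim_unique[of "{\<phi>}"]) simp_all
  with span mem show ?thesis unfolding invariant_harmonics_SS_def by blast
qed

end
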